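(* Let $a\in(0,1/2)$ and let $e(F,\rho)$ be the unique minimal-rate directed metric among those for which the geodesic from $(0,0)$ to $(0,1)$ passes through $(1,a)$; $F$ consists of the segment from $(0,0)$ to $(1,a)$, a segment from $(1,a)$ to a point $(x_B,t_B)$ with $t_B>a$, and $F(t)=x_B\frac{\sqrt t-t}{\sqrt{t_B}-t_B}$ on $[t_B,1]$. Then the minimal rate is $$I=\frac{8}{3a^2(3-2\sqrt{2a})^2},$$ and $x_B=\frac{4(1-\sqrt{2a})}{3-2\sqrt{2a}}$, $t_B=2a$. In particular, as $a\to0$, $x_B\to\frac43$ and $I=\frac{8}{27a^2}+o(a^{-2})$.
   Context: Spacetime points are written $(x,t)$ with $x$ spatial and $t$ time. A directed metric is a continuous $e:\{(x,s,y,t):s<t\}\to\mathbb R\cup\{-\infty\}$ with $e(x,s,y,t)+e(y,t,z,u)\le e(x,s,z,u)$. The Dirichlet metric is $d(x,s,y,t)=-\frac{(y-x)^2}{t-s}$. For a curve $\gamma$ and nonnegative density $\rho$, $e_{\gamma,\rho}(x_1,t_1,x_2,t_2)=\int_{t_1}^{t_2}(\rho-\gamma'^2)dt$ if $x_i=\gamma(t_i)$, else $-\infty$. Finite-rate metrics arise from planting densities $\rho_i$ along countably many curves $\gamma_i$ (smallest directed metric $\ge d$ and $\ge$ each $e_{\gamma_i,\rho_i}$), with rate $I=\sum_i\frac43\int\rho_i^{3/2}$; other metrics have infinite rate. $e(F,\rho)$ is the metric from planting $\rho$ along the single curve $t\mapsto(F(t),t)$. Geodesics are paths whose length (infimum over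 partitions of sums of $e$ along consecutive points) equals the $e$-distance between their endpoints. *)

theory Defs
  imports "HOL-Analysis.Analysis" "HOL-Library.Landau_Symbols"
begin

text \<open>Spacetime points are (x,t). A metric-like object is a function
  e x s y t, meaningful only on the domain s < t, with values in ereal
  (the value +\<infinity> is excluded).\<close>

type_synonym dmetric = "real \<Rightarrow> real \<Rightarrow> real \<Rightarrow> real \<Rightarrow> ereal"

definition st_domain :: "(real \<times> real \<times> real \<times> real) set" where
  "st_domain = {(x, s, y, t). s < t}"

definition directed_metric :: "dmetric \<Rightarrow> bool" where
  "directed_metric e \<longleftrightarrow>
     continuous_on st_domain (\<lambda>(x, s, y, t). e x s y t) \<and>
     (\<forall>x s y t. s < t \<longrightarrow> e x s y t \<noteq> \<infinity>) \<and>
     (\<forall>x s y t z u. s < t \<longrightarrow> t < u \<longrightarrow> e x s y t + e y t z u \<le> e x s z u)"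

definition dle :: "dmetric \<Rightarrow> dmetric \<Rightarrow> bool" where
  "dle e e' \<longleftrightarrow> (\<forall>x s y t. s < t \<longrightarrow> e x s y t \<le> e' x s y t)"

definition deq :: "dmetric \<Rightarrow> dmetric \<Rightarrow> bool" where
  "deq e e' \<longleftrightarrow> (\<forall>x s y t. s < t \<longrightarrow> e x s y t = e' x s y t)"

definition dirichlet :: dmetric where
  "dirichlet x s y t = ereal (- ((y - x)\<^sup>2 / (t - s)))"

text \<open>Admissible planting data: a curve \<gamma> (t \<mapsto> (\<gamma> t, t)), a function g which is its
  derivative (\<gamma> is the indefinite integral of g), and a nonnegative density \<rho>.\<close>
definition admissible :: "(real \<Rightarrow> real) \<Rightarrow> (real \<Rightarrow> real) \<Rightarrow> (real \<Rightarrow> real) \<Rightarrow> bool" where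
  "admissible \<gamma> g \<rho> \<longleftrightarrow>
     (\<forall>t. 0 \<le> \<rho> t) \<and> \<rho> \<in> borel_measurable lborel \<and> g \<in> borel_measurable lborel \<and>
     (\<forall>a b. set_integrable lborel {a..b} \<rho>) \<and>
     (\<forall>a b. set_integrable lborel {a..b} g) \<and>
     (\<forall>s t. s \<le> t \<longrightarrow> \<gamma> t - \<gamma> s = (LINT u:{s..t}|lborel. g u))"

definition curve_metric :: "(real \<Rightarrow> real) \<Rightarrow> (real \<Rightarrow> real) \<Rightarrow> (real \<Rightarrow> real) \<Rightarrow> dmetric" where
  "curve_metric \<gamma> g \<rho> x1 t1 x2 t2 =
     (if x1 = \<gamma> t1 \<and> x2 = \<gamma> t2
      then ereal (LINT u:{t1..t2}|lborel. \<rho> u)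
             - enn2ereal (\<integral>\<^sup>+ u. ennreal ((g u)\<^sup>2) * indicator {t1..t2} u \<partial>lborel)
      else - \<infinity>)"

definition planted :: "dmetric \<Rightarrow> (nat \<Rightarrow> real \<Rightarrow> real) \<Rightarrow> (nat \<Rightarrow> real \<Rightarrow> real)
    \<Rightarrow> (nat \<Rightarrow> real \<Rightarrow> real) \<Rightarrow> bool" where
  "planted e \<Gamma> G R \<longleftrightarrow>
     directed_metric e \<and> dle dirichlet e \<and> (\<forall>i. dle (curve_metric (\<Gamma> i) (G i) (R i)) e) \<and>
     (\<forall>e'. directed_metric e' \<and> dle dirichlet e' \<and>
           (\<forall>i. dle (curve_metric (\<Gamma> i) (G i) (R i)) e') \<longrightarrow> dle e e')"

definition family_rate :: "(nat \<Rightarrow> real \<Rightarrow> real) \<Rightarrow> ennreal" where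
  "family_rate R = (\<Sum>i. ennreal (4/3) * (\<integral>\<^sup>+ t. ennreal (R i t powr (3/2)) \<partial>lborel))"

text \<open>Rate of a directed metric: infimum of the rates over all countable planting
  representations (\<infinity> if there is none).\<close>
definition rate :: "dmetric \<Rightarrow> ennreal" where
  "rate e = (INF (\<Gamma>, G, R) \<in> {(\<Gamma>, G, R). (\<forall>i. admissible (\<Gamma> i) (G i) (R i)) \<and> planted e \<Gamma> G R}.
               family_rate R)"

definition planted1 :: "dmetric \<Rightarrow> (real \<Rightarrow> real) \<Rightarrow> (real \<Rightarrow> real) \<Rightarrow> (real \<Rightarrow> real) \<Rightarrow> bool" where
  "planted1 e F g \<rho> \<longleftrightarrow> planted e (\<lambda>_. F) (\<lambda>_. g) (\<lambda>i. if i = 0 then \<rho> else (\<lambda>_. 0))"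

definition path_length :: "dmetric \<Rightarrow> (real \<Rightarrow> real) \<Rightarrow> real \<Rightarrow> real \<Rightarrow> ereal" where
  "path_length e \<pi> s t =
     (INF (k, ts) \<in> {(k::nat, ts::nat \<Rightarrow> real). 0 < k \<and> ts 0 = s \<and> ts k = t \<and>
                        (\<forall>i<k. ts i < ts (Suc i))}.
        (\<Sum>i<k. e (\<pi> (ts i)) (ts i) (\<pi> (ts (Suc i))) (ts (Suc i))))"

definition is_geodesic :: "dmetric \<Rightarrow> (real \<Rightarrow> real) \<Rightarrow> real \<Rightarrow> real \<Rightarrow> bool" where
  "is_geodesic e \<pi> s t \<longleftrightarrow> s < t \<and> continuous_on {s..t} \<pi> \<and>
     path_length e \<pi> s t = e (\<pi> s) s (\<pi> t) t"

definition through_metrics :: "real \<Rightarrow> dmetric set" where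
  "through_metrics a = {e. directed_metric e \<and>
     (\<exists>\<pi>. is_geodesic e \<pi> 0 1 \<and> \<pi> 0 = 0 \<and> \<pi> 1 = 0 \<and> \<pi> a = 1)}"

end

theory Submission
  imports Defs "HOL-Real_Asymp.Real_Asymp"
begin

text \<open>
  If the densities of a planting family are dominated by \<open>\<sigma>\<close>, the planted metric lies between the
  Dirichlet metric and the Dirichlet metric plus the integral of \<open>\<sigma>\<close>; it is the infimum of all
  superadditive functions above the planted data. Along a geodesic \<open>\<pi>\<close> through \<open>(1, a)\<close> let
  \<open>h t = \<pi> t / t\<close> and let \<open>z t \<ge> 0\<close> be the excess of \<open>e(0, 0; \<pi> t, t)\<close> over the Dirichlet value.
  Then \<open>z t - z s \<le> \<integral> \<sigma> - (h t - h s)\<^sup>2 / (1 / s - 1 / t)\<close>, and pairing \<open>\<sigma>\<close> with a decreasing weight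
  \<open>\<phi>\<close> gives \<open>\<integral> \<phi> \<sigma> \<ge> \<integral> \<phi> u\<^sup>2 (h')\<^sup>2 \<ge> (1 / a)\<^sup>2 / \<integral> 1 / (\<phi> u\<^sup>2)\<close> over \<open>[a, 1]\<close>. Choosing \<open>\<phi>\<close> as the square root of
  the optimal density, convexity of \<open>x powr (3/2)\<close> turns this into the sharp lower bound for the rate.

  For uniqueness, near-optimal representations of a minimiser force its geodesic to be \<open>F\<close> and, by the
  Bregman remainder of the convexity inequality, their densities to converge to the optimal one.
  The distances along \<open>F\<close> are then those of the optimal metric, which in turn forces almost all of the
  planted mass to sit on \<open>F\<close>, so that the minimiser cannot exceed the optimal metric either.
\<close>

section \<open>The Dirichlet metric and integrals over intervals\<close>

text \<open>The optimal density is read off from equality in the weighted argument. Equality needs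
  \<open>h' = - lam / (\<phi> u\<^sup>2)\<close> on \<open>[a, 1]\<close> for a constant
  \<open>lam\<close>, and \<open>z = 0\<close> wherever \<open>\<phi>\<close> strictly decreases.
  Where \<open>z\<close> stays \<open>0\<close>, the density equals
  \<open>u\<^sup>2 (h')\<^sup>2\<close>; being also \<open>\<phi>\<^sup>2\<close>, it gives
  \<open>\<phi>\<^sup>2 = lam / u\<close>. Before that \<open>\<phi>\<close> is a constant
  \<open>r\<close>: \<open>z\<close> grows at rate \<open>r\<^sup>2\<close> up to time
  \<open>a\<close>, where \<open>h\<close> is constant, and then at rate
  \<open>r\<^sup>2 - (lam / (r u))\<^sup>2\<close>. Continuity of \<open>\<phi>\<close> at
  \<open>t_B\<close> gives \<open>lam = r\<^sup>2 t_B\<close>, and the return of \<open>z\<close> to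
  \<open>0\<close> at \<open>t_B\<close> forces \<open>t_B = 2 a\<close>. The total drop
  \<open>1 / a\<close> of \<open>h\<close> then fixes \<open>r\<close>.

  Geodesics and the distances along them are not known to be differentiable. Differential
  inequalities are therefore replaced by inequalities on short intervals with a quadratic error,
  which disappears under subdivision. Upper bounds on a planted metric come from guessing a set of
  route values that is closed under concatenation.\<close>

definition dd :: "real \<Rightarrow> real \<Rightarrow> real \<Rightarrow> real \<Rightarrow> real" where
  "dd x s y t = - ((y - x)\<^sup>2 / (t - s))"

text \<open>For \<open>s = t\<close> the value is \<open>0\<close>, by \<open>x / 0 = 0\<close>; trivial time steps rely on this.\<close>

lemma dirichlet_eq: "dirichlet x s y t = ereal (dd x s y t)"
  by (simp add: dirichlet_def dd_def)

lemma dd_same_time [simp]: "dd x s y s = 0"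
  by (simp add: dd_def)

lemma dd_nonpos: "s \<le> t \<Longrightarrow> dd x s y t \<le> 0"
  by (simp add: dd_def)

lemma dd_superadd_strict:
  assumes "s < t" "t < u"
  shows "dd x s y t + dd y t z u \<le> dd x s z u"
proof -
  define A B where "A = t - s" and "B = u - t"
  have AB: "A > 0" "B > 0" "u - s = A + B" using assms by (auto simp: A_def B_def)
  define p w where "p = y - x" and "w = z - y"
  have pw: "z - x = p + w" by (simp add: p_def w_def)
  have "0 \<le> (p * B - w * A)\<^sup>2 / (A * B * (A + B))"
    using AB by (intro divide_nonneg_nonneg) auto
  also have "\<dots> = p\<^sup>2 / A + w\<^sup>2 / B - (p + w)\<^sup>2 / (A + B)"
    using AB by (simp add: divide_simps) (simp add: power2_eq_square algebra_simps)
  finally show ?thesis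
    unfolding dd_def AB(3) pw A_def[symmetric] B_def[symmetric] p_def[symmetric] w_def[symmetric] by linarith
qed

lemma dd_superadd:
  assumes "s \<le> t" "t \<le> u" "s = t \<Longrightarrow> x = y" "t = u \<Longrightarrow> y = z"
  shows "dd x s y t + dd y t z u \<le> dd x s z u"
  using dd_superadd_strict[of s t u x y z] assms by (cases "s = t"; cases "t = u") auto

text \<open>The witness is the point of the straight segment at time \<open>r\<close>; this is the
  equality case of superadditivity.\<close>

lemma dd_split:
  assumes "s < r" "r < t"
  shows "\<exists>z. dd x s y t = dd x s z r + dd z r y t"
proof -
  define A B where "A = r - s" and "B = t - r"
  have AB: "A > 0" "B > 0" "t - s = A + B" using assms by (auto simp: A_def B_def)
  define w where "w = (y - x) / (A + B)"
  define z where "z = x + w * A"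
  have 0: "y - x = w * (A + B)" using AB by (simp add: w_def)
  have 1: "z - x = w * A" by (simp add: z_def)
  have 2: "y - z = w * B" using 0 by (simp add: z_def algebra_simps)
  have "dd x s y t = dd x s z r + dd z r y t"
    unfolding dd_def 0 1 2 AB(3) A_def[symmetric] B_def[symmetric] using AB
    by (simp add: field_simps) (simp add: power2_eq_square algebra_simps)
  then show ?thesis by blast
qed

section \<open>Superadditivity and the subdivision principle\<close>

definition superadd :: "dmetric \<Rightarrow> bool" where
  "superadd D \<longleftrightarrow> (\<forall>x s y t z u. s < t \<longrightarrow> t < u \<longrightarrow> D x s y t + D y t z u \<le> D x s z u)"

lemma superaddD: "superadd D \<Longrightarrow> s < t \<Longrightarrow> t < u \<Longrightarrow> D x s y t + D y t z u \<le> D x s z u"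
  by (auto simp: superadd_def)

text \<open>Cutting \<open>[A, B]\<close> into \<open>n\<close> equal pieces bounds
  \<open>f A B\<close> by \<open>n\<close> errors of order \<open>1 / n\<^sup>2\<close>. The proof
  bisects instead: below a suitable length the quadratic bound lies under any linear one, and linear
  bounds survive concatenation.\<close>

lemma subdivide:
  fixes f :: "real \<Rightarrow> real \<Rightarrow> real"
  assumes sub: "\<And>s r t. A \<le> s \<Longrightarrow> s < r \<Longrightarrow> r < t \<Longrightarrow> t \<le> B \<Longrightarrow> f s t \<le> f s r + f r t"
    and d: "d > 0"
    and loc: "\<And>s t. A \<le> s \<Longrightarrow> s < t \<Longrightarrow> t \<le> B \<Longrightarrow> t - s < d \<Longrightarrow> f s t \<le> M * (t - s)\<^sup>2"
    and AB: "A < B"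
  shows "f A B \<le> 0"
proof -
  have "f A B \<le> e * (B - A)" if e: "e > 0" for e
  proof -
    define P where "P s t \<longleftrightarrow> (A \<le> s \<and> s < t \<and> t \<le> B \<longrightarrow> f s t \<le> e * (t - s))" for s t
    have "P A B"
    proof (rule Bolzano)
      show "A \<le> B" using AB by simp
    next
      fix s r t assume *: "P s r" "P r t" "s \<le> r" "r \<le> t"
      show "P s t"
      proof (cases "s = r \<or> r = t")
        case True then show ?thesis using * by auto
      next
        case False
        then have "s < r" "r < t" using * by auto
        then show ?thesis using * sub[of s r t] unfolding P_def by (auto simp: algebra_simps)
      qed
    next
      fix x assume "A \<le> x" "x \<le> B"
      define d' where "d' = min d (e / (\<bar>M\<bar> + 1))"
      have d': "d' > 0" "d' \<le> d" using d e by (auto simp: d'_def)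
      have "P s t" if "t - s < d'" for s t
        unfolding P_def
      proof safe
        assume st: "A \<le> s" "s < t" "t \<le> B"
        have "f s t \<le> M * (t - s)\<^sup>2" using loc[OF st] that d' by auto
        also have "\<dots> \<le> (\<bar>M\<bar> + 1) * (t - s)\<^sup>2"
          by (intro mult_right_mono) auto
        also have "\<dots> = ((\<bar>M\<bar> + 1) * (t - s)) * (t - s)" by (simp add: power2_eq_square)
        also have "\<dots> \<le> e * (t - s)"
        proof (intro mult_right_mono)
          have "t - s \<le> e / (\<bar>M\<bar> + 1)" using that by (auto simp: d'_def)
          then show "(\<bar>M\<bar> + 1) * (t - s) \<le> e" by (simp add: field_simps)
        qed (use st in auto)
        finally show "f s t \<le> e * (t - s)" .
      qed
      then show "\<exists>d>0. \<forall>a b. a \<le> x \<and> x \<le> b \<and> b - a < d \<longrightarrow> P a b" using d' by blast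
    qed
    then show ?thesis using AB by (simp add: P_def)
  qed
  note * = this
  show ?thesis
  proof (rule field_le_epsilon)
    fix e :: real assume "e > 0"
    then show "f A B \<le> 0 + e" using *[of "e / (B - A)"] AB by simp
  qed
qed

section \<open>Interval integrals of locally integrable functions\<close>

definition iv :: "(real \<Rightarrow> real) \<Rightarrow> real \<Rightarrow> real \<Rightarrow> real" where
  "iv f s t = (LINT u:{s..t}|lborel. f u)"

definition locint :: "(real \<Rightarrow> real) \<Rightarrow> bool" where
  "locint f \<longleftrightarrow> (\<forall>s t. set_integrable lborel {s..t} f)"

lemma locintD: "locint f \<Longrightarrow> set_integrable lborel {s..t} f"
  by (simp add: locint_def)

lemma locint_const [simp]: "locint (\<lambda>_. c)"
  by (auto simp: locint_def intro!: borel_integrable_atLeastAtMost' continuous_intros)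

lemma locint_zero [simp]: "locint (\<lambda>_. 0)" by (rule locint_const)

lemma locint_add [intro]: "locint f \<Longrightarrow> locint g \<Longrightarrow> locint (\<lambda>u. f u + g u)"
  by (auto simp: locint_def)

lemma locint_diff [intro]: "locint f \<Longrightarrow> locint g \<Longrightarrow> locint (\<lambda>u. f u - g u)"
  by (auto simp: locint_def)

lemma locint_cmult [intro]: "locint f \<Longrightarrow> locint (\<lambda>u. c * f u)"
  by (auto simp: locint_def)

lemma locint_abs [intro]: "locint f \<Longrightarrow> locint (\<lambda>u. \<bar>f u\<bar>)"
  by (auto simp: locint_def intro: set_integrable_abs)

lemma locint_bound:
  assumes "locint f" "g \<in> borel_measurable lborel" "\<And>u. \<bar>g u\<bar> \<le> \<bar>f u\<bar>"
  shows "locint g"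
  unfolding locint_def
proof safe
  fix s t
  show "set_integrable lborel {s..t} g"
    by (rule set_integrable_bound[OF locintD[OF assms(1), of s t]])
       (use assms in \<open>auto simp: set_borel_measurable_def\<close>)
qed

lemma iv_same [simp]: "iv f s s = 0"
  using set_integral_at_point[of _ s]  unfolding iv_def set_lebesgue_integral_def
  by (intro integral_eq_zero_AE) (use AE_lborel_singleton[of s] in \<open>eventually_elim, auto simp: indicator_def\<close>)


lemma iv_combine_on:
  assumes "set_integrable lborel {s..t} f" "s \<le> r" "r \<le> t"
  shows "iv f s r + iv f r t = iv f s t"
proof -
  have i: "set_integrable lborel {s..r} f" "set_integrable lborel {r..t} f"
    using assms by (auto intro: set_integrable_subset[OF assms(1)])
  show ?thesis
    unfolding iv_def assms(1)[THEN set_borel_integral_eq_integral(2)] i[THEN set_borel_integral_eq_integral(2)]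
    by (rule Henstock_Kurzweil_Integration.integral_combine)
       (use assms(2,3) set_borel_integral_eq_integral(1)[OF assms(1)] in auto)
qed

lemma iv_combine: "locint f \<Longrightarrow> s \<le> r \<Longrightarrow> r \<le> t \<Longrightarrow> iv f s r + iv f r t = iv f s t"
  by (rule iv_combine_on[OF locintD])

lemma iv_add: "locint f \<Longrightarrow> locint g \<Longrightarrow> iv (\<lambda>u. f u + g u) s t = iv f s t + iv g s t"
  by (simp add: iv_def locint_def)

lemma iv_diff: "locint f \<Longrightarrow> locint g \<Longrightarrow> iv (\<lambda>u. f u - g u) s t = iv f s t - iv g s t"
  by (simp add: iv_def locint_def)

lemma iv_cmult: "iv (\<lambda>u. c * f u) s t = c * iv f s t"
  by (simp add: iv_def)

lemma iv_const: "s \<le> t \<Longrightarrow> iv (\<lambda>_. c) s t = c * (t - s)"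
  by (simp add: iv_def set_integral_const)

lemma iv_mono: "locint f \<Longrightarrow> locint g \<Longrightarrow> (\<And>u. s \<le> u \<Longrightarrow> u \<le> t \<Longrightarrow> f u \<le> g u) \<Longrightarrow> iv f s t \<le> iv g s t"
  unfolding iv_def by (intro set_integral_mono) (auto intro: locintD)

lemma iv_mono_AE:
  assumes "locint f" "locint g" "AE u in lborel. s < u \<and> u < t \<longrightarrow> f u \<le> g u"
  shows "iv f s t \<le> iv g s t"
  unfolding iv_def
proof (intro set_integral_mono_AE)
  have "AE u in lborel. u \<noteq> s \<and> u \<noteq> t" 
    using AE_lborel_singleton[of s] AE_lborel_singleton[of t] by eventually_elim auto
  with assms(3) show "AE u\<in>{s..t} in lborel. f u \<le> g u" by eventually_elim auto
qed (use assms in \<open>auto intro: locintD\<close>)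

lemma iv_cong:
  assumes "\<And>u. s < u \<Longrightarrow> u < t \<Longrightarrow> f u = g u" "f \<in> borel_measurable lborel" "g \<in> borel_measurable lborel"
  shows "iv f s t = iv g s t"
  unfolding iv_def
proof (intro set_lebesgue_integral_cong_AE)
  have "AE u in lborel. u \<noteq> s \<and> u \<noteq> t" 
    using AE_lborel_singleton[of s] AE_lborel_singleton[of t] by eventually_elim auto
  then show "AE u\<in>{s..t} in lborel. f u = g u" by eventually_elim (use assms(1) in auto)
qed (use assms in auto)

lemma iv_nonneg: "(\<And>u. 0 \<le> f u) \<Longrightarrow> 0 \<le> iv f s t"
  unfolding iv_def set_lebesgue_integral_def by (intro integral_nonneg_AE) auto

lemma iv_mono_interval:
  assumes "locint f" "\<And>u. 0 \<le> f u" "s' \<le> s" "s \<le> t" "t \<le> t'"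
  shows "iv f s t \<le> iv f s' t'"
  using iv_combine[OF assms(1), of s' s t] iv_combine[OF assms(1), of s' t t'] iv_nonneg[of f s' s] iv_nonneg[of f t t'] assms
  by auto

lemma iv_continuous:
  assumes "locint f"
  shows "continuous_on {s..t} (\<lambda>u. iv f s u)"
proof -
  have "continuous_on {s..t} (\<lambda>u. integral {s..u} f)"
    by (rule indefinite_integral_continuous_1)
       (use set_borel_integral_eq_integral(1)[OF locintD[OF assms]] in auto)
  then show ?thesis
    unfolding iv_def using set_borel_integral_eq_integral(2)[OF locintD[OF assms]] by simp
qed

lemma iv_small:
  assumes f: "locint f" "\<And>u. 0 \<le> f u" and e: "e > 0"
  shows "\<exists>\<delta>0>0. \<forall>\<delta>. 0 < \<delta> \<and> \<delta> \<le> \<delta>0 \<longrightarrow> iv f (x - \<delta>) (x + \<delta>) < e"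
proof -
  have "isCont (\<lambda>u. iv f (x - 1) u) x"
    by (rule continuous_on_interior[OF iv_continuous[OF f(1), of "x - 1" "x + 1"]]) auto
  then obtain d where d: "d > 0" "\<And>y. \<bar>y - x\<bar> < d \<Longrightarrow> \<bar>iv f (x - 1) y - iv f (x - 1) x\<bar> < e / 2"
    using e unfolding continuous_at_eps_delta dist_real_def by (meson half_gt_zero)
  define D where "D = min (d / 2) 1"
  have D: "D > 0" "D < d" "D \<le> 1" using d by (auto simp: D_def)
  have "iv f (x - \<delta>) (x + \<delta>) < e" if "0 < \<delta>" "\<delta> \<le> D" for \<delta>
  proof -
    have "iv f (x - 1) (x - \<delta>) + iv f (x - \<delta>) (x + \<delta>) = iv f (x - 1) (x + \<delta>)"
      by (rule iv_combine[OF f(1)]) (use that D in auto)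
    moreover have "\<bar>iv f (x - 1) (x + \<delta>) - iv f (x - 1) x\<bar> < e / 2" "\<bar>iv f (x - 1) (x - \<delta>) - iv f (x - 1) x\<bar> < e / 2"
      by (rule d(2); use that D in linarith)+
    ultimately show ?thesis by linarith
  qed
  then show ?thesis using D by blast
qed

text \<open>Nonnegativity of the variance of \<open>g\<close> over the interval. For a curve with
  derivative \<open>g\<close> it says that the energy is at least that of the chord.\<close>

lemma iv_Cauchy_Schwarz:
  assumes g: "set_integrable lborel {s..t} g" and g2: "set_integrable lborel {s..t} (\<lambda>u. (g u)\<^sup>2)" and st: "s < t"
  shows "(iv g s t)\<^sup>2 / (t - s) \<le> iv (\<lambda>u. (g u)\<^sup>2) s t"
proof -
  define m where "m = iv g s t / (t - s)"
  have "0 \<le> (LINT u:{s..t}|lborel. (g u - m)\<^sup>2)"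
    unfolding set_lebesgue_integral_def by (intro integral_nonneg_AE) auto
  also have "(LINT u:{s..t}|lborel. (g u - m)\<^sup>2) = (LINT u:{s..t}|lborel. ((g u)\<^sup>2 - 2 * m * g u) + m\<^sup>2)"
    by (simp add: power2_eq_square algebra_simps)
  also have "\<dots> = iv (\<lambda>u. (g u)\<^sup>2) s t - 2 * m * iv g s t + m\<^sup>2 * (t - s)"
    using g g2 locintD[OF locint_const[of "m\<^sup>2"], of s t] st
    by (simp add: iv_def set_integral_const)
  also have "\<dots> = iv (\<lambda>u. (g u)\<^sup>2) s t - (iv g s t)\<^sup>2 / (t - s)"
  proof -
    have "iv g s t = m * (t - s)" using st by (simp add: m_def)
    then have "(iv g s t)\<^sup>2 / (t - s) = m * iv g s t" "m\<^sup>2 * (t - s) = m * iv g s t"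
      using st by (simp_all add: power2_eq_square)
    then show ?thesis by simp
  qed
  finally show ?thesis by simp
qed

section \<open>Planted metrics as smallest superadditive majorants\<close>

text \<open>The tool for upper bounds on planted metrics: \<open>T x s y t\<close> collects values
  of routes between two points. If concatenating two routes is always dominated by a third, the
  supremum is superadditive and only the planted data remain to be compared with it.\<close>

lemma superadd_SUP:
  fixes T :: "real \<Rightarrow> real \<Rightarrow> real \<Rightarrow> real \<Rightarrow> real set"
  assumes ne: "\<And>x s y t. s < t \<Longrightarrow> T x s y t \<noteq> {}"
    and T: "\<And>x s y t z u v w. s < t \<Longrightarrow> t < u \<Longrightarrow> v \<in> T x s y t \<Longrightarrow> w \<in> T y t z u \<Longrightarrow> \<exists>v'\<in>T x s z u. v + w \<le> v'"
  shows "superadd (\<lambda>x s y t. SUP v\<in>T x s y t. ereal v)"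
  unfolding superadd_def
proof safe
  fix x s y t z u :: real assume st: "s < t" "t < u"
  have "(SUP v\<in>T x s y t. ereal v) + ereal w \<le> (SUP v\<in>T x s z u. ereal v)" if w: "w \<in> T y t z u" for w
  proof -
    have "(SUP v\<in>T x s y t. ereal v) + ereal w = (SUP v\<in>T x s y t. ereal v + ereal w)"
      by (rule SUP_ereal_add_left[symmetric]) (use ne[OF st(1)] in auto)
    also have "\<dots> \<le> (SUP v\<in>T x s z u. ereal v)"
    proof (rule SUP_mono)
      fix v assume "v \<in> T x s y t"
      then show "\<exists>m\<in>T x s z u. ereal v + ereal w \<le> ereal m" using T[OF st _ w] by auto
    qed
    finally show ?thesis .
  qed
  note * = this
  have **: "(SUP v\<in>T x s y t. ereal v) \<noteq> -\<infinity>"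
  proof -
    obtain v where "v \<in> T x s y t" using ne[OF st(1)] by blast
    then have "ereal v \<le> (SUP v\<in>T x s y t. ereal v)" by (rule SUP_upper)
    then show ?thesis by auto
  qed
  have "(SUP v\<in>T x s y t. ereal v) + (SUP w\<in>T y t z u. ereal w) = (SUP w\<in>T y t z u. (SUP v\<in>T x s y t. ereal v) + ereal w)"
    by (rule SUP_ereal_add_right[symmetric]) (use ne[OF st(2)] ** in auto)
  also have "\<dots> \<le> (SUP v\<in>T x s z u. ereal v)"
    by (rule SUP_least) (use * in auto)
  finally show "(SUP v\<in>T x s y t. ereal v) + (SUP w\<in>T y t z u. ereal w) \<le> (SUP v\<in>T x s z u. ereal v)" .
qed

section \<open>Admissible curves and their curve metrics\<close>

lemma admissible_locint:
  assumes "admissible \<gamma> g \<rho>"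
  shows "locint \<rho>" "locint g"
  using assms by (auto simp: admissible_def locint_def)

lemma admissible_diff:
  assumes "admissible \<gamma> g \<rho>" "s \<le> t"
  shows "\<gamma> t - \<gamma> s = iv g s t"
  using assms by (auto simp: admissible_def iv_def)

lemma admissible_continuous:
  assumes "admissible \<gamma> g \<rho>"
  shows "continuous_on UNIV \<gamma>"
proof -
  have "isCont \<gamma> x" for x
  proof -
    have "continuous_on {x-1..x+1} (\<lambda>u. \<gamma> (x - 1) + iv g (x - 1) u)"
      by (intro continuous_intros iv_continuous admissible_locint[OF assms])
    moreover have "\<gamma> (x - 1) + iv g (x - 1) u = \<gamma> u" if "u \<in> {x-1..x+1}" for u
      using admissible_diff[OF assms, of "x - 1" u] that by auto
    ultimately have "continuous_on {x-1..x+1} \<gamma>" by (subst continuous_on_cong[OF refl, symmetric]) auto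
    then show ?thesis by (rule continuous_on_interior) auto
  qed
  then show ?thesis by (simp add: continuous_at_imp_continuous_on)
qed

text \<open>Infinite energy produces the same value \<open>-\<infinity>\<close> as endpoints off the
  curve, so the only other case is a real number with a square integrable derivative.\<close>

lemma curve_metric_cases:
  assumes "admissible \<gamma> g \<rho>"
  obtains "curve_metric \<gamma> g \<rho> x s y t = -\<infinity>"
  | "x = \<gamma> s" "y = \<gamma> t" "set_integrable lborel {s..t} (\<lambda>u. (g u)\<^sup>2)"
    "curve_metric \<gamma> g \<rho> x s y t = ereal (iv \<rho> s t - iv (\<lambda>u. (g u)\<^sup>2) s t)"
proof (cases "x = \<gamma> s \<and> y = \<gamma> t")
  case False
  then have "curve_metric \<gamma> g \<rho> x s y t = -\<infinity>" by (auto simp: curve_metric_def)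
  then show ?thesis using that(1) by blast
next
  case True
  let ?I = "\<integral>\<^sup>+ u. ennreal ((g u)\<^sup>2) * indicator {s..t} u \<partial>lborel"
  have [measurable]: "g \<in> borel_measurable borel" using assms by (simp add: admissible_def)
  have I: "?I = (\<integral>\<^sup>+ u. ennreal (indicator {s..t} u * (g u)\<^sup>2) \<partial>lborel)"
    by (intro nn_integral_cong) (auto simp: indicator_def)
  show ?thesis
  proof (cases "?I = \<infinity>")
    case T: True
    then show ?thesis using that(1) True by (simp add: curve_metric_def)
  next
    case False
    have i: "set_integrable lborel {s..t} (\<lambda>u. (g u)\<^sup>2)"
      unfolding set_integrable_def
      by (intro integrableI_nonneg) (use False I in \<open>auto simp: less_top\<close>)
    then have "?I = ennreal (iv (\<lambda>u. (g u)\<^sup>2) s t)"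
      unfolding I iv_def set_lebesgue_integral_def
      by (subst nn_integral_eq_integral) (auto simp: set_integrable_def)
    moreover have "0 \<le> iv (\<lambda>u. (g u)\<^sup>2) s t" by (rule iv_nonneg) auto
    ultimately show ?thesis using that(2) True i by (simp add: curve_metric_def iv_def)
  qed
qed

lemma curve_metric_eq:
  assumes "admissible \<gamma> g \<rho>" "set_integrable lborel {s..t} (\<lambda>u. (g u)\<^sup>2)"
  shows "curve_metric \<gamma> g \<rho> (\<gamma> s) s (\<gamma> t) t = ereal (iv \<rho> s t - iv (\<lambda>u. (g u)\<^sup>2) s t)"
proof -
  let ?I = "\<integral>\<^sup>+ u. ennreal ((g u)\<^sup>2) * indicator {s..t} u \<partial>lborel"
  have I: "?I = (\<integral>\<^sup>+ u. ennreal (indicator {s..t} u * (g u)\<^sup>2) \<partial>lborel)"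
    by (intro nn_integral_cong) (auto simp: indicator_def)
  have "?I = ennreal (iv (\<lambda>u. (g u)\<^sup>2) s t)"
    unfolding I iv_def set_lebesgue_integral_def
    by (subst nn_integral_eq_integral) (use assms(2) in \<open>auto simp: set_integrable_def\<close>)
  moreover have "0 \<le> iv (\<lambda>u. (g u)\<^sup>2) s t" by (rule iv_nonneg) auto
  ultimately show ?thesis by (simp add: curve_metric_def iv_def)
qed

lemma curve_le_dd:
  assumes "admissible \<gamma> g' \<rho>'" "s \<le> t" "set_integrable lborel {s..t} (\<lambda>u. (g' u)\<^sup>2)"
  shows "- iv (\<lambda>u. (g' u)\<^sup>2) s t \<le> dd (\<gamma> s) s (\<gamma> t) t"
proof (cases "s = t")
  case False
  then have st: "s < t" using assms by simp
  show ?thesis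
    using iv_Cauchy_Schwarz[OF locintD[OF admissible_locint(2)[OF assms(1)]] assms(3) st]
      admissible_diff[OF assms(1,2)] by (simp add: dd_def)
qed simp

definition majorant :: "(nat \<Rightarrow> real \<Rightarrow> real) \<Rightarrow> (nat \<Rightarrow> real \<Rightarrow> real) \<Rightarrow> (nat \<Rightarrow> real \<Rightarrow> real) \<Rightarrow> dmetric \<Rightarrow> bool" where
  "majorant \<Gamma> G R D \<longleftrightarrow> superadd D \<and> dle dirichlet D \<and> (\<forall>i. dle (curve_metric (\<Gamma> i) (G i) (R i)) D)"

text \<open>Continuity is not asked of the majorants: an infimum of superadditive majorants is again
  one, whereas an infimum of continuous functions may fail to be continuous. Continuity of this
  particular infimum is proved afterwards, and that makes it the planted metric.\<close>

definition planting :: "(nat \<Rightarrow> real \<Rightarrow> real) \<Rightarrow> (nat \<Rightarrow> real \<Rightarrow> real) \<Rightarrow> (nat \<Rightarrow> real \<Rightarrow> real) \<Rightarrow> dmetric" where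
  "planting \<Gamma> G R x s y t = (INF D\<in>Collect (majorant \<Gamma> G R). D x s y t)"

lemma planting_le: "majorant \<Gamma> G R D \<Longrightarrow> planting \<Gamma> G R x s y t \<le> D x s y t"
  unfolding planting_def by (rule INF_lower) auto

lemma majorant_planting: "majorant \<Gamma> G R (planting \<Gamma> G R)"
  unfolding majorant_def
proof safe
  show "superadd (planting \<Gamma> G R)"
    unfolding superadd_def
  proof safe
    fix x s y t z u :: real assume st: "s < t" "t < u"
    show "planting \<Gamma> G R x s y t + planting \<Gamma> G R y t z u \<le> planting \<Gamma> G R x s z u"
      unfolding planting_def[of _ _ _ x s z u]
    proof (rule INF_greatest)
      fix D assume D: "D \<in> Collect (majorant \<Gamma> G R)"
      have "planting \<Gamma> G R x s y t + planting \<Gamma> G R y t z u \<le> D x s y t + D y t z u"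
        using D by (intro add_mono planting_le) auto
      also have "\<dots> \<le> D x s z u" using D st by (auto simp: majorant_def superadd_def)
      finally show "planting \<Gamma> G R x s y t + planting \<Gamma> G R y t z u \<le> D x s z u" .
    qed
  qed
qed (auto simp: dle_def planting_def majorant_def intro!: INF_greatest)

text \<open>One locally integrable bound for all densities keeps the infimum finite however many
  curves there are. Domination is only almost everywhere because the bound used later is the
  envelope of the family.\<close>

locale dominated_planting =
  fixes \<Gamma> G R :: "nat \<Rightarrow> real \<Rightarrow> real" and \<sigma> :: "real \<Rightarrow> real"
  assumes adm: "\<And>i. admissible (\<Gamma> i) (G i) (R i)"
    and loc: "locint \<sigma>" and nonneg: "\<And>u. 0 \<le> \<sigma> u"
    and dom: "\<And>i. AE u in lborel. R i u \<le> \<sigma> u"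
begin

lemma upper_majorant: "majorant \<Gamma> G R (\<lambda>x s y t. ereal (dd x s y t + iv \<sigma> s t))"
  unfolding majorant_def superadd_def dle_def
proof safe
  fix x s y t z u :: real assume st: "s < t" "t < u"
  show "ereal (dd x s y t + iv \<sigma> s t) + ereal (dd y t z u + iv \<sigma> t u) \<le> ereal (dd x s z u + iv \<sigma> s u)"
    using dd_superadd_strict[OF st, of x y z] iv_combine[OF loc, of s t u] st by simp
next
  fix x s y t :: real assume st: "s < t"
  show "dirichlet x s y t \<le> ereal (dd x s y t + iv \<sigma> s t)"
    using iv_nonneg[OF nonneg] by (simp add: dirichlet_eq)
next
  fix i and x s y t :: real assume st: "s < t"
  show "curve_metric (\<Gamma> i) (G i) (R i) x s y t \<le> ereal (dd x s y t + iv \<sigma> s t)"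
  proof (cases rule: curve_metric_cases[OF adm[of i], of x s y t])
    case 2
    have "iv (R i) s t \<le> iv \<sigma> s t"
      by (rule iv_mono_AE[OF admissible_locint(1)[OF adm] loc]) (use dom[of i] in auto)
    then show ?thesis using curve_le_dd[OF adm less_imp_le[OF st] 2(3)] 2 by simp
  qed auto
qed

abbreviation clo :: dmetric where "clo \<equiv> planting \<Gamma> G R"

lemma clo_upper: "clo x s y t \<le> ereal (dd x s y t + iv \<sigma> s t)"
  by (rule planting_le[OF upper_majorant])

lemma clo_lower: "s < t \<Longrightarrow> ereal (dd x s y t) \<le> clo x s y t"
  using majorant_planting[of \<Gamma> G R] by (auto simp: majorant_def dle_def dirichlet_eq)

lemma clo_curve: "s < t \<Longrightarrow> curve_metric (\<Gamma> i) (G i) (R i) x s y t \<le> clo x s y t"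
  using majorant_planting[of \<Gamma> G R] by (auto simp: majorant_def dle_def)

lemma superadd_clo: "superadd clo"
  using majorant_planting[of \<Gamma> G R] by (simp add: majorant_def)

definition cl :: "real \<Rightarrow> real \<Rightarrow> real \<Rightarrow> real \<Rightarrow> real" where
  "cl x s y t = real_of_ereal (clo x s y t)"

lemma clo_eq: "s < t \<Longrightarrow> clo x s y t = ereal (cl x s y t)"
  using clo_upper[of x s y t] clo_lower[of s t x y] unfolding cl_def
  by (cases "clo x s y t") auto

lemma cl_upper: "s < t \<Longrightarrow> cl x s y t \<le> dd x s y t + iv \<sigma> s t"
  using clo_upper[of x s y t] clo_eq[of s t x y] by simp

lemma cl_lower: "s < t \<Longrightarrow> dd x s y t \<le> cl x s y t"
  using clo_lower[of s t x y] clo_eq[of s t x y] by simp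

lemma cl_superadd: "s < t \<Longrightarrow> t < u \<Longrightarrow> cl x s y t + cl y t z u \<le> cl x s z u"
  using superaddD[OF superadd_clo, of s t u x y z] clo_eq[of s t x y] clo_eq[of t u y z] clo_eq[of s u x z]
  by simp

text \<open>Forcing every route across time \<open>r\<close> to pause at a best point
  \<open>z\<close> yields a majorant again: Dirichlet segments split at the segment point and
  planted curves at \<open>\<Gamma> i r\<close>. Minimality of \<open>clo\<close> then bounds it by
  the supremum over \<open>z\<close>.\<close>

lemma midpoint:
  assumes "s < r" "r < t" "e > 0"
  shows "\<exists>z. cl x s y t < cl x s z r + cl z r y t + e"
proof -
  \<comment> \<open>Intervals without \<open>r\<close> in their interior keep the value
    \<open>cl\<close>, so that concatenation is closed both when \<open>r\<close> lies inside one
    half and when it is the junction time.\<close>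
  define T where "T x s y t = (if s < r \<and> r < t then {cl x s z r + cl z r y t |z. True} else {cl x s y t})" for x s y t
  have mem: "cl x s z r + cl z r y t \<in> T x s y t" if "s < r" "r < t" for x s y t z
    using that by (auto simp: T_def)
  define D where "D = (\<lambda>x s y t. SUP v\<in>T x s y t. ereal v)"
  have ub: "ereal v \<le> D x s y t" if "v \<in> T x s y t" for v x s y t
    unfolding D_def by (rule SUP_upper[OF that])
  have "majorant \<Gamma> G R D"
    unfolding majorant_def
  proof (intro conjI allI)
    show "superadd D" unfolding D_def
    proof (rule superadd_SUP)
      fix x s y t show "T x s y t \<noteq> {}" by (auto simp: T_def)
    next
      fix x s y t z u v w assume st: "s < t" "t < u" and v: "v \<in> T x s y t" and w: "w \<in> T y t z u"
      consider "s < r \<and> r < t" | "r = t" | "t < r \<and> r < u" | "\<not> (s < r \<and> r < u)" by linarith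
      then show "\<exists>v'\<in>T x s z u. v + w \<le> v'"
      proof cases
        case 1
        then obtain p where p: "v = cl x s p r + cl p r y t" using v by (auto simp: T_def)
        have "w = cl y t z u" using w 1 by (auto simp: T_def)
        then show ?thesis using mem[of s u x p z] 1 st cl_superadd[of r t u p y z] p
          by (intro bexI[of _ "cl x s p r + cl p r z u"]) auto
      next
        case 2
        then show ?thesis using mem[of s u x y z] st v w
          by (intro bexI[of _ "cl x s y r + cl y r z u"]) (auto simp: T_def)
      next
        case 3
        then obtain p where p: "w = cl y t p r + cl p r z u" using w by (auto simp: T_def)
        have "v = cl x s y t" using v 3 by (auto simp: T_def)
        then show ?thesis using mem[of s u x p z] 3 st cl_superadd[of s t r x y p] p
          by (intro bexI[of _ "cl x s p r + cl p r z u"]) auto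
      next
        case 4
        then show ?thesis using v w cl_superadd[OF st, of x y z] st
          by (intro bexI[of _ "cl x s z u"]) (auto simp: T_def split: if_splits)
      qed
    qed
    show "dle dirichlet D" unfolding dle_def
    proof safe
      fix x s y t :: real assume st: "s < t"
      show "dirichlet x s y t \<le> D x s y t"
      proof (cases "s < r \<and> r < t")
        case True
        then obtain z where z: "dd x s y t = dd x s z r + dd z r y t" using dd_split by blast
        have "dd x s y t \<le> cl x s z r + cl z r y t" using cl_lower True unfolding z by (intro add_mono) auto
        then show ?thesis using ub[OF mem[of s t x z y]] True
          by (auto simp: dirichlet_eq intro: order_trans[of _ "ereal (cl x s z r + cl z r y t)"])
      next
        case False
        then have "cl x s y t \<in> T x s y t" by (auto simp: T_def)
        from order_trans[OF _ ub[OF this]] show ?thesis using cl_lower[OF st, of x y] by (simp add: dirichlet_eq)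
      qed
    qed
    fix i
    show "dle (curve_metric (\<Gamma> i) (G i) (R i)) D" unfolding dle_def
    proof safe
      fix x s y t :: real assume st: "s < t"
      show "curve_metric (\<Gamma> i) (G i) (R i) x s y t \<le> D x s y t"
      proof (cases "s < r \<and> r < t")
        case True
        show ?thesis
        proof (cases rule: curve_metric_cases[OF adm[of i], of x s y t])
          case 2
          let ?g = "\<lambda>u. (G i u)\<^sup>2" and ?z = "\<Gamma> i r"
          have i: "set_integrable lborel {s..r} ?g" "set_integrable lborel {r..t} ?g"
            using True by (auto intro: set_integrable_subset[OF 2(3)])
          have c: "iv ?g s r + iv ?g r t = iv ?g s t"
            using True by (intro iv_combine_on[OF 2(3)]) auto
          have "ereal (iv (R i) s r - iv ?g s r) \<le> ereal (cl x s ?z r)"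
            using clo_curve[of s r i x ?z] clo_eq[of s r x ?z] curve_metric_eq[OF adm i(1)] True 2 by simp
          moreover have "ereal (iv (R i) r t - iv ?g r t) \<le> ereal (cl ?z r y t)"
            using clo_curve[of r t i ?z y] clo_eq[of r t ?z y] curve_metric_eq[OF adm i(2)] True 2 by simp
          ultimately have "iv (R i) s t - iv ?g s t \<le> cl x s ?z r + cl ?z r y t"
            using c iv_combine[OF admissible_locint(1)[OF adm[of i]], of s r t] True by simp
          then show ?thesis using ub[OF mem[of s t x ?z y]] True 2(4)
            by (auto intro: order_trans[of _ "ereal (cl x s ?z r + cl ?z r y t)"])
        qed auto
      next
        case False
        then have "cl x s y t \<in> T x s y t" by (auto simp: T_def)
        from order_trans[OF _ ub[OF this]] show ?thesis using clo_curve[OF st, of i x y] clo_eq[OF st, of x y] by simp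
      qed
    qed
  qed
  from planting_le[OF this, of x s y t] clo_eq[of s t x y] assms
  have "ereal (cl x s y t) \<le> D x s y t" by auto
  then have "ereal (cl x s y t - e) < D x s y t" using assms(3)
    by (cases "D x s y t") auto
  then obtain v where "v \<in> T x s y t" "cl x s y t - e < v" unfolding D_def less_SUP_iff by auto
  moreover from \<open>v \<in> T x s y t\<close> obtain z where "v = cl x s z r + cl z r y t"
    using assms(1,2) by (auto simp: T_def)
  ultimately show ?thesis by (intro exI[of _ z]) simp
qed

end

section \<open>Continuity of planted metrics through convexity\<close>

lemma convex_on_SUP_affine:
  fixes l :: "'i \<Rightarrow> 'a::real_vector \<Rightarrow> real"
  assumes C: "convex C"
    and aff: "\<And>z u v p q. u + v = 1 \<Longrightarrow> l z (u *\<^sub>R p + v *\<^sub>R q) = u * l z p + v * l z q"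
    and bdd: "\<And>p. p \<in> C \<Longrightarrow> bdd_above (range (\<lambda>z. l z p))"
  shows "convex_on C (\<lambda>p. SUP z. l z p)"
  unfolding convex_on_def
proof (intro conjI C ballI allI impI)
  fix p q and u v :: real assume *: "p \<in> C" "q \<in> C" "0 \<le> u" "0 \<le> v" "u + v = 1"
  show "(SUP z. l z (u *\<^sub>R p + v *\<^sub>R q)) \<le> u * (SUP z. l z p) + v * (SUP z. l z q)"
  proof (rule cSUP_least)
    fix z
    have "l z p \<le> (SUP z. l z p)" "l z q \<le> (SUP z. l z q)"
      using * by (auto intro!: cSUP_upper bdd)
    then show "l z (u *\<^sub>R p + v *\<^sub>R q) \<le> u * (SUP z. l z p) + v * (SUP z. l z q)"
      using * by (simp add: aff add_mono mult_left_mono)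
  qed simp
qed

text \<open>Completing the square in \<open>z\<close>. It keeps the supremum over \<open>z\<close>
  of the affine functions below finite.\<close>

lemma quadratic_bound:
  fixes \<alpha> \<beta> z :: real
  assumes "\<alpha> > 0"
  shows "2 * z * \<beta> - z\<^sup>2 * \<alpha> \<le> \<beta>\<^sup>2 / \<alpha>"
proof -
  have "0 \<le> (z * \<alpha> - \<beta>)\<^sup>2 / \<alpha>" using assms by simp
  also have "\<dots> = z\<^sup>2 * \<alpha> - 2 * z * \<beta> + \<beta>\<^sup>2 / \<alpha>"
    using assms by (simp add: field_simps power2_eq_square)
  finally show ?thesis by simp
qed

lemma dd_expand: "s < t \<Longrightarrow> dd x s z t = 2 * z * (x / (t - s)) - z\<^sup>2 * (1 / (t - s)) - x\<^sup>2 / (t - s)"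
  by (simp add: dd_def power2_diff minus_divide_left diff_divide_distrib add_divide_distrib algebra_simps)

lemma dd_expand': "s < t \<Longrightarrow> dd z s y t = 2 * z * (y / (t - s)) - z\<^sup>2 * (1 / (t - s)) - y\<^sup>2 / (t - s)"
  by (simp add: dd_def power2_diff minus_divide_left diff_divide_distrib add_divide_distrib algebra_simps)

context dominated_planting
begin

text \<open>Cutting off short initial and final time intervals changes the metric by little, and what
  remains is, up to a continuous term, a supremum of affine functions of
  \<open>1 / (r1 - s)\<close>, \<open>x / (r1 - s)\<close>, \<open>1 / (t - r2)\<close>, \<open>y / (t - r2)\<close>; being convex, it is continuous.\<close>
lemma cl_continuous: "continuous_on st_domain (\<lambda>(x, s, y, t). cl x s y t)"
proof (intro continuous_at_imp_continuous_on ballI)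
  fix P0 assume "P0 \<in> st_domain"
  then obtain x0 s0 y0 t0 where P0: "P0 = (x0, s0, y0, t0)" "s0 < t0" by (auto simp: st_domain_def)
  let ?f = "\<lambda>(x, s, y, t). cl x s y t"
  show "isCont ?f P0"
    unfolding isCont_def
  proof (rule tendstoI)
    fix e :: real assume e: "e > 0"
    obtain d1 where d1: "d1 > 0" "\<And>d. 0 < d \<Longrightarrow> d \<le> d1 \<Longrightarrow> iv \<sigma> (s0 - d) (s0 + d) < e / 8"
      using iv_small[OF loc nonneg, of "e / 8" s0] e by auto
    obtain d2 where d2: "d2 > 0" "\<And>d. 0 < d \<Longrightarrow> d \<le> d2 \<Longrightarrow> iv \<sigma> (t0 - d) (t0 + d) < e / 8"
      using iv_small[OF loc nonneg, of "e / 8" t0] e by auto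
    define d where "d = min (min d1 d2) ((t0 - s0) / 4)"
    have d: "d > 0" "d \<le> d1" "d \<le> d2" using d1 d2 P0 by (auto simp: d_def)
    have d4: "d \<le> (t0 - s0) / 4" unfolding d_def by (rule min.cobounded2)
    define r1 r2 where "r1 = s0 + d" and "r2 = t0 - d"
    have r: "s0 < r1" "r1 < r2" "r2 < t0" using d d4 P0 by (auto simp: r1_def r2_def)
    define M where "M = iv \<sigma> r1 r2"
    have M: "cl z1 r1 z2 r2 \<le> M" for z1 z2
      using cl_upper[OF r(2), of z1 z2] dd_nonpos[of r1 r2 z1 z2] r by (simp add: M_def)
    \<comment> \<open>Expanding \<open>dd x s z1 r1\<close> gives a function affine in
      \<open>\<alpha> = 1 / (r1 - s)\<close> and \<open>\<beta> = x / (r1 - s)\<close>, minus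
      \<open>x\<^sup>2 / (r1 - s)\<close>. The last term does not involve \<open>z1\<close>; it is
      left out here and subtracted in \<open>H\<close>. The end at \<open>r2\<close> is treated
      alike.\<close>
    define l :: "real \<times> real \<Rightarrow> real \<times> real \<times> real \<times> real \<Rightarrow> real" where
      "l = (\<lambda>(z1, z2) (\<alpha>, \<beta>, \<alpha>', \<beta>'). (2 * z1 * \<beta> - z1\<^sup>2 * \<alpha>) + cl z1 r1 z2 r2 + (2 * z2 * \<beta>' - z2\<^sup>2 * \<alpha>'))"
    define K where "K p = (SUP z. l z p)" for p
    define C where "C = {p::real \<times> real \<times> real \<times> real. fst p > 0 \<and> fst (snd (snd p)) > 0}"
    have Copen: "open C" unfolding C_def
      by (intro open_Collect_conj open_Collect_less continuous_intros)
    have Cconvex: "convex C"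
    proof -
      have "0 < u * a + v * b" if "0 < a" "0 < b" "0 \<le> u" "0 \<le> v" "u + v = 1" for a b u v :: real
        using that by (cases "u = 0") (auto intro: add_pos_nonneg)
      then show ?thesis unfolding convex_def C_def by auto
    qed
    have bdd: "bdd_above (range (\<lambda>z. l z p))" if "p \<in> C" for p
    proof -
      obtain \<alpha> \<beta> \<alpha>' \<beta>' where p: "p = (\<alpha>, \<beta>, \<alpha>', \<beta>')" by (cases p) auto
      have "\<alpha> > 0" "\<alpha>' > 0" using that by (auto simp: C_def p)
      then have "l z p \<le> \<beta>\<^sup>2 / \<alpha> + M + \<beta>'\<^sup>2 / \<alpha>'" for z
        unfolding l_def p by (auto split: prod.split intro!: add_mono M quadratic_bound)
      then show ?thesis by (intro bdd_aboveI2)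
    qed
    have "convex_on C K" unfolding K_def
    proof (rule convex_on_SUP_affine[OF Cconvex _ bdd])
      fix z p q and u v :: real assume uv: "u + v = 1"
      have v: "v = 1 - u" using uv by simp
      show "l z (u *\<^sub>R p + v *\<^sub>R q) = u * l z p + v * l z q"
        unfolding v by (cases z; cases p; cases q) (auto simp: l_def algebra_simps)
    qed
    then have Kcont: "continuous_on C K" by (rule convex_on_continuous[OF Copen])
    define g where "g = (\<lambda>P::real \<times> real \<times> real \<times> real. (1 / (r1 - fst (snd P)), fst P / (r1 - fst (snd P)),
        1 / (snd (snd (snd P)) - r2), fst (snd (snd P)) / (snd (snd (snd P)) - r2)))"
    define H where "H P = K (g P) - (fst P)\<^sup>2 / (r1 - fst (snd P)) - (fst (snd (snd P)))\<^sup>2 / (snd (snd (snd P)) - r2)" for P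
    have Hcont: "isCont H P0"
    proof -
      have "isCont g P0" unfolding g_def using r P0
        by (intro continuous_intros) auto
      moreover have "isCont K (g P0)"
        using Kcont Copen r P0 by (subst (asm) continuous_on_eq_continuous_at) (auto simp: C_def g_def)
      ultimately have "isCont (\<lambda>P. K (g P)) P0" by (rule isCont_o2)
      then show ?thesis unfolding H_def using r P0
        by (intro continuous_intros) auto
    qed
    \<comment> \<open>The lower bound is superadditivity. The upper bound loses
      \<open>e / 16\<close> at each of two midpoints and \<open>e / 8\<close> for each outer
      interval, where \<open>cl\<close> is replaced by \<open>dd\<close>; together this is below
      \<open>e / 2\<close>.\<close>
    have approx: "H (x, s, y, t) \<le> cl x s y t \<and> cl x s y t \<le> H (x, s, y, t) + e / 2"
      if st: "s0 - d < s" "s < r1" "r2 < t" "t < t0 + d" for x s y t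
    proof -
      have gC: "g (x, s, y, t) \<in> C" using st by (auto simp: g_def C_def)
      have lg: "l (z1, z2) (g (x, s, y, t)) = dd x s z1 r1 + cl z1 r1 z2 r2 + dd z2 r2 y t + x\<^sup>2 / (r1 - s) + y\<^sup>2 / (t - r2)" for z1 z2
        using st by (simp add: l_def g_def dd_expand dd_expand')
      have 1: "H (x, s, y, t) \<le> cl x s y t"
      proof -
        have "K (g (x, s, y, t)) \<le> cl x s y t + x\<^sup>2 / (r1 - s) + y\<^sup>2 / (t - r2)"
          unfolding K_def
        proof (rule cSUP_least)
          fix z :: "real \<times> real"
          obtain z1 z2 where z: "z = (z1, z2)" by (cases z)
          have "dd x s z1 r1 + cl z1 r1 z2 r2 + dd z2 r2 y t \<le> cl x s z1 r1 + cl z1 r1 z2 r2 + cl z2 r2 y t"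
            using st by (intro add_mono cl_lower) auto
          also have "\<dots> \<le> cl x s y t"
            using cl_superadd[of s r1 r2 x z1 z2] cl_superadd[of s r2 t x z2 y] st r by simp
          finally show "l z (g (x, s, y, t)) \<le> cl x s y t + x\<^sup>2 / (r1 - s) + y\<^sup>2 / (t - r2)"
            by (simp add: z lg)
        qed simp
        then show ?thesis by (simp add: H_def)
      qed
      obtain z1 where z1: "cl x s y t < cl x s z1 r1 + cl z1 r1 y t + e / 16"
        using midpoint[of s r1 t "e / 16" x y] st r e by auto
      obtain z2 where z2: "cl z1 r1 y t < cl z1 r1 z2 r2 + cl z2 r2 y t + e / 16"
        using midpoint[of r1 r2 t "e / 16" z1 y] st r e by auto
      have "cl x s z1 r1 \<le> dd x s z1 r1 + iv \<sigma> s r1" "cl z2 r2 y t \<le> dd z2 r2 y t + iv \<sigma> r2 t"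
        using st by (auto intro: cl_upper)
      moreover have "iv \<sigma> s r1 \<le> iv \<sigma> (s0 - d) (s0 + d)" "iv \<sigma> r2 t \<le> iv \<sigma> (t0 - d) (t0 + d)"
        using st by (auto intro!: iv_mono_interval loc nonneg simp: r1_def r2_def)
      moreover have "iv \<sigma> (s0 - d) (s0 + d) < e / 8" "iv \<sigma> (t0 - d) (t0 + d) < e / 8"
        using d d1 d2 by auto
      ultimately have "cl x s y t \<le> (dd x s z1 r1 + cl z1 r1 z2 r2 + dd z2 r2 y t) + e / 2"
        using z1 z2 e by simp
      moreover have "l (z1, z2) (g (x, s, y, t)) \<le> K (g (x, s, y, t))"
        unfolding K_def by (intro cSUP_upper bdd gC) auto
      ultimately show ?thesis using 1 by (simp add: H_def lg)
    qed
    have "\<forall>\<^sub>F P in at P0. dist (H P) (H P0) < e / 4"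
      using Hcont e unfolding isCont_def by (intro tendstoD) auto
    moreover have "\<forall>\<^sub>F P in at P0. s0 - d < fst (snd P) \<and> fst (snd P) < r1"
    proof -
      have "((\<lambda>P. fst (snd P)) \<longlongrightarrow> s0) (at P0)"
        using P0 by (auto intro!: tendsto_eq_intros)
      then show ?thesis using r d by (intro eventually_conj order_tendstoD) auto
    qed
    moreover have "\<forall>\<^sub>F P in at P0. r2 < snd (snd (snd P)) \<and> snd (snd (snd P)) < t0 + d"
    proof -
      have "((\<lambda>P. snd (snd (snd P))) \<longlongrightarrow> t0) (at P0)"
        using P0 by (auto intro!: tendsto_eq_intros)
      then show ?thesis using r d by (intro eventually_conj order_tendstoD) auto
    qed
    ultimately show "\<forall>\<^sub>F P in at P0. dist (?f P) (?f P0) < e"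
    proof eventually_elim
      case (elim P)
      obtain x s y t where P: "P = (x, s, y, t)" by (cases P) auto
      have "H P \<le> cl x s y t \<and> cl x s y t \<le> H P + e / 2"
        unfolding P by (rule approx) (use elim in \<open>auto simp: P\<close>)
      moreover have "H P0 \<le> cl x0 s0 y0 t0 \<and> cl x0 s0 y0 t0 \<le> H P0 + e / 2"
        unfolding P0 by (rule approx) (use d r in auto)
      ultimately show ?case using elim(1) e unfolding P P0 dist_real_def prod.case by linarith
    qed
  qed
qed

lemma directed_clo: "directed_metric clo"
  unfolding directed_metric_def
proof (intro conjI allI impI)
  have "continuous_on st_domain (\<lambda>P. ereal ((\<lambda>(x, s, y, t). cl x s y t) P))"
    by (intro continuous_on_ereal cl_continuous)
  then show "continuous_on st_domain (\<lambda>(x, s, y, t). clo x s y t)"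
    by (rule continuous_on_eq) (auto simp: st_domain_def clo_eq)
next
  fix x s y t z u :: real assume "s < t" "t < u"
  then show "clo x s y t + clo y t z u \<le> clo x s z u" by (rule superaddD[OF superadd_clo])
qed (simp add: clo_eq)

lemma planted_clo: "planted clo \<Gamma> G R"
  unfolding planted_def
proof (intro conjI allI impI)
  fix e' assume "directed_metric e' \<and> dle dirichlet e' \<and> (\<forall>i. dle (curve_metric (\<Gamma> i) (G i) (R i)) e')"
  then have "majorant \<Gamma> G R e'" by (auto simp: majorant_def superadd_def directed_metric_def)
  then show "dle clo e'" by (auto simp: dle_def planting_le)
qed (use directed_clo majorant_planting[of \<Gamma> G R] in \<open>auto simp: majorant_def\<close>)

text \<open>Both metrics are smallest among the same competitors. Hence any representation may be
  replaced by the explicit infimum.\<close>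

lemma planted_eq_clo:
  assumes "planted e \<Gamma> G R" "s < t"
  shows "e x s y t = clo x s y t"
proof -
  have "dle e clo" "dle clo e" using assms(1) planted_clo unfolding planted_def by blast+
  then show ?thesis using assms(2) by (auto simp: dle_def intro: antisym)
qed

end

section \<open>Densities with finite three-halves power\<close>

lemma powr_three_halves: "0 \<le> (x::real) \<Longrightarrow> x powr (3/2) = x * sqrt x"
  using powr_add[of x 1 "1/2"] by (simp add: powr_half_sqrt)

definition L32 :: "(real \<Rightarrow> real) \<Rightarrow> bool" where
  "L32 \<sigma> \<longleftrightarrow> (\<forall>u. 0 \<le> \<sigma> u) \<and> \<sigma> \<in> borel_measurable lborel \<and> integrable lborel (\<lambda>u. \<sigma> u powr (3/2))"

definition I32 :: "(real \<Rightarrow> real) \<Rightarrow> real" where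
  "I32 \<sigma> = (LINT u|lborel. \<sigma> u powr (3/2))"

lemma I32_nonneg: "0 \<le> I32 \<sigma>"
  unfolding I32_def by (intro integral_nonneg_AE) auto

lemma le_one_plus_powr: "0 \<le> (x::real) \<Longrightarrow> x \<le> 1 + x powr (3/2)"
proof (cases "x \<le> 1")
  case False
  assume "0 \<le> x"
  have "x * 1 \<le> x * sqrt x" using False by (intro mult_left_mono) auto
  then show ?thesis using powr_three_halves[OF \<open>0 \<le> x\<close>] by linarith
qed (simp add: add_increasing2)

lemma L32_locint:
  assumes "L32 \<sigma>"
  shows "locint \<sigma>"
proof (rule locint_bound[of "\<lambda>u. 1 + \<sigma> u powr (3/2)"])
  have "locint (\<lambda>u. \<sigma> u powr (3/2))"
    unfolding locint_def set_integrable_def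
    by (intro allI integrable_mult_indicator) (use assms in \<open>auto simp: L32_def\<close>)
  then show "locint (\<lambda>u. 1 + \<sigma> u powr (3/2))" by (intro locint_add) auto
qed (use assms le_one_plus_powr in \<open>auto simp: L32_def intro!: add_nonneg_nonneg\<close>)

text \<open>The Bregman divergence of \<open>x powr (3/2)\<close>: the amount by which its value at
  \<open>x\<close> exceeds the tangent taken at \<open>y\<close>.\<close>

definition bregman :: "real \<Rightarrow> real \<Rightarrow> real" where
  "bregman x y = x powr (3/2) + y powr (3/2) / 2 - 3/2 * (x * sqrt y)"

lemma bregman_eq:
  assumes "0 \<le> x" "0 \<le> y"
  shows "bregman x y = (sqrt x - sqrt y)\<^sup>2 * (sqrt x + sqrt y / 2)"
proof -
  define p q where "p = sqrt x" and "q = sqrt y"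
  have xy: "x = p\<^sup>2" "y = q\<^sup>2" "0 \<le> p" "0 \<le> q" using assms by (auto simp: p_def q_def)
  show ?thesis unfolding bregman_def powr_three_halves[OF assms(1)] powr_three_halves[OF assms(2)]
    using xy(3,4) by (simp add: xy(1,2) power2_eq_square algebra_simps real_sqrt_mult)
qed

lemma bregman_nonneg: "0 \<le> x \<Longrightarrow> 0 \<le> y \<Longrightarrow> 0 \<le> bregman x y"
  by (simp add: bregman_eq)

text \<open>With \<open>p = sqrt x\<close> and \<open>q = sqrt y\<close>, write
  \<open>\<bar>x - y\<bar> = \<bar>p - q\<bar> * (p + q)\<close> and apply Young's inequality with
  parameter \<open>\<mu>\<close> to \<open>\<bar>p - q\<bar>\<close>. The quadratic part is absorbed
  by the divergence, the remainder by the three-halves powers.\<close>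

lemma abs_diff_le_bregman:
  assumes "0 \<le> x" "0 \<le> y" "0 < \<mu>"
  shows "\<bar>x - y\<bar> \<le> bregman x y / \<mu> + \<mu> / 2 * (2 + x powr (3/2) + y powr (3/2))"
proof -
  define p q where "p = sqrt x" and "q = sqrt y"
  have xy: "x = p\<^sup>2" "y = q\<^sup>2" "0 \<le> p" "0 \<le> q" using assms by (auto simp: p_def q_def)
  have "0 \<le> (\<bar>p - q\<bar> - \<mu>)\<^sup>2 / (2 * \<mu>)" using assms by simp
  also have "\<dots> = (p - q)\<^sup>2 / (2 * \<mu>) + \<mu> / 2 - \<bar>p - q\<bar>"
    using assms(3) by (simp add: power2_diff field_simps) (simp add: power2_eq_square)
  finally have 1: "\<bar>p - q\<bar> \<le> (p - q)\<^sup>2 / (2 * \<mu>) + \<mu> / 2" by simp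
  have b: "(p - q)\<^sup>2 * (p + q) / 2 \<le> bregman x y"
  proof -
    have "(p - q)\<^sup>2 * ((p + q) / 2) \<le> (p - q)\<^sup>2 * (p + q / 2)"
      using xy by (intro mult_left_mono) auto
    then show ?thesis using assms by (simp add: bregman_eq p_def q_def)
  qed
  have "p \<le> 1 + p powr 3" if "0 \<le> p" for p :: real
  proof (cases "p \<le> 1")
    case False
    then have "p powr 1 \<le> p powr 3" by (intro powr_mono) auto
    then show ?thesis using False by simp
  qed (simp add: add_increasing2)
  note cube = this
  have "x powr (3/2) = p powr 3" "y powr (3/2) = q powr 3"
    using assms by (auto simp: p_def q_def powr_half_sqrt[symmetric] powr_powr)
  then have pq: "p + q \<le> 2 + x powr (3/2) + y powr (3/2)"
    using cube[OF xy(3)] cube[OF xy(4)] by simp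
  have "\<bar>x - y\<bar> = \<bar>p - q\<bar> * (p + q)"
  proof -
    have "x - y = (p - q) * (p + q)" by (simp add: xy power2_eq_square algebra_simps)
    then show ?thesis using xy by (simp add: abs_mult)
  qed
  also have "\<dots> \<le> ((p - q)\<^sup>2 / (2 * \<mu>) + \<mu> / 2) * (p + q)"
    using 1 xy by (intro mult_right_mono) auto
  also have "\<dots> = ((p - q)\<^sup>2 * (p + q) / 2) / \<mu> + \<mu> / 2 * (p + q)"
    using assms(3) by (simp add: field_simps)
  also have "\<dots> \<le> bregman x y / \<mu> + \<mu> / 2 * (2 + x powr (3/2) + y powr (3/2))"
    using b pq assms(3) by (intro add_mono[OF divide_right_mono mult_left_mono]) auto
  finally show ?thesis .
qed

lemma integrable_mult_sqrt:
  assumes "L32 \<sigma>" "L32 \<theta>"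
  shows "integrable lborel (\<lambda>u. \<sigma> u * sqrt (\<theta> u))"
proof (rule Bochner_Integration.integrable_bound[of _ "\<lambda>u. \<sigma> u powr (3/2) + \<theta> u powr (3/2)"])
  show "AE u in lborel. norm (\<sigma> u * sqrt (\<theta> u)) \<le> norm (\<sigma> u powr (3/2) + \<theta> u powr (3/2))"
  proof (rule AE_I2)
    fix u
    have nn: "0 \<le> \<sigma> u" "0 \<le> \<theta> u" using assms by (auto simp: L32_def)
    have "\<sigma> u * sqrt (\<theta> u) \<le> \<sigma> u * sqrt (\<sigma> u) + \<theta> u * sqrt (\<theta> u)"
    proof (cases "\<theta> u \<le> \<sigma> u")
      case True
      then have "\<sigma> u * sqrt (\<theta> u) \<le> \<sigma> u * sqrt (\<sigma> u)" using nn by (intro mult_left_mono) auto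
      then show ?thesis using nn by (simp add: add_increasing2)
    next
      case False
      then have "\<sigma> u * sqrt (\<theta> u) \<le> \<theta> u * sqrt (\<theta> u)" using nn by (intro mult_right_mono) auto
      then show ?thesis using nn by (simp add: add_increasing)
    qed
    then show "norm (\<sigma> u * sqrt (\<theta> u)) \<le> norm (\<sigma> u powr (3/2) + \<theta> u powr (3/2))"
      using nn by (simp add: powr_three_halves)
  qed
qed (use assms in \<open>auto simp: L32_def\<close>)

lemma integrable_bregman:
  assumes "L32 \<sigma>" "L32 \<theta>"
  shows "integrable lborel (\<lambda>u. bregman (\<sigma> u) (\<theta> u))"
  unfolding bregman_def using integrable_mult_sqrt[OF assms] assms by (auto simp: L32_def)

lemma integral_bregman:
  assumes "L32 \<sigma>" "L32 \<theta>"
  shows "(LINT u|lborel. bregman (\<sigma> u) (\<theta> u)) = I32 \<sigma> + I32 \<theta> / 2 - 3/2 * (LINT u|lborel. \<sigma> u * sqrt (\<theta> u))"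
  unfolding bregman_def I32_def using integrable_mult_sqrt[OF assms] assms by (simp add: L32_def)

lemma integral_bregman_nonneg:
  assumes "L32 \<sigma>" "L32 \<theta>"
  shows "0 \<le> (LINT u|lborel. bregman (\<sigma> u) (\<theta> u))"
  using assms by (intro integral_nonneg_AE) (auto simp: L32_def intro!: bregman_nonneg)

lemma L32_zero [simp]: "L32 (\<lambda>_. 0)" and I32_zero [simp]: "I32 (\<lambda>_. 0) = 0"
  by (simp_all add: L32_def I32_def)

lemma iv_le_integral:
  assumes "integrable lborel f" "\<And>u. 0 \<le> f u"
  shows "iv f s t \<le> (LINT u|lborel. f u)"
  unfolding iv_def set_lebesgue_integral_def
  by (intro integral_mono integrable_mult_indicator assms) (auto simp: indicator_def assms)

lemma integrable_locint: "integrable lborel f \<Longrightarrow> locint f"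
  unfolding locint_def set_integrable_def by (intro allI integrable_mult_indicator) auto

lemma L1_le_bregman:
  assumes \<sigma>: "L32 \<sigma>" and \<theta>: "L32 \<theta>" and st: "s \<le> t" and \<mu>: "\<mu> > 0"
  shows "iv (\<lambda>u. \<bar>\<sigma> u - \<theta> u\<bar>) s t \<le>
    (LINT u|lborel. bregman (\<sigma> u) (\<theta> u)) / \<mu> + \<mu> / 2 * (2 * (t - s) + I32 \<sigma> + I32 \<theta>)"
proof -
  note ib = integrable_bregman[OF \<sigma> \<theta>]
  have i: "integrable lborel (\<lambda>u. \<sigma> u powr (3/2))" "integrable lborel (\<lambda>u. \<theta> u powr (3/2))"
    using \<sigma> \<theta> by (auto simp: L32_def)
  note l = integrable_locint[OF ib] integrable_locint[OF i(1)] integrable_locint[OF i(2)]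
  let ?h = "\<lambda>u. 1 / \<mu> * bregman (\<sigma> u) (\<theta> u) + (\<mu> / 2) * (2 + \<sigma> u powr (3/2) + \<theta> u powr (3/2))"
  have "iv (\<lambda>u. \<bar>\<sigma> u - \<theta> u\<bar>) s t \<le> iv ?h s t"
  proof (rule iv_mono)
    show "locint (\<lambda>u. \<bar>\<sigma> u - \<theta> u\<bar>)" using \<sigma> \<theta> by (intro locint_abs locint_diff L32_locint)
    show "locint ?h" by (intro locint_add locint_cmult l locint_const)
    show "\<bar>\<sigma> u - \<theta> u\<bar> \<le> ?h u" for u
      using abs_diff_le_bregman[of "\<sigma> u" "\<theta> u" \<mu>] \<sigma> \<theta> \<mu> by (simp add: L32_def)
  qed
  also have "\<dots> = 1 / \<mu> * iv (\<lambda>u. bregman (\<sigma> u) (\<theta> u)) s t + \<mu> / 2 * (2 * (t - s) + iv (\<lambda>u. \<sigma> u powr (3/2)) s t + iv (\<lambda>u. \<theta> u powr (3/2)) s t)"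
    using st by (simp add: iv_add iv_cmult locint_add locint_cmult l iv_const del: times_divide_eq_left)
  also have "\<dots> \<le> 1 / \<mu> * (LINT u|lborel. bregman (\<sigma> u) (\<theta> u)) + \<mu> / 2 * (2 * (t - s) + I32 \<sigma> + I32 \<theta>)"
    using \<mu> i \<sigma> \<theta> ib unfolding I32_def
    by (intro add_mono mult_left_mono iv_le_integral order_refl) (auto simp: L32_def bregman_nonneg)
  finally show ?thesis by simp
qed

text \<open>A divergence of size \<open>\<mu>\<^sup>2\<close> gives an L1 distance of order
  \<open>\<mu>\<close> on bounded intervals. This turns near-optimal rates into closeness of the
  integrals that enter the metrics.\<close>

lemma L1_small:
  assumes \<sigma>: "L32 \<sigma>" and \<theta>: "L32 \<theta>" and st: "s \<le> t" and \<mu>: "\<mu> > 0"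
    and B: "(LINT u|lborel. bregman (\<sigma> u) (\<theta> u)) \<le> \<mu>\<^sup>2" and I: "I32 \<sigma> + I32 \<theta> \<le> 2 * N"
  shows "iv (\<lambda>u. \<bar>\<sigma> u - \<theta> u\<bar>) s t \<le> \<mu> * (1 + N + (t - s))"
proof -
  have "iv (\<lambda>u. \<bar>\<sigma> u - \<theta> u\<bar>) s t \<le> \<mu>\<^sup>2 / \<mu> + \<mu> / 2 * (2 * (t - s) + 2 * N)"
  proof (rule order_trans[OF L1_le_bregman[OF \<sigma> \<theta> st \<mu>]], intro add_mono[OF divide_right_mono mult_left_mono])
    show "2 * (t - s) + I32 \<sigma> + I32 \<theta> \<le> 2 * (t - s) + 2 * N" using I by simp
  qed (use B \<mu> in auto)
  also have "\<dots> = \<mu> * (1 + N + (t - s))" using \<mu> by (simp add: power2_eq_square algebra_simps)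
  finally show ?thesis .
qed

text \<open>The pointwise three-halves norm of the whole family: one density that dominates every
  \<open>R i\<close> and has exactly the rate of the family. At times where the sum is infinite
  \<open>enn2real\<close> returns \<open>0\<close>, so domination holds only almost
  everywhere.\<close>

definition envelope :: "(nat \<Rightarrow> real \<Rightarrow> real) \<Rightarrow> real \<Rightarrow> real" where
  "envelope R u = enn2real (\<Sum>i. ennreal (R i u powr (3/2))) powr (2/3)"

definition weights :: "(nat \<Rightarrow> real \<Rightarrow> real) \<Rightarrow> bool" where
  "weights R \<longleftrightarrow> (\<forall>i. (\<forall>u. 0 \<le> R i u) \<and> R i \<in> borel_measurable lborel)"

lemma family_rate_eq:
  assumes "weights R"
  shows "family_rate R = ennreal (4/3) * (\<integral>\<^sup>+ u. (\<Sum>i. ennreal (R i u powr (3/2))) \<partial>lborel)"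
proof -
  have [measurable]: "\<And>i. R i \<in> borel_measurable borel" using assms by (auto simp: weights_def)
  show ?thesis unfolding family_rate_def by (subst nn_integral_suminf) auto
qed

lemma envelope_powr:
  "envelope R u powr (3/2) = enn2real (\<Sum>i. ennreal (R i u powr (3/2)))"
  by (simp add: envelope_def powr_powr)

lemma finite_sum_AE:
  assumes "weights R" "family_rate R < \<infinity>"
  shows "AE u in lborel. (\<Sum>i. ennreal (R i u powr (3/2))) < \<infinity>"
proof -
  have [measurable]: "\<And>i. R i \<in> borel_measurable lborel" using assms by (auto simp: weights_def)
  have "(\<integral>\<^sup>+ u. (\<Sum>i. ennreal (R i u powr (3/2))) \<partial>lborel) \<noteq> \<infinity>"
    using assms(2) unfolding family_rate_eq[OF assms(1)] by (auto simp: ennreal_mult_eq_top_iff)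
  then have "AE u in lborel. (\<Sum>i. ennreal (R i u powr (3/2))) \<noteq> \<infinity>"
    by (intro nn_integral_noteq_infinite) auto
  then show ?thesis by eventually_elim (auto simp: less_top)
qed

lemma envelope_L32:
  assumes R: "weights R" and fin: "family_rate R < \<infinity>"
  shows "L32 (envelope R)" "family_rate R = ennreal (4/3 * I32 (envelope R))"
proof -
  have [measurable]: "\<And>i. R i \<in> borel_measurable borel" using R by (auto simp: weights_def)
  have m: "envelope R \<in> borel_measurable lborel" unfolding envelope_def by measurable
  have eq: "(\<integral>\<^sup>+ u. ennreal (envelope R u powr (3/2)) \<partial>lborel) = (\<integral>\<^sup>+ u. (\<Sum>i. ennreal (R i u powr (3/2))) \<partial>lborel)"
    by (intro nn_integral_cong_AE) (use finite_sum_AE[OF assms] in \<open>eventually_elim, auto simp: envelope_powr\<close>)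
  have "\<dots> < \<infinity>"
    using fin unfolding family_rate_eq[OF R] by (auto simp: ennreal_mult_less_top)
  then have i: "integrable lborel (\<lambda>u. envelope R u powr (3/2))"
    using eq m by (intro integrableI_nonneg) auto
  then show "L32 (envelope R)" using m by (simp add: L32_def envelope_def)
  show "family_rate R = ennreal (4/3 * I32 (envelope R))"
    unfolding family_rate_eq[OF R] eq[symmetric] I32_def
    by (subst nn_integral_eq_integral[OF i]) (auto simp: ennreal_mult[symmetric])
qed

lemma envelope_dominates:
  assumes R: "weights R" and fin: "family_rate R < \<infinity>"
  shows "AE u in lborel. R i u \<le> envelope R u"
  using finite_sum_AE[OF assms]
proof eventually_elim
  case (elim u)
  have nn: "0 \<le> R i u" using R by (auto simp: weights_def)
  define f where "f = (\<lambda>i. ennreal (R i u powr (3/2)))"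
  have "sum f {i} \<le> suminf f" by (rule sum_le_suminf) (auto intro: summableI)
  then have le: "ennreal (R i u powr (3/2)) \<le> (\<Sum>i. ennreal (R i u powr (3/2)))"
    by (simp add: f_def)
  have "R i u powr (3/2) \<le> enn2real (\<Sum>i. ennreal (R i u powr (3/2)))"
    using enn2real_mono[OF le] elim by simp
  then have "(R i u powr (3/2)) powr (2/3) \<le> envelope R u"
    unfolding envelope_def by (intro powr_mono2) auto
  then show ?case using nn by (simp add: powr_powr)
qed

lemma envelope_mono_AE:
  assumes "weights R" "family_rate R < \<infinity>" "\<And>i u. 0 \<le> R' i u" "\<And>i u. R' i u \<le> R i u"
  shows "AE u in lborel. envelope R' u \<le> envelope R u"
  using finite_sum_AE[OF assms(1,2)]
proof eventually_elim
  case (elim u)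
  have "(\<Sum>i. ennreal (R' i u powr (3/2))) \<le> (\<Sum>i. ennreal (R i u powr (3/2)))"
    by (intro suminf_le summableI ennreal_leI powr_mono2) (use assms in auto)
  then show ?case
    unfolding envelope_def using elim by (intro powr_mono2 enn2real_mono) auto
qed

section \<open>Splitting the rate of a family over time sets\<close>

lemma weights_restrict:
  assumes "weights R" "\<And>i. {u. E i u} \<in> sets borel"
  shows "weights (\<lambda>i u. if E i u then R i u else 0)"
  unfolding weights_def
proof (intro allI conjI)
  fix i
  have [measurable]: "R i \<in> borel_measurable borel" "Measurable.pred borel (E i)"
    using assms by (auto simp: weights_def pred_def)
  show "(\<lambda>u. if E i u then R i u else 0) \<in> borel_measurable lborel" by simp
qed (use assms in \<open>auto simp: weights_def\<close>)

lemma family_rate_split: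
  assumes R: "weights R" and E: "\<And>i. {u. E i u} \<in> sets borel"
  shows "family_rate R = family_rate (\<lambda>i u. if E i u then R i u else 0) + family_rate (\<lambda>i u. if \<not> E i u then R i u else 0)"
proof -
  have [measurable]: "\<And>i. R i \<in> borel_measurable borel" using R by (auto simp: weights_def)
  have [measurable]: "\<And>i. Measurable.pred borel (E i)" using E by (simp add: pred_def)
  have "(\<integral>\<^sup>+ t. ennreal (R i t powr (3/2)) \<partial>lborel) =
     (\<integral>\<^sup>+ t. ennreal ((if E i t then R i t else 0) powr (3/2)) \<partial>lborel) + (\<integral>\<^sup>+ t. ennreal ((if \<not> E i t then R i t else 0) powr (3/2)) \<partial>lborel)" for i
  proof (subst nn_integral_add[symmetric])
    show "(\<integral>\<^sup>+ t. ennreal (R i t powr (3/2)) \<partial>lborel) = (\<integral>\<^sup>+ t. ennreal ((if E i t then R i t else 0) powr (3/2)) +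
       ennreal ((if \<not> E i t then R i t else 0) powr (3/2)) \<partial>lborel)"
      by (rule nn_integral_cong) simp
  qed measurable
  note eq = this
  show ?thesis unfolding family_rate_def eq distrib_left
    by (rule suminf_add[symmetric]; rule summableI)
qed

section \<open>The optimal curve and density\<close>

lemma iv_FTC:
  assumes "s \<le> t" "\<And>x. s \<le> x \<Longrightarrow> x \<le> t \<Longrightarrow> (f has_real_derivative f' x) (at x)"
    "\<And>x. s \<le> x \<Longrightarrow> x \<le> t \<Longrightarrow> isCont f' x"
  shows "iv f' s t = f t - f s"
  using integral_FTC_Icc_real[OF assms] by (simp add: iv_def set_lebesgue_integral_def mult.commute)

lemma integral_eq_iv:
  assumes "\<And>u. u \<notin> {s..t} \<Longrightarrow> f u = 0"
  shows "(LINT u|lborel. f u) = iv f s t"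
  unfolding iv_def set_lebesgue_integral_def
  by (rule Bochner_Integration.integral_cong) (use assms in \<open>auto simp: indicator_def\<close>)

lemma locint_bounded:
  fixes f :: "real \<Rightarrow> real"
  assumes "f \<in> borel_measurable borel" "\<And>u. \<bar>f u\<bar> \<le> B"
  shows "locint f"
proof (rule locint_bound[OF locint_const[of B]])
  fix u show "\<bar>f u\<bar> \<le> \<bar>B\<bar>" using assms(2)[of u] by linarith
qed (use assms(1) in simp)

text \<open>Used for \<open>Q\<close> stable under concatenation, with \<open>b\<close> a breakpoint
  of a piecewise definition.\<close>

lemma glue:
  fixes Q :: "real \<Rightarrow> real \<Rightarrow> bool"
  assumes "\<And>s r t. s \<le> r \<Longrightarrow> r \<le> t \<Longrightarrow> Q s r \<Longrightarrow> Q r t \<Longrightarrow> Q s t"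
    and "\<And>s t. A \<le> s \<Longrightarrow> s \<le> t \<Longrightarrow> t \<le> b \<Longrightarrow> Q s t" "\<And>s t. b \<le> s \<Longrightarrow> s \<le> t \<Longrightarrow> Q s t"
    and "A \<le> s" "s \<le> t"
  shows "Q s t"
  using assms by (metis linear)

locale passage =
  fixes a :: real
  assumes a: "0 < a" "a < 1/2"
begin

text \<open>\<open>q\<^sup>2 = 2 a\<close> is the time \<open>t_B\<close>, and \<open>r\<close> is
  the value of \<open>\<phi>\<close> up to that time, chosen so that \<open>F a = 1\<close>. The
  constant \<open>c\<close> makes \<open>K\<close> continuous at \<open>q\<^sup>2\<close>; since
  \<open>K 1 = c\<close>, subtracting \<open>c t\<close> brings \<open>F\<close> back to
  \<open>0\<close> at time \<open>1\<close>.\<close>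

definition q where "q = sqrt (2 * a)"
definition r where "r = 2 / (q\<^sup>2 * (3 - 2 * q))"
definition c where "c = 2 * r * q"

lemma q: "0 < q" "q < 1" "a < q\<^sup>2" "q\<^sup>2 < 1" and q2: "q\<^sup>2 = 2 * a"
  using a by (auto simp: q_def)

lemma pos_of_ge: "q\<^sup>2 \<le> u \<Longrightarrow> 0 < u"
  using q(1) by (meson less_le_trans zero_less_power)

lemma r: "0 < r" "r * q\<^sup>2 * (3 - 2 * q) = 2" "r * (3 - 2 * q) * a = 1"
  and c: "0 < c"
proof -
  show "0 < r" unfolding r_def using q by (intro divide_pos_pos mult_pos_pos) auto
  then show "0 < c" using q by (simp add: c_def)
  have "q\<^sup>2 * (3 - 2 * q) \<noteq> 0" using q by auto
  then show *: "r * q\<^sup>2 * (3 - 2 * q) = 2" unfolding r_def by (metis nonzero_eq_divide_eq mult.assoc)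
  show "r * (3 - 2 * q) * a = 1" using * unfolding q2 by (simp add: algebra_simps)
qed

text \<open>The density is \<open>\<phi>\<^sup>2\<close>, and \<open>F + c t\<close> has slope \<open>3 \<phi>\<close> before time \<open>a\<close> and slope \<open>\<phi>\<close> after it.\<close>

definition \<phi> :: "real \<Rightarrow> real" where
  "\<phi> u = (if u < 0 \<or> 1 < u then 0 else if u \<le> q\<^sup>2 then r else r * q / sqrt u)"
definition \<rho> :: "real \<Rightarrow> real" where "\<rho> u = (\<phi> u)\<^sup>2"
definition g :: "real \<Rightarrow> real" where
  "g u = (if u < 0 \<or> 1 < u then 0 else if u \<le> a then 3 * r - c else \<phi> u - c)"
definition K :: "real \<Rightarrow> real" where
  "K t = (if t \<le> a then 3 * r * t else if t \<le> q\<^sup>2 then r * (t + q\<^sup>2) else c * sqrt t)"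
definition F :: "real \<Rightarrow> real" where
  "F t = (if t < 0 \<or> 1 < t then 0 else K t - c * t)"
text \<open>The integral over \<open>[0, t]\<close> of \<open>\<rho> - g\<^sup>2\<close> in closed
  form, for \<open>t\<close> in \<open>[0, 1]\<close>. The slopes of \<open>F + c t\<close>, namely
  \<open>3 \<phi>\<close> and \<open>\<phi>\<close>, make the integrand affine in \<open>g\<close>
  apart from the term \<open>- 8 r\<^sup>2\<close> before time \<open>a\<close>.\<close>

definition w :: "real \<Rightarrow> real" where
  "w t = 2 * c * F t + c\<^sup>2 * t - 8 * r\<^sup>2 * min a t"

lemma \<phi>_measurable [measurable]: "\<phi> \<in> borel_measurable borel"
  unfolding \<phi>_def by measurable

lemma \<rho>_measurable [measurable]: "\<rho> \<in> borel_measurable borel"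
  unfolding \<rho>_def by measurable

lemma g_measurable [measurable]: "g \<in> borel_measurable borel"
  unfolding g_def by measurable

lemma \<phi>_nonneg: "0 \<le> \<phi> u" using q r by (auto simp: \<phi>_def)

lemma \<phi>_pos: "0 \<le> u \<Longrightarrow> u \<le> 1 \<Longrightarrow> 0 < \<phi> u" using q(1) r(1) pos_of_ge[of u] by (simp add: \<phi>_def)

lemma sqrt_gt_q: "q\<^sup>2 < u \<Longrightarrow> q < sqrt u" "q\<^sup>2 \<le> u \<Longrightarrow> q \<le> sqrt u"
  using real_less_rsqrt real_le_rsqrt by auto

lemma \<phi>_le_r: "\<phi> u \<le> r"
proof -
  have "r * q / sqrt u \<le> r" if "q\<^sup>2 < u"
  proof -
    have "r * q \<le> r * sqrt u" using sqrt_gt_q(1)[OF that] r by simp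
    moreover have "0 < sqrt u" using sqrt_gt_q(1)[OF that] q by linarith
    ultimately show ?thesis by (simp add: divide_le_eq)
  qed
  then show ?thesis using r by (auto simp: \<phi>_def)
qed

lemma \<phi>_antimono: "0 \<le> s \<Longrightarrow> s \<le> t \<Longrightarrow> \<phi> t \<le> \<phi> s"
proof -
  assume st: "0 \<le> s" "s \<le> t"
  show ?thesis
  proof (cases "t \<le> 1 \<and> q\<^sup>2 < s")
    case True
    then have "0 < s" using pos_of_ge[of s] by simp
    then show ?thesis using True st q r by (auto simp: \<phi>_def intro!: divide_left_mono mult_pos_pos)
  next
    case False
    then show ?thesis using \<phi>_le_r[of t] \<phi>_nonneg[of s] st by (auto simp: \<phi>_def)
  qed
qed

lemma locint_\<phi>: "locint \<phi>"
  by (rule locint_bounded[of _ r]) (use \<phi>_le_r \<phi>_nonneg in auto)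

lemma locint_\<rho>: "locint \<rho>"
  by (rule locint_bounded[of _ "r\<^sup>2"]) (use \<phi>_le_r \<phi>_nonneg in \<open>auto simp: \<rho>_def intro!: power_mono\<close>)

lemma g_bound: "\<bar>g u\<bar> \<le> 3 * r + c"
  using \<phi>_le_r[of u] \<phi>_nonneg[of u] r c by (auto simp: g_def)

lemma locint_g: "locint g"
  by (rule locint_bounded[of _ "3 * r + c"]) (use g_bound in auto)

lemma locint_g2: "locint (\<lambda>u. (g u)\<^sup>2)"
  by (rule locint_bounded[of _ "(3 * r + c)\<^sup>2"]) (use g_bound in \<open>auto simp: power2_le_iff_abs_le intro: abs_le_square_iff[THEN iffD1]\<close>, metis abs_ge_zero g_bound power2_abs power_mono)

lemma K_cont: "K a = 3 * r * a" "K (q\<^sup>2) = c * q"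
  using q by (auto simp: K_def c_def power2_eq_square)

lemma F_ends: "F 0 = 0" "F 1 = 0" "F a = 1"
proof -
  show "F 0 = 0" using a by (simp add: F_def K_def)
  show "F 1 = 0" using a q by (simp add: F_def K_def)
  have "F a = r * (3 - 2 * q) * a" using a by (simp add: F_def K_def c_def algebra_simps)
  then show "F a = 1" using r by simp
qed

lemma F_diff: "s \<le> t \<Longrightarrow> F t - F s = iv g s t"
proof -
  let ?Q = "\<lambda>s t. F t - F s = iv g s t"
  have tr: "?Q s t" if "s \<le> r'" "r' \<le> t" "?Q s r'" "?Q r' t" for s r' t
    using iv_combine[OF locint_g that(1,2)] that(3,4) by simp
  have Fz: "F u = 0" if "u \<le> 0 \<or> 1 \<le> u" for u
    using that F_ends by (cases "u = 0"; cases "u = 1") (auto simp: F_def)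
  have out: "?Q s t" if "s \<le> t" "t \<le> 0 \<or> 1 \<le> s" for s t
  proof -
    have "iv g s t = iv (\<lambda>_. 0) s t"
      by (rule iv_cong) (use that in \<open>auto simp: g_def\<close>)
    then show ?thesis using that by (simp add: iv_const) (use that Fz in fastforce)
  qed
  have p1: "?Q s t" if "0 \<le> s" "s \<le> t" "t \<le> a" for s t
  proof -
    have "iv g s t = iv (\<lambda>_. 3 * r - c) s t"
      by (rule iv_cong) (use that a in \<open>auto simp: g_def\<close>)
    then show ?thesis using that a by (auto simp: F_def K_def iv_const algebra_simps)
  qed
  have p2: "?Q s t" if "a \<le> s" "s \<le> t" "t \<le> q\<^sup>2" for s t
  proof -
    have 1: "F u = r * (u + q\<^sup>2) - c * u" if "a \<le> u" "u \<le> q\<^sup>2" for u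
    proof (cases "u = a")
      case True
      then show ?thesis using a by (simp add: F_def K_def q2)
    next
      case False
      then show ?thesis using that a q by (simp add: F_def K_def)
    qed
    have "iv g s t = iv (\<lambda>_. r - c) s t"
      by (rule iv_cong) (use that a q in \<open>auto simp: g_def \<phi>_def\<close>)
    then show ?thesis using that by (auto simp: 1 iv_const algebra_simps)
  qed
  have p3: "?Q s t" if "q\<^sup>2 \<le> s" "s \<le> t" "t \<le> 1" for s t
  proof -
    have 1: "F u = c * sqrt u - c * u" if "q\<^sup>2 \<le> u" "u \<le> 1" for u
    proof (cases "u = q\<^sup>2")
      case True
      then show ?thesis using K_cont q by (simp add: F_def)
    next
      case False
      then have "0 < u" "a < u" "q\<^sup>2 < u" using that q a by auto
      then show ?thesis using that by (auto simp: F_def K_def)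
    qed
    have s: "0 < s" using that pos_of_ge by simp
    have "iv g s t = iv (\<lambda>u. r * q / sqrt u - c) s t"
      by (rule iv_cong) (use that a q s in \<open>auto simp: g_def \<phi>_def\<close>)
    also have "\<dots> = (c * sqrt t - c * t) - (c * sqrt s - c * s)"
      by (rule iv_FTC) (use that s in \<open>auto intro!: derivative_eq_intros continuous_intros simp: c_def field_simps\<close>)
    finally show ?thesis using that by (simp add: 1)
  qed
  have 4: "?Q s t" if "q\<^sup>2 \<le> s" "s \<le> t" for s t
    by (rule glue[of ?Q "q\<^sup>2" 1]) (use tr p3 out that in auto)
  have 3: "?Q s t" if "a \<le> s" "s \<le> t" for s t
    by (rule glue[of ?Q a "q\<^sup>2"]) (use tr p2 4 that in auto)
  have 2: "?Q s t" if "0 \<le> s" "s \<le> t" for s t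
    by (rule glue[of ?Q 0 a]) (use tr p1 3 that in auto)
  show "?Q s t" if "s \<le> t"
    by (rule glue[of ?Q s 0]) (use tr out 2 that in auto)
qed

lemma F_lipschitz: "s \<le> t \<Longrightarrow> \<bar>F t - F s\<bar> \<le> (3 * r + c) * (t - s)"
proof -
  assume st: "s \<le> t"
  have b: "g u \<le> 3 * r + c" "- (3 * r + c) \<le> g u" for u using g_bound[of u] by linarith+
  have "iv g s t \<le> iv (\<lambda>_. 3 * r + c) s t" "iv (\<lambda>_. - (3 * r + c)) s t \<le> iv g s t"
    by (rule iv_mono[OF _ _ b(1)] iv_mono[OF _ _ b(2)]; simp add: locint_g)+
  then show ?thesis using F_diff[OF st] st by (simp add: iv_const abs_le_iff algebra_simps)
qed

lemma admissible_F: "admissible F g \<rho>"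
  unfolding admissible_def using locint_\<rho> locint_g F_diff by (auto simp: \<rho>_def locint_def iv_def)

lemma energy_density: "0 \<le> u \<Longrightarrow> u \<le> 1 \<Longrightarrow> \<rho> u - (g u)\<^sup>2 = (if u \<le> a then - 8 * r\<^sup>2 else 0) + 2 * c * g u + c\<^sup>2"
  using a q by (auto simp: \<rho>_def g_def \<phi>_def power2_eq_square algebra_simps)

lemma gain_eq:
  assumes "0 \<le> s" "s \<le> t" "t \<le> 1"
  shows "iv \<rho> s t - iv (\<lambda>u. (g u)\<^sup>2) s t = w t - w s"
proof -
  let ?j = "\<lambda>u. if u \<le> a then - 8 * r\<^sup>2 else (0::real)"
  have lj: "locint ?j" by (rule locint_bounded[of _ "8 * r\<^sup>2"]) auto
  have j: "iv ?j s t = - 8 * r\<^sup>2 * (min a t - min a s)"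
  proof -
    have tr: "iv ?j s r' + iv ?j r' t = iv ?j s t" if "s \<le> r'" "r' \<le> t" for s r' t
      by (rule iv_combine[OF lj that])
    have 1: "iv ?j s t = - 8 * r\<^sup>2 * (t - s)" if "s \<le> t" "t \<le> a" for s t
      using iv_cong[of s t ?j "\<lambda>_. - 8 * r\<^sup>2"] that by (simp add: iv_const)
    have 2: "iv ?j s t = 0" if "s \<le> t" "a \<le> s" for s t
      using iv_cong[of s t ?j "\<lambda>_. 0"] that by (simp add: iv_const)
    show ?thesis
      using 1[of s t] 2[of s t] 1[of s a] 2[of a t] tr[of s a t] assms by (auto simp: min_def)
  qed
  have "iv \<rho> s t - iv (\<lambda>u. (g u)\<^sup>2) s t = iv (\<lambda>u. \<rho> u - (g u)\<^sup>2) s t"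
    by (simp add: iv_diff locint_\<rho> locint_g2)
  also have "\<dots> = iv (\<lambda>u. ?j u + (2 * c * g u + c\<^sup>2)) s t"
    by (rule iv_cong) (use assms energy_density in \<open>auto simp: add.assoc\<close>)
  also have "\<dots> = iv ?j s t + (2 * c * iv g s t + c\<^sup>2 * (t - s))"
    using assms lj locint_g by (simp add: iv_add iv_cmult locint_add locint_cmult iv_const del: if_split)
  also have "\<dots> = w t - w s"
    using F_diff[OF assms(2)] by (simp add: j w_def algebra_simps)
  finally show ?thesis .
qed

text \<open>This is \<open>gain_ge_dd\<close> after completing the square: adding the drift
  \<open>c t\<close> to \<open>F\<close> absorbs the terms \<open>2 c F + c\<^sup>2 t\<close> of
  \<open>w\<close>. In each nontrivial case the difference of the two sides is visibly nonnegative,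
  a square or a product of nonnegative factors; \<open>q\<^sup>2 = 2 a\<close> enters when the
  interval crosses \<open>a\<close>.\<close>

lemma K_increment:
  assumes "0 \<le> s" "s < t" "t \<le> 1"
  shows "8 * r\<^sup>2 * (t - s) * (min a t - min a s) \<le> (K t - K s)\<^sup>2"
proof -
  consider "t \<le> a" | "a \<le> s" | "s < a" "a < t" "t \<le> q\<^sup>2" | "s < a" "q\<^sup>2 < t" using q assms by linarith
  then show ?thesis
  proof cases
    case 1
    then have "(K t - K s)\<^sup>2 - 8 * r\<^sup>2 * (t - s) * (min a t - min a s) = r\<^sup>2 * (t - s)\<^sup>2"
      using assms by (simp add: K_def power2_eq_square algebra_simps)
    then show ?thesis by (metis diff_ge_0_iff_ge mult_nonneg_nonneg zero_le_power2)
  next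
    case 2
    then show ?thesis using assms by simp
  next
    case 3
    then have "(K t - K s)\<^sup>2 - 8 * r\<^sup>2 * (t - s) * (min a t - min a s) = r\<^sup>2 * (2 * a - s - t)\<^sup>2"
      using assms by (simp add: K_def q2) (simp add: power2_eq_square algebra_simps)
    then show ?thesis by (metis diff_ge_0_iff_ge mult_nonneg_nonneg zero_le_power2)
  next
    case 4
    define y where "y = sqrt t"
    have y: "t = y\<^sup>2" "q < y" using sqrt_gt_q 4 assms by (auto simp: y_def)
    have a': "8 * r\<^sup>2 * (t - s) * (a - s) = 4 * r\<^sup>2 * (t - s) * (q\<^sup>2 - 2 * s)" using q2 by simp
    have "K t = 2 * r * q * y" "K s = 3 * r * s" using 4 q by (auto simp: K_def c_def y_def)
    then have "(K t - K s)\<^sup>2 - 8 * r\<^sup>2 * (t - s) * (a - s) = r\<^sup>2 * s * (s + 4 * (y - q) * (2 * y - q))"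
      unfolding a' unfolding y(1) by (simp add: power2_eq_square algebra_simps)
    moreover have "0 \<le> r\<^sup>2 * s * (s + 4 * (y - q) * (2 * y - q))"
    proof -
      have "0 \<le> y - q" "0 \<le> 2 * y - q" using y(2) q(1) by linarith+
      then show ?thesis using assms(1) by simp
    qed
    ultimately show ?thesis using 4 q by simp
  qed
qed

lemma gain_ge_dd:
  assumes "0 \<le> s" "s \<le> t" "t \<le> 1"
  shows "dd (F s) s (F t) t \<le> w t - w s"
proof (cases "s = t")
  case False
  then have st: "s < t" using assms by simp
  have "8 * r\<^sup>2 * (min a t - min a s) \<le> (K t - K s)\<^sup>2 / (t - s)"
    using K_increment[OF assms(1) st assms(3)] st by (simp add: le_divide_eq mult.commute mult.left_commute)
  also have "K t - K s = F t - F s + c * (t - s)"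
    using assms by (simp add: F_def algebra_simps)
  also have "(F t - F s + c * (t - s))\<^sup>2 / (t - s) = (F t - F s)\<^sup>2 / (t - s) + 2 * c * (F t - F s) + c\<^sup>2 * (t - s)"
    using st by (simp add: power2_sum add_divide_distrib) (simp add: power2_eq_square)
  finally show ?thesis using st by (simp add: dd_def w_def algebra_simps)
qed simp

lemma w_ends: "w 0 = 0" "w 1 = 0"
proof -
  show "w 0 = 0" using a by (simp add: w_def F_ends)
  show "w 1 = 0" using a q2 by (simp add: w_def F_ends c_def power_mult_distrib)
qed

lemma \<phi>2_lipschitz:
  assumes "a \<le> s" "s \<le> t" "t \<le> 1"
  shows "(\<phi> s)\<^sup>2 - (\<phi> t)\<^sup>2 \<le> r\<^sup>2 / q\<^sup>2 * (t - s)"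
proof -
  have \<phi>2: "(\<phi> u)\<^sup>2 = r\<^sup>2 * q\<^sup>2 / max u (q\<^sup>2)" if "a \<le> u" "u \<le> 1" for u
    using that a q by (auto simp: \<phi>_def max_def power_divide power_mult_distrib)
  define s' t' where "s' = max s (q\<^sup>2)" and "t' = max t (q\<^sup>2)"
  have st: "q\<^sup>2 \<le> s'" "s' \<le> t'" "t' - s' \<le> t - s" using assms by (auto simp: s'_def t'_def)
  have qq: "0 < q\<^sup>2" using q by simp
  have pos: "0 < s'" "0 < t'" using st qq by linarith+
  have "(\<phi> s)\<^sup>2 - (\<phi> t)\<^sup>2 = r\<^sup>2 * q\<^sup>2 * ((t' - s') / (s' * t'))"
    using assms pos by (simp add: \<phi>2 s'_def[symmetric] t'_def[symmetric] field_simps)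
  also have "\<dots> \<le> r\<^sup>2 * q\<^sup>2 * ((t - s) / (q\<^sup>2 * q\<^sup>2))"
    using st qq pos by (intro mult_left_mono frac_le mult_mono) auto
  also have "\<dots> = r\<^sup>2 / q\<^sup>2 * (t - s)" using qq by (simp add: field_simps)
  finally show ?thesis .
qed

text \<open>On \<open>[0, a]\<close> the curve is straight and there is no excess; on
  \<open>[a, 1]\<close> the variance of the slope is controlled by the Lipschitz bound on
  \<open>\<phi>\<^sup>2\<close>. The interval must not cross \<open>a\<close>: the slope jumps there
  from \<open>3 r - c\<close> to \<open>r - c\<close>, which would cost an amount of first
  order.\<close>

lemma energy_excess:
  assumes "0 \<le> s" "s < t" "t \<le> 1" "t \<le> a \<or> a \<le> s"
  shows "iv (\<lambda>u. (g u)\<^sup>2) s t - (F t - F s)\<^sup>2 / (t - s) \<le> r\<^sup>2 / q\<^sup>2 * (t - s)\<^sup>2"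
proof (cases "t \<le> a")
  case True
  have "iv (\<lambda>u. (g u)\<^sup>2) s t = iv (\<lambda>_. (3 * r - c)\<^sup>2) s t"
    by (rule iv_cong) (use assms True in \<open>auto simp: g_def\<close>)
  also have "\<dots> = (3 * r - c)\<^sup>2 * (t - s)" using assms by (simp add: iv_const)
  also have "\<dots> = (F t - F s)\<^sup>2 / (t - s)"
  proof -
    have "F t - F s = (3 * r - c) * (t - s)" using assms True by (auto simp: F_def K_def algebra_simps)
    then show ?thesis using assms by (simp add: power2_eq_square)
  qed
  finally show ?thesis by simp
next
  case False
  then have as: "a \<le> s" using assms by simp
  have "iv (\<lambda>u. (g u)\<^sup>2) s t = iv (\<lambda>u. \<rho> u - 2 * c * \<phi> u + c\<^sup>2) s t"
    by (rule iv_cong) (use assms as a in \<open>auto simp: g_def \<rho>_def power2_eq_square algebra_simps\<close>)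
  also have "\<dots> = iv \<rho> s t - 2 * c * iv \<phi> s t + c\<^sup>2 * (t - s)"
    using assms by (simp add: iv_add iv_diff iv_cmult iv_const locint_\<rho> locint_\<phi> locint_diff locint_cmult)
  finally have 1: "iv (\<lambda>u. (g u)\<^sup>2) s t = iv \<rho> s t - 2 * c * iv \<phi> s t + c\<^sup>2 * (t - s)" .
  have "iv g s t = iv (\<lambda>u. \<phi> u - c) s t"
    by (rule iv_cong) (use assms as a in \<open>auto simp: g_def\<close>)
  then have 2: "F t - F s = iv \<phi> s t - c * (t - s)"
    using F_diff[of s t] assms by (simp add: iv_diff iv_const locint_\<phi>)
  have "iv (\<lambda>_. \<phi> t) s t \<le> iv \<phi> s t"
    by (rule iv_mono) (use assms locint_\<phi> \<phi>_antimono in auto)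
  then have 3: "\<phi> t * (t - s) \<le> iv \<phi> s t" using assms by (simp add: iv_const)
  have "iv \<rho> s t \<le> iv (\<lambda>_. (\<phi> s)\<^sup>2) s t"
    by (rule iv_mono) (use assms locint_\<rho> \<phi>_antimono \<phi>_nonneg in \<open>auto simp: \<rho>_def intro!: power_mono\<close>)
  then have 4: "iv \<rho> s t \<le> (\<phi> s)\<^sup>2 * (t - s)" using assms by (simp add: iv_const)
  have "(F t - F s)\<^sup>2 / (t - s) = (iv \<phi> s t)\<^sup>2 / (t - s) - 2 * c * iv \<phi> s t + c\<^sup>2 * (t - s)"
    unfolding 2 using assms by (simp add: power2_diff add_divide_distrib diff_divide_distrib) (simp add: power2_eq_square)
  then have "iv (\<lambda>u. (g u)\<^sup>2) s t - (F t - F s)\<^sup>2 / (t - s) = iv \<rho> s t - (iv \<phi> s t)\<^sup>2 / (t - s)"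
    using 1 by simp
  also have "(\<phi> t * (t - s))\<^sup>2 / (t - s) \<le> (iv \<phi> s t)\<^sup>2 / (t - s)"
    using assms 3 \<phi>_nonneg by (intro divide_right_mono power_mono) auto
  then have "iv \<rho> s t - (iv \<phi> s t)\<^sup>2 / (t - s) \<le> (\<phi> s)\<^sup>2 * (t - s) - (\<phi> t * (t - s))\<^sup>2 / (t - s)"
    using 4 by simp
  also have "\<dots> = ((\<phi> s)\<^sup>2 - (\<phi> t)\<^sup>2) * (t - s)"
  proof -
    have "(\<phi> t * (t - s))\<^sup>2 / (t - s) = (\<phi> t)\<^sup>2 * (t - s)"
      using assms by (simp add: power_mult_distrib power2_eq_square[of "t - s"])
    then show ?thesis by (simp add: algebra_simps)
  qed
  also have "\<dots> \<le> (r\<^sup>2 / q\<^sup>2 * (t - s)) * (t - s)"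
    using \<phi>2_lipschitz[of s t] as assms by (intro mult_right_mono) auto
  also have "\<dots> = r\<^sup>2 / q\<^sup>2 * (t - s)\<^sup>2" by (simp add: power2_eq_square)
  finally show ?thesis .
qed

lemma \<rho>_powr: "\<rho> u powr (3/2) = (\<phi> u) ^ 3"
  using \<phi>_nonneg[of u] by (simp add: \<rho>_def powr_three_halves power2_eq_square power3_eq_cube)

lemma L32_\<rho>: "L32 \<rho>"
proof -
  have "set_integrable lborel {0..1} (\<lambda>u. (\<phi> u) ^ 3)"
    by (intro locintD locint_bounded[of _ "r ^ 3"]) (use \<phi>_le_r \<phi>_nonneg in \<open>auto intro!: power_mono\<close>)
  then have "integrable lborel (\<lambda>u. indicator {0..1} u *\<^sub>R (\<phi> u) ^ 3)" by (simp add: set_integrable_def)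
  also have "(\<lambda>u. indicator {0..1} u *\<^sub>R (\<phi> u) ^ 3) = (\<lambda>u. \<rho> u powr (3/2))"
    by (auto simp: \<rho>_powr \<phi>_def indicator_def)
  finally show ?thesis by (auto simp: L32_def \<rho>_def)
qed

lemma I32_\<rho>: "I32 \<rho> = 2 * r\<^sup>2"
proof -
  have l: "locint (\<lambda>u. (\<phi> u) ^ 3)"
    by (rule locint_bounded[of _ "r ^ 3"]) (use \<phi>_le_r \<phi>_nonneg in \<open>auto intro!: power_mono\<close>)
  have "I32 \<rho> = iv (\<lambda>u. (\<phi> u) ^ 3) 0 1"
    unfolding I32_def \<rho>_powr by (rule integral_eq_iv) (auto simp: \<phi>_def)
  also have "\<dots> = iv (\<lambda>u. (\<phi> u) ^ 3) 0 (q\<^sup>2) + iv (\<lambda>u. (\<phi> u) ^ 3) (q\<^sup>2) 1"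
    using q by (intro iv_combine[OF l, symmetric]) auto
  also have "iv (\<lambda>u. (\<phi> u) ^ 3) 0 (q\<^sup>2) = iv (\<lambda>_. r ^ 3) 0 (q\<^sup>2)"
    by (rule iv_cong) (use q in \<open>auto simp: \<phi>_def\<close>)
  also have "\<dots> = r ^ 3 * q\<^sup>2" by (simp add: iv_const)
  also have "iv (\<lambda>u. (\<phi> u) ^ 3) (q\<^sup>2) 1 = iv (\<lambda>u. (r * q) ^ 3 / (u * sqrt u)) (q\<^sup>2) 1"
  proof (rule iv_cong)
    fix u assume u: "q\<^sup>2 < u" "u < 1"
    then have "0 < u" using pos_of_ge[of u] by simp
    then show "(\<phi> u) ^ 3 = (r * q) ^ 3 / (u * sqrt u)"
      using u by (simp add: \<phi>_def power_divide power3_eq_cube)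
  qed auto
  also have "\<dots> = - 2 * (r * q) ^ 3 / sqrt 1 - (- 2 * (r * q) ^ 3 / sqrt (q\<^sup>2))"
  proof (rule iv_FTC)
    fix x assume "q\<^sup>2 \<le> x" "x \<le> 1"
    then have x: "0 < x" using pos_of_ge[of x] by simp
    show "((\<lambda>u. - 2 * (r * q) ^ 3 / sqrt u) has_real_derivative (r * q) ^ 3 / (x * sqrt x)) (at x)"
      using x by (auto intro!: derivative_eq_intros simp: field_simps)
    show "isCont (\<lambda>u. (r * q) ^ 3 / (u * sqrt u)) x" using x by (intro continuous_intros) auto
  qed (use q in auto)
  also have "r ^ 3 * q\<^sup>2 + (- 2 * (r * q) ^ 3 / sqrt 1 - (- 2 * (r * q) ^ 3 / sqrt (q\<^sup>2))) = r\<^sup>2 * (r * q\<^sup>2 * (3 - 2 * q))"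
    using q by (simp add: field_simps power2_eq_square power3_eq_cube)
  also have "\<dots> = 2 * r\<^sup>2" by (simp add: r)
  finally show ?thesis .
qed

end

section \<open>Lower bound for the rate\<close>

text \<open>The inversion \<open>(x, t)\<close> to \<open>(x / t, 1 / t)\<close> preserves the
  Dirichlet metric up to boundary terms, which are the Dirichlet distances from the origin.\<close>

lemma dd_from_origin:
  assumes "0 < s" "s < t"
  shows "(y / t - x / s)\<^sup>2 / (1 / s - 1 / t) = - dd x s y t + x\<^sup>2 / s - y\<^sup>2 / t"
proof -
  have 1: "1 / s - 1 / t = (t - s) / (s * t)" using assms by (simp add: field_simps)
  have 2: "y / t - x / s = (y * s - x * t) / (s * t)" using assms by (simp add: field_simps)
  have 3: "(y * s - x * t)\<^sup>2 / (s * t * (t - s)) = (y - x)\<^sup>2 / (t - s) + x\<^sup>2 / s - y\<^sup>2 / t"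
    using assms by (simp add: divide_simps) (simp add: power2_eq_square algebra_simps)
  have "(y / t - x / s)\<^sup>2 / (1 / s - 1 / t) = (y * s - x * t)\<^sup>2 / (s * t * (t - s))"
    unfolding 1 2 using assms by (simp add: power_divide power2_eq_square[of "s * t"])
  then show ?thesis unfolding 3 by (simp add: dd_def)
qed

context passage
begin

text \<open>An antiderivative of \<open>1 / (\<phi> u * u\<^sup>2)\<close> on \<open>(0, 1]\<close>.\<close>
definition V :: "real \<Rightarrow> real" where
  "V t = (if t \<le> q\<^sup>2 then - 1 / (r * t) else 1 / (r * q\<^sup>2) - 2 / (r * q * sqrt t))"

lemma V_late: "q\<^sup>2 \<le> t \<Longrightarrow> V t = 1 / (r * q\<^sup>2) - 2 / (r * q * sqrt t)"
  using q(1) r(1) by (cases "t = q\<^sup>2") (auto simp: V_def power2_eq_square field_simps)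

text \<open>The error of using the end value \<open>\<phi> t\<close> instead of
  \<open>\<phi>\<close> in the integral of \<open>1 / (\<phi> u\<^sup>2)\<close> over
  \<open>[s, t]\<close>; it is of second order.\<close>

lemma V_step_late:
  assumes "q\<^sup>2 \<le> s" "s < t" "t \<le> 1"
  shows "(1 / s - 1 / t) / \<phi> t - (V t - V s) \<le> 1 / (4 * r * q ^ 6) * (t - s)\<^sup>2"
proof -
  define x y where "x = sqrt s" and "y = sqrt t"
  have pos: "0 < s" "0 < t" using pos_of_ge[of s] pos_of_ge[of t] assms by auto
  have xy: "s = x\<^sup>2" "t = y\<^sup>2" "q \<le> x" "x < y" "0 < x" "0 < y"
    using pos assms sqrt_gt_q by (auto simp: x_def y_def)
  have \<phi>t: "\<phi> t = r * q / y" using assms pos by (simp add: \<phi>_def y_def)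
  have Vd: "V t - V s = (2 / (r * q)) * (1 / x - 1 / y)"
    using assms by (simp add: V_late x_def y_def right_diff_distrib)
  have "(1 / s - 1 / t) / \<phi> t - (V t - V s) = (y - x)\<^sup>2 / (r * q * (x\<^sup>2 * y))"
    unfolding \<phi>t Vd unfolding xy(1,2) using xy(5,6) r(1) q(1)
    by (simp add: field_simps) (simp add: eval_nat_numeral algebra_simps)
  also have "\<dots> \<le> ((t - s)\<^sup>2 / (2 * q)\<^sup>2) / (r * q * (q\<^sup>2 * q))"
  proof (rule frac_le)
    have "2 * q * (y - x) \<le> (y + x) * (y - x)" using xy by (intro mult_right_mono) auto
    also have "\<dots> = t - s" unfolding xy(1,2) by (simp add: power2_eq_square algebra_simps)
    finally have "y - x \<le> (t - s) / (2 * q)" using q(1) by (simp add: field_simps)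
    then have "(y - x)\<^sup>2 \<le> ((t - s) / (2 * q))\<^sup>2" using xy by (intro power_mono) auto
    then show "(y - x)\<^sup>2 \<le> (t - s)\<^sup>2 / (2 * q)\<^sup>2" by (simp only: power_divide)
    show "r * q * (q\<^sup>2 * q) \<le> r * q * (x\<^sup>2 * y)"
      using xy r(1) q(1) by (intro mult_left_mono mult_mono power_mono) auto
  qed (use r(1) q(1) in auto)
  also have "\<dots> = 1 / (4 * r * q ^ 6) * (t - s)\<^sup>2" by (simp add: power2_eq_square power_numeral_reduce)
  finally show ?thesis .
qed

text \<open>Cauchy-Schwarz in linearised form: Young's inequality with a fixed slope
  \<open>l\<close> makes the bound additive over subintervals, so \<open>subdivide\<close> can
  replace the end values of \<open>\<phi>\<close> by the antiderivative \<open>V\<close>. Up to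
  \<open>q\<^sup>2\<close> the weight is constant and one step is exact.\<close>

lemma dual_bound:
  fixes \<Phi> h :: "real \<Rightarrow> real"
  assumes step: "\<And>s t. 0 < s \<Longrightarrow> s < t \<Longrightarrow> t \<le> 1 \<Longrightarrow> \<phi> t * ((h t - h s)\<^sup>2 / (1 / s - 1 / t)) \<le> \<Phi> t - \<Phi> s"
    and st: "0 < s" "s < t" "t \<le> 1"
  shows "2 * l * (h s - h t) - l\<^sup>2 * (V t - V s) \<le> \<Phi> t - \<Phi> s"
proof -
  have lin: "2 * l * (h s - h t) - l\<^sup>2 * ((1 / s - 1 / t) / \<phi> t) \<le> \<Phi> t - \<Phi> s" if "0 < s" "s < t" "t \<le> 1" for s t
  proof -
    define \<tau> X where "\<tau> = 1 / s - 1 / t" and "X = h t - h s"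
    have \<tau>: "0 < \<tau>" using that by (simp add: \<tau>_def field_simps)
    have p: "0 < \<phi> t" using that by (intro \<phi>_pos) auto
    have "0 \<le> (\<phi> t * X + l * \<tau>)\<^sup>2 / (\<phi> t * \<tau>)" using p \<tau> by simp
    also have "\<dots> = \<phi> t * (X\<^sup>2 / \<tau>) + 2 * l * X + l\<^sup>2 * (\<tau> / \<phi> t)"
      using p \<tau> by (simp add: field_simps) (simp add: power2_eq_square algebra_simps)
    finally show ?thesis using step[OF that] by (simp add: \<tau>_def[symmetric] X_def algebra_simps)
  qed
  have early: "2 * l * (h s - h t) - l\<^sup>2 * (V t - V s) \<le> \<Phi> t - \<Phi> s" if "0 < s" "s < t" "t \<le> q\<^sup>2" for s t
  proof -
    have "\<phi> t = r" using that q by (simp add: \<phi>_def)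
    then have "(1 / s - 1 / t) / \<phi> t = V t - V s" using that r(1) by (simp add: V_def field_simps)
    then show ?thesis using lin[of s t] that q by simp
  qed
  have late: "2 * l * (h s - h t) - l\<^sup>2 * (V t - V s) \<le> \<Phi> t - \<Phi> s" if "q\<^sup>2 \<le> s" "s < t" "t \<le> 1" for s t
  proof -
    define f where "f s t = 2 * l * (h s - h t) - l\<^sup>2 * (V t - V s) - (\<Phi> t - \<Phi> s)" for s t
    have "f s t \<le> 0"
    proof (rule subdivide[where f = f and d = 1 and M = "l\<^sup>2 * (1 / (4 * r * q ^ 6))"])
      fix s' t' assume *: "s \<le> s'" "s' < t'" "t' \<le> t"
      then have "f s' t' \<le> l\<^sup>2 * ((1 / s' - 1 / t') / \<phi> t' - (V t' - V s'))"
        using lin[of s' t'] that pos_of_ge[of s'] by (simp add: f_def algebra_simps)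
      also have "\<dots> \<le> l\<^sup>2 * (1 / (4 * r * q ^ 6) * (t' - s')\<^sup>2)"
        using * that by (intro mult_left_mono V_step_late) auto
      finally show "f s' t' \<le> (l\<^sup>2 * (1 / (4 * r * q ^ 6))) * (t' - s')\<^sup>2" by (simp only: mult.assoc)
    qed (use that in \<open>auto simp: f_def algebra_simps\<close>)
    then show ?thesis by (simp add: f_def)
  qed
  consider "t \<le> q\<^sup>2" | "q\<^sup>2 \<le> s" | "s < q\<^sup>2" "q\<^sup>2 < t" by linarith
  then show ?thesis
  proof cases
    case 3
    then show ?thesis using early[of s "q\<^sup>2"] late[of "q\<^sup>2" t] st by (simp add: algebra_simps)
  qed (use early late st in auto)
qed

text \<open>The maximiser of \<open>2 l / a - l\<^sup>2 (V 1 - V a)\<close> over \<open>l\<close>,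
  that is \<open>(1 / a) / (V 1 - V a)\<close>.\<close>

definition lam where "lam = r\<^sup>2 * q\<^sup>2"

lemma V_a: "V a = - 2 / (r * q\<^sup>2)"
  using a q by (simp add: V_def q2)

lemma V_mono: "a < t \<Longrightarrow> t \<le> 1 \<Longrightarrow> V a < V t"
proof -
  assume t: "a < t" "t \<le> 1"
  have rq: "0 < r * q\<^sup>2" using r(1) q(1) by simp
  show ?thesis
  proof (cases "t \<le> q\<^sup>2")
    case True
    then show ?thesis using t r(1) a q by (simp add: V_def divide_strict_left_mono)
  next
    case False
    then have s: "q < sqrt t" using sqrt_gt_q by simp
    then have "0 < sqrt t" using q(1) by linarith
    have "2 / (r * q * sqrt t) < 2 / (r * q * q)"
      using s \<open>0 < sqrt t\<close> r(1) q(1) by (intro divide_strict_left_mono mult_pos_pos mult_strict_left_mono) auto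
    then have "2 / (r * q * sqrt t) < 2 / (r * q\<^sup>2)" by (simp add: power2_eq_square mult.assoc)
    moreover have "0 < 1 / (r * q\<^sup>2)" using rq by simp
    moreover have "V t = 1 / (r * q\<^sup>2) - 2 / (r * q * sqrt t)" using False by (simp add: V_late)
    moreover have "V a = - (2 / (r * q\<^sup>2))" by (simp add: V_a)
    ultimately show ?thesis by linarith
  qed
qed

lemma optimal_value: "2 * lam * (1 / a) - lam\<^sup>2 * (V 1 - V a) = 2 * r\<^sup>2"
proof -
  have V1: "V 1 = 1 / (r * q\<^sup>2) - 2 / (r * q)" using q by (simp add: V_late)
  have "lam\<^sup>2 * (V 1 - V a) = r\<^sup>2 * (r * q\<^sup>2 * (3 - 2 * q))"
    unfolding V1 V_a lam_def using r(1) q(1) by (simp add: field_simps) (simp add: eval_nat_numeral algebra_simps)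
  also have "\<dots> = 2 * r\<^sup>2" by (simp add: r)
  finally have 1: "lam\<^sup>2 * (V 1 - V a) = 2 * r\<^sup>2" .
  have "2 * lam * (1 / a) = 4 * r\<^sup>2" unfolding lam_def q2 using a by (simp add: field_simps)
  then show ?thesis using 1 by simp
qed

lemma F_early: "0 \<le> t \<Longrightarrow> t \<le> a \<Longrightarrow> F t = t / a"
proof -
  assume t: "0 \<le> t" "t \<le> a"
  have "F t = (r * (3 - 2 * q)) * t" using t a by (simp add: F_def K_def c_def algebra_simps)
  also have "r * (3 - 2 * q) = 1 / a" using r(3) a by (simp add: field_simps)
  finally show ?thesis by simp
qed

text \<open>The equality case of \<open>dual_bound\<close> with slope \<open>lam\<close>: in the
  clock \<open>V\<close>, the ratio \<open>F t / t\<close> falls linearly.\<close>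

lemma F_late:
  assumes "a \<le> t" "t \<le> 1"
  shows "F t = t * (1 / a - lam * (V t - V a))"
proof -
  have ra: "1 / a = r * (3 - 2 * q)" using r(3) a by (simp add: field_simps)
  have t0: "0 < t" using assms a by linarith
  show ?thesis
  proof (cases "t \<le> q\<^sup>2")
    case True
    have "F t = r * (t + q\<^sup>2) - c * t"
    proof (cases "t = a")
      case True
      then show ?thesis using a by (simp add: F_def K_def q2)
    next
      case False
      then show ?thesis using True assms a q by (simp add: F_def K_def)
    qed
    moreover have Vt: "V t = - 1 / (r * t)" using True by (simp add: V_def)
    have "lam * (V t - V a) = 2 * r - r * q\<^sup>2 / t"
      unfolding Vt using r(1) q(1) t0 by (simp add: V_a lam_def power2_eq_square field_simps)
    ultimately show ?thesis unfolding ra using t0 by (simp add: c_def field_simps)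
  next
    case False
    have "F t = c * sqrt t - c * t" using False assms a q by (simp add: F_def K_def)
    moreover have L: "lam * (V t - V a) = 3 * r - 2 * r * q / sqrt t"
      using False r(1) q(1) t0 by (simp add: V_a V_late lam_def) (simp add: power2_eq_square field_simps)
    moreover have "t / sqrt t = sqrt t" using t0 by (simp add: real_div_sqrt)
    moreover have "t * (r * (3 - 2 * q) - (3 * r - 2 * r * q / sqrt t)) = c * (t / sqrt t) - c * t"
      by (simp add: c_def algebra_simps)
    ultimately show ?thesis unfolding ra L by simp
  qed
qed

text \<open>The third bound is the one for the rate. The other two add a penalty for the deviation
  of \<open>p t\<close> from \<open>F t\<close>, after and before time \<open>a\<close>, and serve
  to identify the geodesic.\<close>

lemma lower_bounds:
  fixes \<sigma> W p :: "real \<Rightarrow> real"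
  assumes \<sigma>: "locint \<sigma>" "\<And>u. 0 \<le> \<sigma> u" "\<sigma> \<in> borel_measurable borel"
    and W0: "\<And>t. 0 < t \<Longrightarrow> t \<le> 1 \<Longrightarrow> dd 0 0 (p t) t \<le> W t"
    and W1: "\<And>t. 0 < t \<Longrightarrow> t \<le> 1 \<Longrightarrow> W t \<le> dd 0 0 (p t) t + iv \<sigma> 0 t"
    and W2: "\<And>s t. 0 < s \<Longrightarrow> s < t \<Longrightarrow> t \<le> 1 \<Longrightarrow> W t - W s \<le> dd (p s) s (p t) t + iv \<sigma> s t"
    and p: "p a = 1" "p 1 = 0"
  shows "\<And>t. a < t \<Longrightarrow> t < 1 \<Longrightarrow> 2 * r\<^sup>2 + (1 / a - p t / t - lam * (V t - V a))\<^sup>2 / (V t - V a) \<le> iv (\<lambda>u. \<phi> u * \<sigma> u) 0 1"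
    and "\<And>t. 0 < t \<Longrightarrow> t < a \<Longrightarrow> 2 * r\<^sup>2 + r * ((1 / a - p t / t)\<^sup>2 / (1 / t - 1 / a)) \<le> iv (\<lambda>u. \<phi> u * \<sigma> u) 0 1"
    and "2 * r\<^sup>2 \<le> iv (\<lambda>u. \<phi> u * \<sigma> u) 0 1"
proof -
  define J where "J = iv (\<lambda>u. \<phi> u * \<sigma> u) 0 1"
  have l\<sigma>: "locint (\<lambda>u. \<phi> u * \<sigma> u)"
  proof (rule locint_bound[of "\<lambda>u. r * \<sigma> u"])
    show "locint (\<lambda>u. r * \<sigma> u)" using \<sigma> by (intro locint_cmult)
    show "\<bar>\<phi> u * \<sigma> u\<bar> \<le> \<bar>r * \<sigma> u\<bar>" for u
      using \<phi>_le_r[of u] \<phi>_nonneg[of u] \<sigma>(2)[of u] r(1) by (simp add: abs_mult mult_right_mono)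
  qed (use \<sigma>(3) in measurable)
  define h where "h t = p t / t" for t
  define z where "z t = W t - dd 0 0 (p t) t" for t
  \<comment> \<open>Summation by parts: since \<open>\<phi>\<close> decreases and \<open>z\<close>
    is nonnegative, the loss \<open>(\<phi> s - \<phi> t) * z s\<close> has the favourable sign, and
    \<open>\<Phi>\<close> inherits the increments of \<open>z\<close> weighted with
    \<open>\<phi> t\<close>.\<close>
  define \<Phi> where "\<Phi> t = iv (\<lambda>u. \<phi> u * \<sigma> u) 0 t - \<phi> t * z t" for t
  have dd0: "dd 0 0 y t = - (y\<^sup>2 / t)" for y t by (simp add: dd_def)
  have step: "\<phi> t * ((h t - h s)\<^sup>2 / (1 / s - 1 / t)) \<le> \<Phi> t - \<Phi> s" if "0 < s" "s < t" "t \<le> 1" for s t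
  proof -
    have "z t - z s \<le> iv \<sigma> s t - (h t - h s)\<^sup>2 / (1 / s - 1 / t)"
      using W2[OF that] dd_from_origin[OF that(1,2), of "p t" "p s"] by (simp add: z_def h_def dd0)
    then have "\<phi> t * (z t - z s) \<le> \<phi> t * (iv \<sigma> s t - (h t - h s)\<^sup>2 / (1 / s - 1 / t))"
      using \<phi>_nonneg by (intro mult_left_mono) auto
    moreover have "\<phi> t * iv \<sigma> s t \<le> iv (\<lambda>u. \<phi> u * \<sigma> u) s t"
      unfolding iv_cmult[symmetric]
      by (rule iv_mono[OF locint_cmult[OF \<sigma>(1)] l\<sigma>]) (use \<phi>_antimono \<sigma>(2) that in \<open>auto intro: mult_right_mono\<close>)
    moreover have "\<phi> t * z s \<le> \<phi> s * z s"
      using W0[of s] that \<phi>_antimono[of s t] by (intro mult_right_mono) (auto simp: z_def)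
    moreover have "iv (\<lambda>u. \<phi> u * \<sigma> u) 0 s + iv (\<lambda>u. \<phi> u * \<sigma> u) s t = iv (\<lambda>u. \<phi> u * \<sigma> u) 0 t"
      using that by (intro iv_combine l\<sigma>) auto
    ultimately show ?thesis unfolding \<Phi>_def right_diff_distrib by linarith
  qed
  have top: "\<Phi> 1 \<le> J"
    using W0[of 1] \<phi>_nonneg[of 1] by (simp add: \<Phi>_def J_def z_def)
  have bot: "0 \<le> \<Phi> s" if "0 < s" "s \<le> 1" for s
  proof -
    have "\<phi> s * z s \<le> \<phi> s * iv \<sigma> 0 s"
      using W1[OF that] \<phi>_nonneg by (intro mult_left_mono) (auto simp: z_def)
    also have "\<dots> \<le> iv (\<lambda>u. \<phi> u * \<sigma> u) 0 s"
      unfolding iv_cmult[symmetric]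
      by (rule iv_mono[OF locint_cmult[OF \<sigma>(1)] l\<sigma>]) (use \<phi>_antimono \<sigma>(2) that in \<open>auto intro: mult_right_mono\<close>)
    finally show ?thesis by (simp add: \<Phi>_def)
  qed
  note dual = dual_bound[of h \<Phi>, OF step]
  have ha: "h a = 1 / a" "h 1 = 0" using p by (auto simp: h_def)
  have main: "2 * r\<^sup>2 \<le> \<Phi> 1 - \<Phi> a"
    using dual[of a 1 lam] a ha optimal_value by simp
  show "2 * r\<^sup>2 \<le> iv (\<lambda>u. \<phi> u * \<sigma> u) 0 1"
    using main top bot[of a] a unfolding J_def by linarith
  show "2 * r\<^sup>2 + r * ((1 / a - p t / t)\<^sup>2 / (1 / t - 1 / a)) \<le> iv (\<lambda>u. \<phi> u * \<sigma> u) 0 1" if "0 < t" "t < a" for t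
  proof -
    have "\<phi> a = r" using a q by (simp add: \<phi>_def)
    then have "r * ((1 / a - p t / t)\<^sup>2 / (1 / t - 1 / a)) \<le> \<Phi> a - \<Phi> t"
      using step[of t a] that a ha by (simp add: h_def)
    then show ?thesis using main top bot[of t] that a unfolding J_def by linarith
  qed
  show "2 * r\<^sup>2 + (1 / a - p t / t - lam * (V t - V a))\<^sup>2 / (V t - V a) \<le> iv (\<lambda>u. \<phi> u * \<sigma> u) 0 1" if "a < t" "t < 1" for t
  proof -
    \<comment> \<open>The slope is changed to \<open>lam + k\<close> on \<open>[a, t]\<close> and
      kept at \<open>lam\<close> on \<open>[t, 1]\<close>; this \<open>k\<close> maximises the
      resulting gain \<open>2 k (X - lam A) - k\<^sup>2 A\<close>.\<close>
    define A X k where "A = V t - V a" and "X = 1 / a - h t" and "k = (X - lam * A) / A"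
    have A: "0 < A" using V_mono[of t] that by (simp add: A_def)
    have "2 * (lam + k) * X - (lam + k)\<^sup>2 * A \<le> \<Phi> t - \<Phi> a"
      using dual[of a t "lam + k"] that a ha by (simp add: A_def X_def)
    moreover have "2 * lam * h t - lam\<^sup>2 * (V 1 - V t) \<le> \<Phi> 1 - \<Phi> t"
      using dual[of t 1 lam] that a ha by simp
    moreover have "2 * (lam + k) * X - (lam + k)\<^sup>2 * A + (2 * lam * h t - lam\<^sup>2 * (V 1 - V t))
      = (2 * lam * (1 / a) - lam\<^sup>2 * (V 1 - V a)) + (2 * k * (X - lam * A) - k\<^sup>2 * A)"
      unfolding A_def X_def by (simp add: power2_eq_square algebra_simps)
    moreover have "2 * k * (X - lam * A) - k\<^sup>2 * A = (X - lam * A)\<^sup>2 / A"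
    proof -
      have "X - lam * A = k * A" using A by (simp add: k_def)
      then show ?thesis using A by (simp add: power2_eq_square algebra_simps)
    qed
    ultimately have "2 * r\<^sup>2 + (X - lam * A)\<^sup>2 / A \<le> \<Phi> 1 - \<Phi> a" unfolding optimal_value by linarith
    then show ?thesis using top bot[of a] a unfolding J_def X_def A_def h_def by linarith
  qed
qed

text \<open>\<open>W\<close> and \<open>p\<close> are fixed while \<open>\<sigma>\<close> depends on
  \<open>e\<close>. The penalties in \<open>lower_bounds\<close> involve only \<open>p\<close>, and
  they are at most \<open>e\<close> for every \<open>e\<close>, so they vanish.\<close>

lemma path_determined:
  fixes W p :: "real \<Rightarrow> real"
  assumes "\<And>e. e > 0 \<Longrightarrow> \<exists>\<sigma>. locint \<sigma> \<and> (\<forall>u. 0 \<le> \<sigma> u) \<and> \<sigma> \<in> borel_measurable borel \<and>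
      (\<forall>t. 0 < t \<and> t \<le> 1 \<longrightarrow> W t \<le> dd 0 0 (p t) t + iv \<sigma> 0 t) \<and>
      (\<forall>s t. 0 < s \<and> s < t \<and> t \<le> 1 \<longrightarrow> W t - W s \<le> dd (p s) s (p t) t + iv \<sigma> s t) \<and>
      iv (\<lambda>u. \<phi> u * \<sigma> u) 0 1 \<le> 2 * r\<^sup>2 + e"
    and W0: "\<And>t. 0 < t \<Longrightarrow> t \<le> 1 \<Longrightarrow> dd 0 0 (p t) t \<le> W t"
    and p: "p 0 = 0" "p a = 1" "p 1 = 0" and t: "0 \<le> t" "t \<le> 1"
  shows "p t = F t"
proof -
  consider "t = 0" | "t = a" | "t = 1" | "a < t" "t < 1" | "0 < t" "t < a" using t by linarith
  then show ?thesis
  proof cases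
    case 4
    have "(1 / a - p t / t - lam * (V t - V a))\<^sup>2 / (V t - V a) \<le> 0 + e" if "e > 0" for e
    proof -
      obtain \<sigma> where \<sigma>: "locint \<sigma>" "\<And>u. 0 \<le> \<sigma> u" "\<sigma> \<in> borel_measurable borel"
        "\<And>t. 0 < t \<Longrightarrow> t \<le> 1 \<Longrightarrow> W t \<le> dd 0 0 (p t) t + iv \<sigma> 0 t"
        "\<And>s t. 0 < s \<Longrightarrow> s < t \<Longrightarrow> t \<le> 1 \<Longrightarrow> W t - W s \<le> dd (p s) s (p t) t + iv \<sigma> s t"
        "iv (\<lambda>u. \<phi> u * \<sigma> u) 0 1 \<le> 2 * r\<^sup>2 + e"
        using assms(1)[OF \<open>e > 0\<close>] by blast
      show ?thesis using lower_bounds(1)[OF \<sigma>(1-3) W0 \<sigma>(4,5) p(2,3) 4] \<sigma>(6) by linarith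
    qed
    then have "(1 / a - p t / t - lam * (V t - V a))\<^sup>2 / (V t - V a) \<le> 0" by (rule field_le_epsilon)
    moreover have "0 < V t - V a" using V_mono 4 by simp
    ultimately have "(1 / a - p t / t - lam * (V t - V a))\<^sup>2 \<le> 0"
      by (simp add: divide_le_0_iff)
    then have "p t / t = 1 / a - lam * (V t - V a)" by simp
    then show ?thesis using 4 a by (simp add: F_late field_simps)
  next
    case 5
    have "r * ((1 / a - p t / t)\<^sup>2 / (1 / t - 1 / a)) \<le> 0 + e" if "e > 0" for e
    proof -
      obtain \<sigma> where \<sigma>: "locint \<sigma>" "\<And>u. 0 \<le> \<sigma> u" "\<sigma> \<in> borel_measurable borel"
        "\<And>t. 0 < t \<Longrightarrow> t \<le> 1 \<Longrightarrow> W t \<le> dd 0 0 (p t) t + iv \<sigma> 0 t"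
        "\<And>s t. 0 < s \<Longrightarrow> s < t \<Longrightarrow> t \<le> 1 \<Longrightarrow> W t - W s \<le> dd (p s) s (p t) t + iv \<sigma> s t"
        "iv (\<lambda>u. \<phi> u * \<sigma> u) 0 1 \<le> 2 * r\<^sup>2 + e"
        using assms(1)[OF \<open>e > 0\<close>] by blast
      show ?thesis using lower_bounds(2)[OF \<sigma>(1-3) W0 \<sigma>(4,5) p(2,3) 5] \<sigma>(6) by linarith
    qed
    then have "r * ((1 / a - p t / t)\<^sup>2 / (1 / t - 1 / a)) \<le> 0" by (rule field_le_epsilon)
    moreover have "0 < 1 / t - 1 / a" using 5 by (simp add: field_simps)
    ultimately have "(1 / a - p t / t)\<^sup>2 \<le> 0"
      using r(1) by (simp add: mult_le_0_iff divide_le_0_iff)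
    then have "p t / t = 1 / a" by simp
    then show ?thesis using 5 by (simp add: F_early field_simps)
  qed (use p F_ends in auto)
qed

end

section \<open>The optimal metric\<close>

lemma partition_mono:
  fixes ts :: "nat \<Rightarrow> real"
  assumes "\<forall>i<k. ts i < ts (Suc i)" "i \<le> j" "j \<le> k"
  shows "ts i \<le> ts j"
  using assms(2,3)
proof (induction j rule: dec_induct)
  case (step n)
  then show ?case using assms(1)[rule_format, of n] by simp
qed simp

lemma path_length_le_partition:
  assumes "0 < k" "ts 0 = s" "ts k = t" "\<And>i. i < k \<Longrightarrow> ts i < ts (Suc i)"
  shows "path_length e p s t \<le> (\<Sum>i<k. e (p (ts i)) (ts i) (p (ts (Suc i))) (ts (Suc i)))"
  unfolding path_length_def by (rule INF_lower2[of "(k, ts)"]) (use assms in auto)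

text \<open>The value between the ends of a geodesic is at most the sum over any partition.
  Superadditivity outside \<open>[s, t]\<close> cancels the other pieces, leaving the inequality
  opposite to superadditivity at \<open>v\<close>. Partitions are strictly increasing, so
  \<open>s = 0\<close> and \<open>t = 1\<close> need their own shorter partitions.\<close>

lemma geodesic_additive:
  assumes e: "\<And>x s y t. s < t \<Longrightarrow> e x s y t = ereal (E x s y t)"
    and sup: "\<And>x s y t z u. s < t \<Longrightarrow> t < u \<Longrightarrow> E x s y t + E y t z u \<le> E x s z u"
    and geo: "is_geodesic e p 0 1"
    and st: "0 \<le> s" "s < v" "v < t" "t \<le> 1"
  shows "E (p s) s (p v) v + E (p v) v (p t) t = E (p s) s (p t) t"
proof -
  let ?E = "\<lambda>s t. E (p s) s (p t) t"
  have len: "path_length e p 0 1 = ereal (?E 0 1)" using geo e by (simp add: is_geodesic_def)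
  have two: "?E 0 1 \<le> ?E 0 s + ?E s 1" if "0 < s" "s < 1" for s
    using path_length_le_partition[of 2 "\<lambda>i. if i = 0 then 0 else if i = 1 then s else 1" 0 1 e p] that
    by (auto simp: len e numeral_2_eq_2)
  have three: "?E 0 1 \<le> ?E 0 s + ?E s t + ?E t 1" if "0 < s" "s < t" "t < 1" for s t
  proof -
    let ?ts = "\<lambda>i::nat. if i = 0 then 0 else if i = 1 then s else if i = 2 then t else 1"
    have "path_length e p 0 1 \<le> (\<Sum>i<3. e (p (?ts i)) (?ts i) (p (?ts (Suc i))) (?ts (Suc i)))"
      by (rule path_length_le_partition) (use that in \<open>auto simp: eval_nat_numeral less_Suc_eq\<close>)
    then show ?thesis using that by (simp add: len e eval_nat_numeral)
  qed
  have four: "?E 0 1 \<le> ?E 0 s + ?E s v + ?E v t + ?E t 1" if "0 < s" "s < v" "v < t" "t < 1" for s v t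
  proof -
    let ?ts = "\<lambda>i::nat. if i = 0 then 0 else if i = 1 then s else if i = 2 then v else if i = 3 then t else 1"
    have "path_length e p 0 1 \<le> (\<Sum>i<4. e (p (?ts i)) (?ts i) (p (?ts (Suc i))) (?ts (Suc i)))"
      by (rule path_length_le_partition) (use that in \<open>auto simp: eval_nat_numeral less_Suc_eq\<close>)
    then show ?thesis using that by (simp add: len e eval_nat_numeral)
  qed
  have "?E s t \<le> ?E s v + ?E v t"
  proof (cases "s = 0"; cases "t = 1")
    assume "s = 0" "t = 1"
    then show ?thesis using two[of v] st by simp
  next
    assume "s = 0" "t \<noteq> 1"
    then show ?thesis using three[of v t] st sup[of 0 t 1 "p 0" "p t" "p 1"] by simp
  next
    assume "s \<noteq> 0" "t = 1"
    then show ?thesis using three[of s v] st sup[of 0 s 1 "p 0" "p s" "p 1"] by simp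
  next
    assume *: "s \<noteq> 0" "t \<noteq> 1"
    then show ?thesis using four[of s v t] st sup[of 0 s t "p 0" "p s" "p t"] sup[of 0 t 1 "p 0" "p t" "p 1"] by simp
  qed
  then show ?thesis using sup[of s v t "p s" "p v" "p t"] st by simp
qed

section \<open>The metric planted along the optimal curve\<close>

context passage
begin

definition R1 :: "nat \<Rightarrow> real \<Rightarrow> real" where "R1 = (\<lambda>i. if i = 0 then \<rho> else (\<lambda>_. 0))"

lemma \<rho>_nonneg: "0 \<le> \<rho> u" by (simp add: \<rho>_def)

lemma R1_le: "0 \<le> R1 i u" "R1 i u \<le> \<rho> u" using \<rho>_nonneg by (auto simp: R1_def)

lemma admissible_R1: "admissible F g (R1 i)"
  using admissible_F by (auto simp: R1_def admissible_def set_integrable_def)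

sublocale opt: dominated_planting "\<lambda>_. F" "\<lambda>_. g" R1 \<rho>
  by unfold_locales (use admissible_R1 locint_\<rho> \<rho>_nonneg R1_le in auto)

abbreviation eopt :: dmetric where "eopt \<equiv> planting (\<lambda>_. F) (\<lambda>_. g) R1"

lemma planted1_eopt: "planted1 eopt F g \<rho>"
  using opt.planted_clo unfolding planted1_def R1_def .

lemma family_rate_R1: "family_rate R1 = ennreal (8 / 3 * r\<^sup>2)"
proof -
  have "(\<integral>\<^sup>+ t. ennreal (\<rho> t powr (3/2)) \<partial>lborel) = ennreal (I32 \<rho>)"
    unfolding I32_def using L32_\<rho> by (intro nn_integral_eq_integral) (auto simp: L32_def)
  moreover have "family_rate R1 = (\<Sum>i\<in>{0}. ennreal (4/3) * (\<integral>\<^sup>+ t. ennreal (R1 i t powr (3/2)) \<partial>lborel))"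
    unfolding family_rate_def by (rule suminf_finite) (auto simp: R1_def)
  ultimately show ?thesis by (simp add: R1_def I32_\<rho> ennreal_mult[symmetric])
qed

lemma curve_F_eq: "curve_metric F g (R1 i) (F s) s (F t) t = ereal (iv (R1 i) s t - iv (\<lambda>u. (g u)\<^sup>2) s t)"
  by (rule curve_metric_eq[OF admissible_R1 locintD[OF locint_g2]])

lemma iv_outside:
  assumes "s \<le> t" "t \<le> 0 \<or> 1 \<le> s"
  shows "iv \<rho> s t = 0" "iv (\<lambda>u. (g u)\<^sup>2) s t = 0"
proof -
  have "iv \<rho> s t = iv (\<lambda>_. 0) s t" "iv (\<lambda>u. (g u)\<^sup>2) s t = iv (\<lambda>_. 0) s t"
    by (rule iv_cong; use assms in \<open>auto simp: \<rho>_def \<phi>_def g_def\<close>)+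
  then show "iv \<rho> s t = 0" "iv (\<lambda>u. (g u)\<^sup>2) s t = 0" using assms by (simp_all add: iv_const)
qed

lemma F_outside: "u \<le> 0 \<or> 1 \<le> u \<Longrightarrow> F u = 0"
  using F_ends by (cases "u = 0"; cases "u = 1") (auto simp: F_def)

lemma gain_clip:
  assumes "s \<le> 1" "0 \<le> t" "s \<le> t"
  shows "iv \<rho> s t - iv (\<lambda>u. (g u)\<^sup>2) s t = w (min t 1) - w (max s 0)"
proof -
  let ?s = "max s 0" and ?t = "min t 1"
  have c: "iv f s t = iv f s ?s + iv f ?s ?t + iv f ?t t" if "locint f" for f
    using iv_combine[OF that, of s ?s t] iv_combine[OF that, of ?s ?t t] assms by auto
  have "iv f s ?s = 0" "iv f ?t t = 0" if "f = \<rho> \<or> f = (\<lambda>u. (g u)\<^sup>2)" for f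
    using that iv_outside[of s 0] iv_outside[of 1 t] by (auto simp: max_def min_def)
  then show ?thesis
    using gain_eq[of ?s ?t] c[OF locint_\<rho>] c[OF locint_g2] assms by simp
qed

text \<open>By \<open>gain_ge_dd\<close>, leaving the curve between two visits never pays, so a best route follows
  the curve on a single time interval.\<close>
lemma eopt_le_0: "eopt 0 0 0 1 \<le> 0"
proof -
  \<comment> \<open>A route is either a single Dirichlet step or a step to \<open>F\<close>, a
    stretch of \<open>F\<close> within \<open>[0, 1]\<close>, and a step away. The implications for
    \<open>s = u\<close> and \<open>v = t\<close> exclude jumps in zero time, to which
    \<open>dd\<close> would assign the cost \<open>0\<close>.\<close>
  define T where "T x s y t = insert (dd x s y t)
     {dd x s (F u) u + (w v - w u) + dd (F v) v y t |u v. s \<le> u \<and> u \<le> v \<and> v \<le> t \<and> 0 \<le> u \<and> v \<le> 1 \<and>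
        (s = u \<longrightarrow> x = F u) \<and> (v = t \<longrightarrow> F v = y)}" for x s y t
  have memI: "dd x s (F u) u + (w v - w u) + dd (F v) v y t \<in> T x s y t"
    if "s \<le> u" "u \<le> v" "v \<le> t" "0 \<le> u" "v \<le> 1" "s = u \<Longrightarrow> x = F u" "v = t \<Longrightarrow> F v = y" for x s y t u v
    using that by (auto simp: T_def)
  have dmem: "dd x s y t \<in> T x s y t" for x s y t by (simp add: T_def)
  define D where "D = (\<lambda>x s y t. SUP v\<in>T x s y t. ereal v)"
  have ub: "ereal v \<le> D x s y t" if "v \<in> T x s y t" for v x s y t
    unfolding D_def by (rule SUP_upper[OF that])
  have "majorant (\<lambda>_. F) (\<lambda>_. g) R1 D"
    unfolding majorant_def
  proof (intro conjI allI)
    show "superadd D" unfolding D_def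
    proof (rule superadd_SUP)
      fix x s y t show "T x s y t \<noteq> {}" by (simp add: T_def)
    next
      fix x s y t z u and v1 v2 :: real
      assume st: "s < t" "t < u" and v1: "v1 \<in> T x s y t" and v2: "v2 \<in> T y t z u"
      from v1 consider (1) "v1 = dd x s y t"
        | (2) b c where "v1 = dd x s (F b) b + (w c - w b) + dd (F c) c y t" "s \<le> b" "b \<le> c" "c \<le> t" "0 \<le> b" "c \<le> 1"
          "s = b \<longrightarrow> x = F b" "c = t \<longrightarrow> F c = y"
        unfolding T_def by blast
      then show "\<exists>v'\<in>T x s z u. v1 + v2 \<le> v'"
      proof cases
        case 1
        from v2 consider (a) "v2 = dd y t z u"
          | (b) b' c' where "v2 = dd y t (F b') b' + (w c' - w b') + dd (F c') c' z u" "t \<le> b'" "b' \<le> c'" "c' \<le> u" "0 \<le> b'" "c' \<le> 1"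
            "t = b' \<longrightarrow> y = F b'" "c' = u \<longrightarrow> F c' = z"
          unfolding T_def by blast
        then show ?thesis
        proof cases
          case a
          then show ?thesis using 1 dd_superadd_strict[OF st, of x y z] dmem by (intro bexI[of _ "dd x s z u"]) auto
        next
          case b
          then show ?thesis using 1 st dd_superadd[of s t b' x y "F b'"]
            by (intro bexI[OF _ memI[of s b' c' u x z]]) auto
        qed
      next
        case 2
        from v2 consider (a) "v2 = dd y t z u"
          | (b) b' c' where "v2 = dd y t (F b') b' + (w c' - w b') + dd (F c') c' z u" "t \<le> b'" "b' \<le> c'" "c' \<le> u" "0 \<le> b'" "c' \<le> 1"
            "t = b' \<longrightarrow> y = F b'" "c' = u \<longrightarrow> F c' = z"
          unfolding T_def by blast
        then show ?thesis
        proof cases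
          case a
          then show ?thesis using 2 st dd_superadd[of c t u "F c" y z]
            by (intro bexI[OF _ memI[of s b c u x z]]) auto
        next
          case b
          \<comment> \<open>The two visits to \<open>F\<close> merge: leaving at time
            \<open>c\<close> through \<open>(y, t)\<close> and returning at time \<open>b'\<close>
            is no better than the chord, which is no better than following \<open>F\<close>.\<close>
          have "dd (F c) c y t + dd y t (F b') b' \<le> dd (F c) c (F b') b'"
            using b 2 by (intro dd_superadd) auto
          also have "\<dots> \<le> w b' - w c" using b 2 by (intro gain_ge_dd) auto
          finally show ?thesis using 2 b st by (intro bexI[OF _ memI[of s b c' u x z]]) auto
        qed
      qed
    qed
    show "dle dirichlet D" unfolding dle_def dirichlet_eq using ub[OF dmem] by blast
    fix i
    show "dle (curve_metric F g (R1 i)) D" unfolding dle_def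
    proof safe
      fix x s y t :: real assume st: "s < t"
      show "curve_metric F g (R1 i) x s y t \<le> D x s y t"
      proof (cases rule: curve_metric_cases[OF admissible_R1[of i], of x s y t])
        case 2
        have le: "iv (R1 i) s t \<le> iv \<rho> s t"
          by (rule iv_mono) (use R1_le admissible_locint(1)[OF admissible_R1] locint_\<rho> in auto)
        show ?thesis
        proof (cases "t \<le> 0 \<or> 1 \<le> s")
          case True
          have "curve_metric F g (R1 i) x s y t \<le> ereal (dd x s y t)"
            using le iv_outside[OF _ True] F_outside[of s] F_outside[of t] True 2 st by (auto simp: dd_def)
          then show ?thesis using ub[OF dmem] by (rule order_trans)
        next
          case False
          have z: "dd (F s) s (F (max s 0)) (max s 0) = 0" "dd (F (min t 1)) (min t 1) (F t) t = 0"
            using F_outside[of s] F_outside[of t] F_ends by (auto simp: max_def min_def dd_def)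
          have "curve_metric F g (R1 i) x s y t \<le>
             ereal (dd x s (F (max s 0)) (max s 0) + (w (min t 1) - w (max s 0)) + dd (F (min t 1)) (min t 1) y t)"
            using le gain_clip[of s t] False st z 2 by simp
          then show ?thesis
            using False st 2 by (intro order_trans[OF _ ub[OF memI[of s "max s 0" "min t 1" t x y]]]) (auto simp: max_def min_def)
        qed
      qed auto
    qed
  qed
  then have "eopt 0 0 0 1 \<le> D 0 0 0 1" by (rule planting_le)
  also have "\<dots> \<le> 0"
    unfolding D_def
  proof (rule SUP_least)
    fix v assume "v \<in> T 0 0 0 1"
    then consider "v = dd 0 0 0 1" | b c where "v = dd 0 0 (F b) b + (w c - w b) + dd (F c) c 0 1" "0 \<le> b" "b \<le> c" "c \<le> 1"
      unfolding T_def by blast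
    then show "ereal v \<le> 0"
    proof cases
      case 2
      then show ?thesis using gain_ge_dd[of 0 b] gain_ge_dd[of c 1] by (simp add: F_ends w_ends)
    qed (simp add: dd_def)
  qed
  finally show ?thesis .
qed

lemma eopt_ge_gain: "s < t \<Longrightarrow> ereal (iv \<rho> s t - iv (\<lambda>u. (g u)\<^sup>2) s t) \<le> eopt (F s) s (F t) t"
  using opt.clo_curve[of s t 0 "F s" "F t"] by (simp add: curve_F_eq) (simp add: R1_def)

text \<open>Along \<open>F\<close> every partition sum of \<open>eopt\<close> is at least the
  telescoping sum of increments of \<open>w\<close>, which is \<open>0\<close>; and
  \<open>eopt 0 0 0 1\<close> is at most \<open>0\<close>.\<close>

lemma eopt_geodesic: "is_geodesic eopt F 0 1"
proof -
  have "eopt (F 0) 0 (F 1) 1 \<le> path_length eopt F 0 1"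
    unfolding path_length_def
  proof (rule INF_greatest)
    fix kts assume "kts \<in> {(k::nat, ts::nat \<Rightarrow> real). 0 < k \<and> ts 0 = 0 \<and> ts k = 1 \<and> (\<forall>i<k. ts i < ts (Suc i))}"
    then obtain k :: nat and ts :: "nat \<Rightarrow> real" where kts: "kts = (k, ts)"
      and k: "0 < k" "ts 0 = 0" "ts k = 1" "\<forall>i<k. ts i < ts (Suc i)" by auto
    have "eopt (F 0) 0 (F 1) 1 \<le> ereal (w 1 - w 0)" using eopt_le_0 by (simp add: F_ends w_ends zero_ereal_def[symmetric])
    also have "w 1 - w 0 = (\<Sum>i<k. w (ts (Suc i)) - w (ts i))" using k sum_lessThan_telescope[of "\<lambda>i. w (ts i)" k] by simp
    also have "ereal \<dots> \<le> (\<Sum>i<k. eopt (F (ts i)) (ts i) (F (ts (Suc i))) (ts (Suc i)))"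
      unfolding sum_ereal[symmetric]
    proof (rule sum_mono)
      fix i assume i: "i \<in> {..<k}"
      have "0 \<le> ts i" "ts (Suc i) \<le> 1"
        using partition_mono[OF k(4), of 0 i] partition_mono[OF k(4), of "Suc i" k] i k by auto
      then show "ereal (w (ts (Suc i)) - w (ts i)) \<le> eopt (F (ts i)) (ts i) (F (ts (Suc i))) (ts (Suc i))"
        using gain_eq[of "ts i" "ts (Suc i)"] eopt_ge_gain[of "ts i" "ts (Suc i)"] k(4) i by auto
    qed
    finally show "eopt (F 0) 0 (F 1) 1 \<le> (case kts of (k, ts) \<Rightarrow> \<Sum>i<k. eopt (F (ts i)) (ts i) (F (ts (Suc i))) (ts (Suc i)))"
      by (simp add: kts)
  qed
  moreover have "path_length eopt F 0 1 \<le> eopt (F 0) 0 (F 1) 1"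
    using path_length_le_partition[of 1 "\<lambda>i. if i = 0 then 0 else 1" 0 1 eopt F] by simp
  ultimately show ?thesis
    unfolding is_geodesic_def using admissible_continuous[OF admissible_F]
    by (auto intro: antisym continuous_on_subset)
qed

lemma eopt_through: "eopt \<in> through_metrics a"
  unfolding through_metrics_def using eopt_geodesic F_ends opt.directed_clo by auto

lemma rate_eopt_le: "rate eopt \<le> ennreal (8 / 3 * r\<^sup>2)"
  unfolding rate_def family_rate_R1[symmetric]
  by (rule INF_lower2[of "(\<lambda>_. F, \<lambda>_. g, R1)"]) (use admissible_R1 opt.planted_clo in auto)

lemma integral_mult_\<phi>: "(LINT u|lborel. \<sigma> u * sqrt (\<rho> u)) = iv (\<lambda>u. \<phi> u * \<sigma> u) 0 1"
proof -
  have "sqrt (\<rho> u) = \<phi> u" for u using \<phi>_nonneg by (simp add: \<rho>_def)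
  then show ?thesis by (subst integral_eq_iv[of 0 1]) (auto simp: \<phi>_def mult.commute)
qed

text \<open>Since \<open>\<rho> = \<phi>\<^sup>2\<close>, the tangent term of the divergence is the
  pairing with \<open>\<phi>\<close>. A pairing of at least \<open>2 r\<^sup>2\<close> therefore
  gives \<open>I32 \<sigma> \<ge> 2 r\<^sup>2\<close> and bounds the divergence by
  \<open>I32 \<sigma> - 2 r\<^sup>2\<close>.\<close>

lemma bregman_\<rho>:
  assumes "L32 \<sigma>"
  shows "(LINT u|lborel. bregman (\<sigma> u) (\<rho> u)) = I32 \<sigma> + r\<^sup>2 - 3 / 2 * iv (\<lambda>u. \<phi> u * \<sigma> u) 0 1"
  using integral_bregman[OF assms L32_\<rho>] by (simp add: integral_mult_\<phi> I32_\<rho>)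

end

section \<open>Uniqueness of the minimiser\<close>

lemma le_of_small:
  fixes x y B :: real
  assumes "\<And>m. 0 < m \<Longrightarrow> m \<le> 1 \<Longrightarrow> x \<le> y + m * B"
  shows "x \<le> y"
proof (rule field_le_epsilon)
  fix e :: real assume e: "e > 0"
  define m where "m = min 1 (e / (\<bar>B\<bar> + 1))"
  have m: "0 < m" "m \<le> 1" using e by (auto simp: m_def)
  have "m * B \<le> m * (\<bar>B\<bar> + 1)" using m by (intro mult_left_mono) auto
  also have "\<dots> \<le> e / (\<bar>B\<bar> + 1) * (\<bar>B\<bar> + 1)" by (intro mult_right_mono) (auto simp: m_def)
  also have "\<dots> = e" by (simp add: add_nonneg_eq_0_iff)
  finally show "x \<le> y + e" using assms[OF m] by linarith
qed

section \<open>Contacts of a planted curve with the optimal curve\<close>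

context passage
begin

text \<open>On a short time interval only the gain between the first and the last contact of \<open>\<gamma>\<close> with
  \<open>F\<close> matters; replacing \<open>\<gamma>\<close> by \<open>F\<close> in between costs an energy excess of second order.\<close>
lemma contact_gain_le_eopt:
  assumes adm: "admissible \<gamma> g' \<rho>'" and st: "s < t"
    and g2: "set_integrable lborel {s..t} (\<lambda>u. (g' u)\<^sup>2)"
  shows "iv (\<lambda>u. if \<gamma> u = F u then \<rho> u else 0) s t - iv (\<lambda>u. (g' u)\<^sup>2) s t \<le> opt.cl (\<gamma> s) s (\<gamma> t) t"
proof -
  let ?\<chi> = "\<lambda>u. if \<gamma> u = F u then \<rho> u else 0" and ?e = "\<lambda>u. (g' u)\<^sup>2"
  have cont: "continuous_on UNIV \<gamma>" "continuous_on UNIV F"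
    using admissible_continuous adm admissible_F by auto
  have [measurable]: "\<gamma> \<in> borel_measurable borel" "F \<in> borel_measurable borel"
    using cont by (auto intro: borel_measurable_continuous_onI)
  have l\<chi>: "locint ?\<chi>"
    by (rule locint_bound[OF locint_\<rho>]) (use \<rho>_nonneg in auto)
  have \<chi>0: "0 \<le> ?\<chi> u" for u using \<rho>_nonneg by simp
  have sub: "set_integrable lborel {s'..t'} ?e" if "s \<le> s'" "t' \<le> t" for s' t'
    using that by (intro set_integrable_subset[OF g2]) auto
  have comb: "iv ?e s' v + iv ?e v t' = iv ?e s' t'" if "s \<le> s'" "s' \<le> v" "v \<le> t'" "t' \<le> t" for s' v t'
    using that by (intro iv_combine_on sub) auto
  have no_contact: "iv ?\<chi> s' t' \<le> 0" if "\<And>u. s' < u \<Longrightarrow> u < t' \<Longrightarrow> \<gamma> u \<noteq> F u \<or> \<rho> u = 0" for s' t'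
  proof -
    have "iv ?\<chi> s' t' \<le> iv (\<lambda>_. 0) s' t'" by (rule iv_mono_AE[OF l\<chi>]) (use that in auto)
    then show ?thesis by (simp add: iv_def)
  qed
  \<comment> \<open>The value \<open>0\<close> on trivial intervals lets contact times coincide with
    each other or with the ends.\<close>
  define k where "k s' t' = (if s' < t' then opt.cl (\<gamma> s') s' (\<gamma> t') t' else 0)" for s' t'
  have k_sup: "k s' v + k v t' \<le> k s' t'" if "s' \<le> v" "v \<le> t'" for s' v t'
    using that opt.cl_superadd[of s' v t' "\<gamma> s'" "\<gamma> v" "\<gamma> t'"] by (auto simp: k_def)
  have k_low: "- iv ?e s' t' \<le> k s' t'" if "s \<le> s'" "s' \<le> t'" "t' \<le> t" for s' t'
    using curve_le_dd[OF adm, of s' t'] sub[of s' t'] that opt.cl_lower[of s' t' "\<gamma> s'" "\<gamma> t'"]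
    by (auto simp: k_def)
  have k_F: "iv \<rho> s' t' - iv (\<lambda>u. (g u)\<^sup>2) s' t' \<le> k s' t'" if "s' \<le> t'" "\<gamma> s' = F s'" "\<gamma> t' = F t'" for s' t'
    using eopt_ge_gain[of s' t'] opt.clo_eq[of s' t' "F s'" "F t'"] that by (auto simp: k_def)
  define f where "f s' t' = iv ?\<chi> s' t' - iv ?e s' t' - k s' t'" for s' t'
  have f_sub: "f s' t' \<le> f s' v + f v t'" if "s \<le> s'" "s' \<le> v" "v \<le> t'" "t' \<le> t" for s' v t'
    using comb[OF that] k_sup[OF that(2,3)] iv_combine[OF l\<chi> that(2,3)] by (simp add: f_def)
  have outer: "f s' t' \<le> 0" if "s \<le> s'" "s' \<le> t'" "t' \<le> t" "t' \<le> 0 \<or> 1 \<le> s'" for s' t'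
    using no_contact[of s' t'] k_low[OF that(1-3)] that(4) by (auto simp: f_def \<rho>_def \<phi>_def)
  have local_bound: "f s' t' \<le> r\<^sup>2 / q\<^sup>2 * (t' - s')\<^sup>2"
    if st': "s \<le> s'" "s' < t'" "t' \<le> t" "0 \<le> s'" "t' \<le> 1" "t' \<le> a \<or> a \<le> s'" for s' t'
  proof (cases "{u \<in> {s'..t'}. \<gamma> u = F u} = {}")
    case True
    then have "f s' t' \<le> 0"
      using no_contact[of s' t'] k_low[of s' t'] st' by (force simp: f_def)
    then show ?thesis by (rule order_trans) simp
  next
    case False
    let ?Z = "{u \<in> {s'..t'}. \<gamma> u = F u}"
    have "closed ?Z"
      using closed_Int[OF closed_atLeastAtMost[of s' t'] closed_Collect_eq[OF cont]] by (simp add: Int_def)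
    moreover have "bounded ?Z"
      by (rule bounded_subset[OF bounded_closed_interval[of s' t']]) auto
    \<comment> \<open>Compactness provides the first and last contact times. Outside them the
      contact density vanishes, and between them the energy of \<open>\<gamma>\<close> is at least
      that of the chord, hence that of \<open>F\<close> up to the quadratic excess.\<close>
    ultimately have Z: "compact ?Z" by (simp add: compact_eq_bounded_closed)
    obtain u1 where u1: "u1 \<in> ?Z" "\<And>u. u \<in> ?Z \<Longrightarrow> u1 \<le> u" using compact_attains_inf[OF Z False] by blast
    obtain u2 where u2: "u2 \<in> ?Z" "\<And>u. u \<in> ?Z \<Longrightarrow> u \<le> u2" using compact_attains_sup[OF Z False] by blast
    have o: "s' \<le> u1" "u1 \<le> u2" "u2 \<le> t'" using u1 u2 by auto
    have n1: "iv ?\<chi> s' u1 \<le> 0" 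
    proof (rule no_contact)
      fix u assume "s' < u" "u < u1"
      then show "\<gamma> u \<noteq> F u \<or> \<rho> u = 0" using u1(2)[of u] u1(1) by auto
    qed
    have n2: "iv ?\<chi> u2 t' \<le> 0" 
    proof (rule no_contact)
      fix u assume "u2 < u" "u < t'"
      then show "\<gamma> u \<noteq> F u \<or> \<rho> u = 0" using u2(2)[of u] u2(1) by auto
    qed
    have n3: "iv ?\<chi> u1 u2 \<le> iv \<rho> u1 u2" by (rule iv_mono[OF l\<chi> locint_\<rho>]) (use \<rho>_nonneg in auto)
    have "iv (\<lambda>u. (g u)\<^sup>2) u1 u2 \<le> iv ?e u1 u2 + r\<^sup>2 / q\<^sup>2 * (u2 - u1)\<^sup>2"
    proof (cases "u1 = u2")
      case False
      then have "iv (\<lambda>u. (g u)\<^sup>2) u1 u2 - (F u2 - F u1)\<^sup>2 / (u2 - u1) \<le> r\<^sup>2 / q\<^sup>2 * (u2 - u1)\<^sup>2"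
        using o st' by (intro energy_excess) auto
      moreover have "- iv ?e u1 u2 \<le> dd (\<gamma> u1) u1 (\<gamma> u2) u2"
        using o st' by (intro curve_le_dd[OF adm] sub) auto
      ultimately show ?thesis using u1(1) u2(1) by (simp add: dd_def)
    qed simp
    also have "r\<^sup>2 / q\<^sup>2 * (u2 - u1)\<^sup>2 \<le> r\<^sup>2 / q\<^sup>2 * (t' - s')\<^sup>2"
      using o by (intro mult_left_mono power_mono) auto
    finally have 1: "iv (\<lambda>u. (g u)\<^sup>2) u1 u2 \<le> iv ?e u1 u2 + r\<^sup>2 / q\<^sup>2 * (t' - s')\<^sup>2" by simp
    have "iv \<rho> u1 u2 - iv (\<lambda>u. (g u)\<^sup>2) u1 u2 \<le> k u1 u2" using u1(1) u2(1) o by (intro k_F) auto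
    moreover have "k s' u1 + (k u1 u2 + k u2 t') \<le> k s' t'"
      using k_sup[of u1 u2 t'] k_sup[of s' u1 t'] o by linarith
    moreover have "- iv ?e s' u1 \<le> k s' u1" "- iv ?e u2 t' \<le> k u2 t'"
      using o st' by (auto intro!: k_low)
    moreover have "iv ?e s' u1 + (iv ?e u1 u2 + iv ?e u2 t') = iv ?e s' t'"
      using comb[of s' u1 t'] comb[of u1 u2 t'] o st' by simp
    moreover have "iv ?\<chi> s' u1 + (iv ?\<chi> u1 u2 + iv ?\<chi> u2 t') = iv ?\<chi> s' t'"
      using iv_combine[OF l\<chi>, of s' u1 t'] iv_combine[OF l\<chi>, of u1 u2 t'] o by simp
    ultimately show ?thesis using 1 n1 n2 n3 unfolding f_def by linarith
  qed
  have inner: "f s' t' \<le> 0" if "s \<le> s'" "s' < t'" "t' \<le> t" "0 \<le> s'" "t' \<le> 1" "t' \<le> a \<or> a \<le> s'" for s' t'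
  proof (rule subdivide[where d = 1 and f = f and M = "r\<^sup>2 / q\<^sup>2"])
    fix x v y assume "s' \<le> x" "x < v" "v < y" "y \<le> t'"
    then show "f x y \<le> f x v + f v y" using that by (intro f_sub) auto
  next
    fix x y assume "s' \<le> x" "x < y" "y \<le> t'"
    then show "f x y \<le> r\<^sup>2 / q\<^sup>2 * (y - x)\<^sup>2" using that by (intro local_bound) auto
  qed (use that in auto)
  have f_same: "f s' s' = 0" for s' by (simp add: f_def k_def)
  \<comment> \<open>Square integrability of \<open>g'\<close> is available only on
    \<open>[s, t]\<close>, whereas \<open>glue\<close> runs over intervals that need not lie there;
    the premise in \<open>Q\<close> reconciles the two.\<close>
  define Q where "Q s' t' \<longleftrightarrow> (s \<le> s' \<and> t' \<le> t \<longrightarrow> f s' t' \<le> 0)" for s' t'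
  have Qtr: "Q s' t'" if "s' \<le> v" "v \<le> t'" "Q s' v" "Q v t'" for s' v t'
    using that f_sub[of s' v t'] by (auto simp: Q_def)
  have in1: "Q s' t'" if "0 \<le> s'" "s' \<le> t'" "t' \<le> a" for s' t'
    using inner[of s' t'] that f_same a by (cases "s' = t'") (auto simp: Q_def)
  have in2: "Q s' t'" if "a \<le> s'" "s' \<le> t'" "t' \<le> 1" for s' t'
    using inner[of s' t'] that f_same a by (cases "s' = t'") (auto simp: Q_def)
  have out: "Q s' t'" if "s' \<le> t'" "t' \<le> 0 \<or> 1 \<le> s'" for s' t'
    using outer[of s' t'] that by (auto simp: Q_def)
  have 3: "Q s' t'" if "a \<le> s'" "s' \<le> t'" for s' t'
    by (rule glue[of Q a 1]) (use Qtr in2 out that in auto)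
  have 2: "Q s' t'" if "0 \<le> s'" "s' \<le> t'" for s' t'
    by (rule glue[of Q 0 a]) (use Qtr in1 3 that in auto)
  have "Q s t"
    by (rule glue[of Q s 0]) (use Qtr out 2 st in auto)
  then show ?thesis using st by (simp add: Q_def f_def k_def)
qed

end

text \<open>One representation of a metric \<open>E\<close> whose rate exceeds the minimum by at
  most \<open>4 / 3 * \<epsilon>\<close>. The infimum defining \<open>rate\<close> need not be
  attained, so this locale is interpreted for ever smaller \<open>\<epsilon>\<close> with changing
  \<open>\<Gamma>\<close>, \<open>G\<close>, \<open>R\<close>, while \<open>E\<close> and its
  geodesic \<open>p\<close> stay the same.\<close>

locale competitor = passage a + dominated_planting \<Gamma> G R "envelope R"
  for a :: real and \<Gamma> G R :: "nat \<Rightarrow> real \<Rightarrow> real" +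
  fixes E :: "real \<Rightarrow> real \<Rightarrow> real \<Rightarrow> real \<Rightarrow> real" and p :: "real \<Rightarrow> real" and \<epsilon> :: real
  assumes wR: "weights R" and eps: "0 \<le> \<epsilon>" and rateR: "family_rate R \<le> ennreal (4 / 3 * (2 * r\<^sup>2 + \<epsilon>))"
    and E_eq: "\<And>x s y t. s < t \<Longrightarrow> planting \<Gamma> G R x s y t = ereal (E x s y t)"
    and p: "p 0 = 0" "p a = 1" "p 1 = 0"
    and additive: "\<And>s v t. 0 \<le> s \<Longrightarrow> s < v \<Longrightarrow> v < t \<Longrightarrow> t \<le> 1 \<Longrightarrow>
      E (p s) s (p v) v + E (p v) v (p t) t = E (p s) s (p t) t"
begin

abbreviation "\<sigma> \<equiv> envelope R"

lemma E_upper: "s < t \<Longrightarrow> E x s y t \<le> dd x s y t + iv \<sigma> s t"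
  using clo_upper[of x s y t] by (simp add: E_eq)

lemma E_lower: "s < t \<Longrightarrow> dd x s y t \<le> E x s y t"
  using clo_lower[of s t x y] by (simp add: E_eq)

lemma fin: "family_rate R < \<infinity>" using rateR by (auto intro: le_less_trans)

lemma L32_\<sigma>: "L32 \<sigma>" using envelope_L32(1)[OF wR fin] .

lemma \<sigma>_meas: "\<sigma> \<in> borel_measurable borel" using L32_\<sigma> by (simp add: L32_def)

lemma I32_\<sigma>: "I32 \<sigma> \<le> 2 * r\<^sup>2 + \<epsilon>"
proof -
  have "ennreal (4 / 3 * I32 \<sigma>) \<le> ennreal (4 / 3 * (2 * r\<^sup>2 + \<epsilon>))"
    using rateR envelope_L32(2)[OF wR fin] by simp
  then show ?thesis using eps by (subst (asm) ennreal_le_iff) auto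
qed

lemma W_bounds:
  "\<And>t. 0 < t \<Longrightarrow> t \<le> 1 \<Longrightarrow> dd 0 0 (p t) t \<le> E 0 0 (p t) t"
  "\<And>t. 0 < t \<Longrightarrow> t \<le> 1 \<Longrightarrow> E 0 0 (p t) t \<le> dd 0 0 (p t) t + iv \<sigma> 0 t"
  "\<And>s t. 0 < s \<Longrightarrow> s < t \<Longrightarrow> t \<le> 1 \<Longrightarrow> E 0 0 (p t) t - E 0 0 (p s) s \<le> dd (p s) s (p t) t + iv \<sigma> s t"
proof -
  fix s t :: real assume "0 < s" "s < t" "t \<le> 1"
  then show "E 0 0 (p t) t - E 0 0 (p s) s \<le> dd (p s) s (p t) t + iv \<sigma> s t"
    using additive[of 0 s t] E_upper[of s t "p s" "p t"] p by simp
qed (simp_all add: E_upper E_lower)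

lemma pairing_ge: "2 * r\<^sup>2 \<le> iv (\<lambda>u. \<phi> u * \<sigma> u) 0 1"
  by (rule lower_bounds(3)[OF loc nonneg \<sigma>_meas, where W = "\<lambda>t. E 0 0 (p t) t" and p = p]) (use W_bounds p in auto)

lemma I32_\<sigma>_ge: "2 * r\<^sup>2 \<le> I32 \<sigma>"
  using pairing_ge bregman_\<rho>[OF L32_\<sigma>] integral_bregman_nonneg[OF L32_\<sigma> L32_\<rho>] by linarith

lemma pairing_le: "iv (\<lambda>u. \<phi> u * \<sigma> u) 0 1 \<le> 2 * r\<^sup>2 + \<epsilon>"
  using I32_\<sigma> eps bregman_\<rho>[OF L32_\<sigma>] integral_bregman_nonneg[OF L32_\<sigma> L32_\<rho>] by linarith

text \<open>The divergence of \<open>\<sigma>\<close> from \<open>\<rho>\<close> is at most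
  \<open>\<epsilon>\<close>, so \<open>L1_small\<close> allows \<open>\<rho>\<close> in place of
  \<open>\<sigma>\<close> at a cost of order \<open>m\<close>.\<close>

lemma E_le_\<rho>:
  assumes m: "0 < m" "m \<le> 1" "\<epsilon> \<le> m\<^sup>2" and st: "s < t"
  shows "E x s y t \<le> dd x s y t + iv \<rho> s t + m * (2 + 2 * r\<^sup>2 + (t - s))"
proof -
  have "m\<^sup>2 \<le> 1" using m by (simp add: power_le_one)
  have "iv (\<lambda>u. \<bar>\<sigma> u - \<rho> u\<bar>) s t \<le> m * (1 + (2 * r\<^sup>2 + 1) + (t - s))"
  proof (rule L1_small[OF L32_\<sigma> L32_\<rho> _ m(1)])
    show "(LINT u|lborel. bregman (\<sigma> u) (\<rho> u)) \<le> m\<^sup>2"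
      unfolding bregman_\<rho>[OF L32_\<sigma>] using I32_\<sigma> pairing_ge m by linarith
    show "I32 \<sigma> + I32 \<rho> \<le> 2 * (2 * r\<^sup>2 + 1)" using I32_\<sigma> I32_\<rho> m(3) \<open>m\<^sup>2 \<le> 1\<close> by simp
  qed (use st in auto)
  moreover have "iv \<sigma> s t \<le> iv \<rho> s t + iv (\<lambda>u. \<bar>\<sigma> u - \<rho> u\<bar>) s t"
  proof -
    have l: "locint (\<lambda>u. \<bar>\<sigma> u - \<rho> u\<bar>)" using loc locint_\<rho> by (intro locint_abs locint_diff)
    have "iv \<sigma> s t \<le> iv (\<lambda>u. \<rho> u + \<bar>\<sigma> u - \<rho> u\<bar>) s t"
      by (rule iv_mono[OF loc]) (use l locint_\<rho> in auto)
    then show ?thesis using iv_add[OF locint_\<rho> l] by simp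
  qed
  ultimately show ?thesis using E_upper[OF st, of x y] by (simp add: algebra_simps)
qed

end

section \<open>Planted mass near the optimal curve and away from it\<close>

context competitor
begin

definition near :: "real \<Rightarrow> nat \<Rightarrow> real \<Rightarrow> real" where
  "near \<eta> = (\<lambda>i u. if \<bar>\<Gamma> i u - F u\<bar> < \<eta> then R i u else 0)"

definition far :: "real \<Rightarrow> nat \<Rightarrow> real \<Rightarrow> real" where
  "far \<eta> = (\<lambda>i u. if \<not> \<bar>\<Gamma> i u - F u\<bar> < \<eta> then R i u else 0)"

definition off :: "nat \<Rightarrow> real \<Rightarrow> real" where
  "off = (\<lambda>i u. if \<not> \<Gamma> i u = F u then R i u else 0)"

lemma contact_sets: "{u. \<bar>\<Gamma> i u - F u\<bar> < \<eta>} \<in> sets borel" "{u. \<not> \<bar>\<Gamma> i u - F u\<bar> < \<eta>} \<in> sets borel"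
  "{u. \<Gamma> i u = F u} \<in> sets borel" "{u. \<not> \<Gamma> i u = F u} \<in> sets borel"
proof -
  have [measurable]: "\<Gamma> i \<in> borel_measurable borel" "F \<in> borel_measurable borel"
    using admissible_continuous[OF adm] admissible_continuous[OF admissible_F]
    by (auto intro: borel_measurable_continuous_onI)
  show "{u. \<bar>\<Gamma> i u - F u\<bar> < \<eta>} \<in> sets borel" "{u. \<not> \<bar>\<Gamma> i u - F u\<bar> < \<eta>} \<in> sets borel"
    "{u. \<Gamma> i u = F u} \<in> sets borel" "{u. \<not> \<Gamma> i u = F u} \<in> sets borel"
    by measurable
qed

lemma weights_parts: "weights (near \<eta>)" "weights (far \<eta>)" "weights off"
  unfolding near_def far_def off_def using contact_sets by (intro weights_restrict[OF wR]; simp)+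

lemma family_rate_near_far: "family_rate R = family_rate (near \<eta>) + family_rate (far \<eta>)"
  unfolding near_def far_def by (rule family_rate_split[OF wR]) (rule contact_sets)

lemma fin_parts: "family_rate (near \<eta>) < \<infinity>" "family_rate (far \<eta>) < \<infinity>"
  using fin unfolding family_rate_near_far[of \<eta>] by auto

abbreviation "\<nu> \<eta> \<equiv> envelope (near \<eta>)"

lemma R_nonneg: "0 \<le> R i u" using wR by (simp add: weights_def)

lemma L32_\<nu>: "L32 (\<nu> \<eta>)" using envelope_L32(1)[OF weights_parts(1) fin_parts(1)] .

lemma \<nu>_nonneg: "0 \<le> \<nu> \<eta> u" using L32_\<nu> by (simp add: L32_def)

lemma locint_\<nu>: "locint (\<nu> \<eta>)" by (rule L32_locint[OF L32_\<nu>])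

lemma iv_\<nu>_le: "iv (\<nu> \<eta>) s t \<le> iv \<sigma> s t"
proof (rule iv_mono_AE[OF locint_\<nu> loc])
  have "AE u in lborel. \<nu> \<eta> u \<le> \<sigma> u"
    by (rule envelope_mono_AE[OF wR fin]) (use R_nonneg in \<open>auto simp: near_def\<close>)
  then show "AE u in lborel. s < u \<and> u < t \<longrightarrow> \<nu> \<eta> u \<le> \<sigma> u" by eventually_elim simp
qed

lemma I32_split: "I32 \<sigma> = I32 (\<nu> \<eta>) + I32 (envelope (far \<eta>))"
proof -
  have "ennreal (4 / 3 * I32 \<sigma>) = ennreal (4 / 3 * (I32 (\<nu> \<eta>) + I32 (envelope (far \<eta>))))"
    using family_rate_near_far[of \<eta>] envelope_L32(2)[OF wR fin] envelope_L32(2)[OF weights_parts(1) fin_parts(1), of \<eta>]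
      envelope_L32(2)[OF weights_parts(2) fin_parts(2), of \<eta>] I32_nonneg
    by (simp add: distrib_left ennreal_plus[symmetric] del: ennreal_plus)
  then show ?thesis using I32_nonneg by (subst (asm) ennreal_inj) (auto intro: add_nonneg_nonneg)
qed

text \<open>A route either stays \<open>\<eta>\<close>-close to \<open>F\<close>, and profits only from the nearby densities, or makes a
  detour through a point at distance at least \<open>\<eta>\<close>.\<close>
lemma E_near_or_detour:
  assumes "s < t"
    and detour: "\<And>z u. s < u \<Longrightarrow> u < t \<Longrightarrow> \<eta> \<le> \<bar>z - F u\<bar> \<Longrightarrow> dd x s z u + dd z u y t + iv \<sigma> s t \<le> B"
    and near: "dd x s y t + iv (\<nu> \<eta>) s t \<le> B"
  shows "E x s y t \<le> B"
proof -
  define T where "T x s y t = insert (dd x s y t + iv (\<nu> \<eta>) s t)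
    {dd x s z u + dd z u y t + iv \<sigma> s t |z u. s < u \<and> u < t \<and> \<eta> \<le> \<bar>z - F u\<bar>}" for x s y t
  have dmem: "dd x s y t + iv (\<nu> \<eta>) s t \<in> T x s y t" for x s y t by (simp add: T_def)
  have memI: "dd x s z u + dd z u y t + iv \<sigma> s t \<in> T x s y t" if "s < u" "u < t" "\<eta> \<le> \<bar>z - F u\<bar>" for x s y t z u
    using that by (auto simp: T_def)
  define D where "D = (\<lambda>x s y t. SUP v\<in>T x s y t. ereal v)"
  have ub: "ereal v \<le> D x s y t" if "v \<in> T x s y t" for v x s y t
    unfolding D_def by (rule SUP_upper[OF that])
  have "majorant \<Gamma> G R D"
    unfolding majorant_def
  proof (intro conjI allI)
    show "superadd D" unfolding D_def
    proof (rule superadd_SUP)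
      fix x s y t show "T x s y t \<noteq> {}" by (simp add: T_def)
    next
      fix x s y t z u and v1 v2 :: real
      assume st: "s < t" "t < u" and v1: "v1 \<in> T x s y t" and v2: "v2 \<in> T y t z u"
      have c: "iv \<sigma> s t + iv \<sigma> t u = iv \<sigma> s u" "iv (\<nu> \<eta>) s t + iv (\<nu> \<eta>) t u = iv (\<nu> \<eta>) s u"
        using st by (auto intro!: iv_combine loc locint_\<nu>)
      from v1 consider (1) "v1 = dd x s y t + iv (\<nu> \<eta>) s t"
        | (2) x' b where "v1 = dd x s x' b + dd x' b y t + iv \<sigma> s t" "s < b" "b < t" "\<eta> \<le> \<bar>x' - F b\<bar>"
        unfolding T_def by blast
      then show "\<exists>v'\<in>T x s z u. v1 + v2 \<le> v'"
      proof cases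
        case 1
        from v2 consider (a) "v2 = dd y t z u + iv (\<nu> \<eta>) t u"
          | (b) y' b' where "v2 = dd y t y' b' + dd y' b' z u + iv \<sigma> t u" "t < b'" "b' < u" "\<eta> \<le> \<bar>y' - F b'\<bar>"
          unfolding T_def by blast
        then show ?thesis
        proof cases
          case a
          then show ?thesis using 1 c dd_superadd_strict[OF st, of x y z]
            by (intro bexI[OF _ dmem]) auto
        next
          case b
          then show ?thesis using 1 c st dd_superadd_strict[of s t b' x y y'] iv_\<nu>_le[of \<eta> s t]
            by (intro bexI[OF _ memI[of s b' u y']]) auto
        qed
      next
        case 2
        have "v2 \<le> dd y t z u + iv \<sigma> t u"
        proof -
          from v2 consider (a) "v2 = dd y t z u + iv (\<nu> \<eta>) t u"
            | (b) y' b' where "v2 = dd y t y' b' + dd y' b' z u + iv \<sigma> t u" "t < b'" "b' < u"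
            unfolding T_def by blast
          then show ?thesis
          proof cases
            case a
            then show ?thesis using iv_\<nu>_le[of \<eta> t u] by simp
          next
            case b
            then show ?thesis using dd_superadd_strict[of t b' u y y' z] by simp
          qed
        qed
        then show ?thesis using 2 c st dd_superadd_strict[of b t u x' y z]
          by (intro bexI[OF _ memI[of s b u x']]) auto
      qed
    qed
    show "dle dirichlet D"
      unfolding dle_def
    proof safe
      fix x s y t :: real assume "s < t"
      have "dirichlet x s y t \<le> ereal (dd x s y t + iv (\<nu> \<eta>) s t)"
        using iv_nonneg[of "\<nu> \<eta>" s t] \<nu>_nonneg by (simp add: dirichlet_eq)
      then show "dirichlet x s y t \<le> D x s y t" using ub[OF dmem] by (rule order_trans)
    qed
    fix i
    show "dle (curve_metric (\<Gamma> i) (G i) (R i)) D" unfolding dle_def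
    proof safe
      fix x s y t :: real assume st: "s < t"
      show "curve_metric (\<Gamma> i) (G i) (R i) x s y t \<le> D x s y t"
      proof (cases rule: curve_metric_cases[OF adm[of i], of x s y t])
        case 2
        show ?thesis
        proof (cases "\<forall>u. s < u \<and> u < t \<longrightarrow> \<bar>\<Gamma> i u - F u\<bar> < \<eta>")
          case True
          have "iv (R i) s t \<le> iv (\<nu> \<eta>) s t"
          proof (rule iv_mono_AE[OF admissible_locint(1)[OF adm] locint_\<nu>])
            show "AE u in lborel. s < u \<and> u < t \<longrightarrow> R i u \<le> \<nu> \<eta> u"
              using envelope_dominates[OF weights_parts(1) fin_parts(1), of \<eta> i]
              by eventually_elim (use True in \<open>auto simp: near_def\<close>)
          qed
          then have "curve_metric (\<Gamma> i) (G i) (R i) x s y t \<le> ereal (dd x s y t + iv (\<nu> \<eta>) s t)"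
            using 2 curve_le_dd[OF adm less_imp_le[OF st] 2(3)] by simp
          then show ?thesis using ub[OF dmem] by (rule order_trans)
        next
          case False
          then obtain u where u: "s < u" "u < t" "\<eta> \<le> \<bar>\<Gamma> i u - F u\<bar>" by (auto simp: not_less)
          have i: "set_integrable lborel {s..u} (\<lambda>u. (G i u)\<^sup>2)" "set_integrable lborel {u..t} (\<lambda>u. (G i u)\<^sup>2)"
            using u by (auto intro: set_integrable_subset[OF 2(3)])
          have "iv (\<lambda>u. (G i u)\<^sup>2) s u + iv (\<lambda>u. (G i u)\<^sup>2) u t = iv (\<lambda>u. (G i u)\<^sup>2) s t"
            using u by (intro iv_combine_on[OF 2(3)]) auto
          moreover have "iv (R i) s t \<le> iv \<sigma> s t"
            by (rule iv_mono_AE[OF admissible_locint(1)[OF adm] loc]) (use dom[of i] in auto)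
          ultimately have "curve_metric (\<Gamma> i) (G i) (R i) x s y t \<le> ereal (dd x s (\<Gamma> i u) u + dd (\<Gamma> i u) u y t + iv \<sigma> s t)"
            using 2 curve_le_dd[OF adm less_imp_le[OF u(1)] i(1)] curve_le_dd[OF adm less_imp_le[OF u(2)] i(2)] by simp
          then show ?thesis using ub[OF memI[OF u]] by (rule order_trans)
        qed
      qed auto
    qed
  qed
  from planting_le[OF this, of x s y t] have "ereal (E x s y t) \<le> D x s y t"
    using E_eq[OF assms(1)] by simp
  also have "\<dots> \<le> ereal B"
    unfolding D_def by (rule SUP_least) (use detour near in \<open>auto simp: T_def\<close>)
  finally show ?thesis by simp
qed

text \<open>Within a short time a detour to distance \<open>\<eta>\<close> from \<open>F\<close>
  costs more than all the available density can repay, so the first alternative of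
  \<open>E_near_or_detour\<close> wins.\<close>

lemma E_near:
  assumes "\<eta> > 0"
  shows "\<exists>d>0. \<forall>s t. 0 \<le> s \<and> s < t \<and> t \<le> 1 \<and> t - s < d \<longrightarrow> E (F s) s (F t) t \<le> dd (F s) s (F t) t + iv (\<nu> \<eta>) s t"
proof -
  define L S where "L = 3 * r + c" and "S = iv \<sigma> 0 1"
  have L: "L > 0" using r(1) c by (simp add: L_def)
  have S: "S \<ge> 0" unfolding S_def by (rule iv_nonneg[OF nonneg])
  \<comment> \<open>The second bound keeps \<open>F\<close> within \<open>\<eta> / 2\<close> of its
    starting point, so a detour covers at least \<open>\<eta> / 2\<close>. The third makes its cost
    at least \<open>S + L\<^sup>2\<close>: the total mass plus, for intervals shorter than
    \<open>1\<close>, the cost of the chord of \<open>F\<close>.\<close>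
  define d where "d = min 1 (min (\<eta> / (2 * L)) (\<eta>\<^sup>2 / (4 * (S + L\<^sup>2))))"
  have SL: "S + L\<^sup>2 > 0" using S L by (simp add: add_nonneg_pos)
  have d: "d > 0" using assms L SL by (simp add: d_def)
  have "E (F s) s (F t) t \<le> dd (F s) s (F t) t + iv (\<nu> \<eta>) s t" if st: "0 \<le> s" "s < t" "t \<le> 1" "t - s < d" for s t
  proof (rule E_near_or_detour[OF st(2)])
    fix z u assume u: "s < u" "u < t" "\<eta> \<le> \<bar>z - F u\<bar>"
    have d1: "t - s < 1" "t - s < \<eta> / (2 * L)" "t - s < \<eta>\<^sup>2 / (4 * (S + L\<^sup>2))" using st(4) unfolding d_def by linarith+
    have "L * (t - s) < \<eta> / 2" using d1(2) L by (simp add: field_simps)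
    moreover have "\<bar>F u - F s\<bar> \<le> L * (t - s)"
      using F_lipschitz[of s u] u L by (auto simp: L_def[symmetric] intro: order_trans)
    ultimately have "\<eta> / 2 \<le> \<bar>z - F s\<bar>" using u(3) by linarith
    then have "(\<eta> / 2)\<^sup>2 \<le> (z - F s)\<^sup>2" using assms by (intro abs_le_square_iff[THEN iffD1]) auto
    then have "(\<eta> / 2)\<^sup>2 / (t - s) \<le> (z - F s)\<^sup>2 / (u - s)"
      using u st by (intro frac_le) auto
    then have 1: "dd (F s) s z u \<le> - (\<eta>\<^sup>2 / 4) / (t - s)" by (simp add: dd_def power_divide)
    have 2: "dd z u (F t) t \<le> 0" using u by (intro dd_nonpos) auto
    have 3: "iv \<sigma> s t \<le> S" unfolding S_def using st by (intro iv_mono_interval loc nonneg) auto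
    have "(F t - F s)\<^sup>2 \<le> (L * (t - s))\<^sup>2"
      using F_lipschitz[of s t] st L by (intro abs_le_square_iff[THEN iffD1]) (auto simp: L_def[symmetric])
    then have "(F t - F s)\<^sup>2 / (t - s) \<le> (L * (t - s))\<^sup>2 / (t - s)" using st by (intro divide_right_mono) auto
    also have "\<dots> = L\<^sup>2 * (t - s)" using st by (simp add: power_mult_distrib power2_eq_square[of "t - s"])
    also have "\<dots> \<le> L\<^sup>2 * 1" using d1 by (intro mult_left_mono) auto
    finally have 4: "- L\<^sup>2 \<le> dd (F s) s (F t) t" by (simp add: dd_def)
    have "S + L\<^sup>2 \<le> (\<eta>\<^sup>2 / 4) / (t - s)" using d1(3) SL st by (simp add: field_simps)
    then show "dd (F s) s z u + dd z u (F t) t + iv \<sigma> s t \<le> dd (F s) s (F t) t + iv (\<nu> \<eta>) s t"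
      using 1 2 3 4 iv_nonneg[of "\<nu> \<eta>" s t, OF \<nu>_nonneg] by simp
  qed simp
  then show ?thesis using d by blast
qed

section \<open>Representations of a metric with the optimal distances along the curve\<close>

context
  assumes gain: "\<And>s t. 0 \<le> s \<Longrightarrow> s < t \<Longrightarrow> t \<le> 1 \<Longrightarrow> E (F s) s (F t) t = w t - w s"
begin

text \<open>On short intervals the distance \<open>w t - w s\<close> can be earned only from
  densities planted near \<open>F\<close>. Comparing energy and chord leaves a quadratic error,
  removed by subdivision on either side of the kink at \<open>a\<close>.\<close>

lemma iv_\<rho>_le_\<nu>:
  assumes \<eta>: "\<eta> > 0" and st: "0 \<le> s" "s \<le> t" "t \<le> 1"
  shows "iv \<rho> s t \<le> iv (\<nu> \<eta>) s t"
proof -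
  obtain d where d: "d > 0" "\<And>s t. 0 \<le> s \<Longrightarrow> s < t \<Longrightarrow> t \<le> 1 \<Longrightarrow> t - s < d \<Longrightarrow>
      E (F s) s (F t) t \<le> dd (F s) s (F t) t + iv (\<nu> \<eta>) s t" using E_near[OF \<eta>] by blast
  define f where "f s t = iv \<rho> s t - iv (\<nu> \<eta>) s t" for s t
  have f_add: "f s t = f s v + f v t" if "s \<le> v" "v \<le> t" for s v t
    using iv_combine[OF locint_\<rho> that] iv_combine[OF locint_\<nu> that, of \<eta>] by (simp add: f_def)
  have piece: "f s t \<le> 0" if "0 \<le> s" "s \<le> t" "t \<le> 1" "t \<le> a \<or> a \<le> s" for s t
  proof (cases "s = t")
    case False
    show ?thesis
    proof (rule subdivide[where f = f and d = d and M = "r\<^sup>2 / q\<^sup>2"])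
      fix x v y assume "s \<le> x" "x < v" "v < y" "y \<le> t"
      then show "f x y \<le> f x v + f v y" using f_add[of x v y] by simp
    next
      fix x y assume xy: "s \<le> x" "x < y" "y \<le> t" "y - x < d"
      have "w y - w x = iv \<rho> x y - iv (\<lambda>u. (g u)\<^sup>2) x y" using xy that by (subst gain_eq) auto
      moreover have "w y - w x \<le> dd (F x) x (F y) y + iv (\<nu> \<eta>) x y"
        using d(2)[of x y] gain[of x y] xy that by simp
      moreover have "iv (\<lambda>u. (g u)\<^sup>2) x y - (F y - F x)\<^sup>2 / (y - x) \<le> r\<^sup>2 / q\<^sup>2 * (y - x)\<^sup>2"
        using xy that by (intro energy_excess) auto
      ultimately show "f x y \<le> r\<^sup>2 / q\<^sup>2 * (y - x)\<^sup>2" by (simp add: f_def dd_def)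
    qed (use d(1) that False in auto)
  qed (simp add: f_def)
  have "f s t \<le> 0"
  proof (cases "s \<le> a \<and> a \<le> t")
    case True
    then show ?thesis using piece[of s a] piece[of a t] f_add[of s a t] st a by simp
  qed (use piece[of s t] st in auto)
  then show ?thesis by (simp add: f_def)
qed

text \<open>The comparison with \<open>\<rho>\<close> makes \<open>w\<close> and \<open>F\<close>
  satisfy the hypotheses of \<open>lower_bounds\<close> with the near density alone.\<close>

lemma pairing_near_ge: "\<eta> > 0 \<Longrightarrow> 2 * r\<^sup>2 \<le> iv (\<lambda>u. \<phi> u * \<nu> \<eta> u) 0 1"
proof (rule lower_bounds(3)[OF locint_\<nu> \<nu>_nonneg, where W = w and p = F])
  assume \<eta>: "\<eta> > 0"
  have *: "w t - w s \<le> dd (F s) s (F t) t + iv (\<nu> \<eta>) s t" if "0 \<le> s" "s < t" "t \<le> 1" for s t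
    using gain_eq[of s t] iv_\<rho>_le_\<nu>[OF \<eta>, of s t] curve_le_dd[OF admissible_F, of s t] locintD[OF locint_g2, of s t] that by simp
  show "w t - w s \<le> dd (F s) s (F t) t + iv (\<nu> \<eta>) s t" if "0 < s" "s < t" "t \<le> 1" for s t
    using * that by simp
  show "w t \<le> dd 0 0 (F t) t + iv (\<nu> \<eta>) 0 t" if "0 < t" "t \<le> 1" for t
    using *[of 0 t] that by (simp add: F_ends w_ends)
  show "dd 0 0 (F t) t \<le> w t" if "0 < t" "t \<le> 1" for t
    using gain_ge_dd[of 0 t] that by (simp add: F_ends w_ends)
qed (use L32_\<nu> F_ends in \<open>auto simp: L32_def\<close>)

text \<open>The near part already uses up the minimum \<open>2 r\<^sup>2\<close> of
  \<open>I32\<close>, so at most \<open>\<epsilon>\<close> remains for the far part; the same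
  surplus bounds the divergence of the near part from \<open>\<rho>\<close>.\<close>

lemma near_far_bounds:
  assumes "\<eta> > 0"
  shows "I32 (envelope (far \<eta>)) \<le> \<epsilon>" "(LINT u|lborel. bregman (\<nu> \<eta> u) (\<rho> u)) \<le> \<epsilon>" "I32 (\<nu> \<eta>) \<le> 2 * r\<^sup>2 + \<epsilon>"
  using I32_split[of \<eta>] I32_\<sigma> bregman_\<rho>[OF L32_\<nu>, of \<eta>] integral_bregman_nonneg[OF L32_\<nu> L32_\<rho>, of \<eta>]
    pairing_near_ge[OF assms] I32_nonneg[of "envelope (far \<eta>)"] by linarith+

text \<open>The bound on the far part is uniform in \<open>\<eta>\<close>, and the far parts
  increase to \<open>off\<close> as \<open>\<eta>\<close> tends to \<open>0\<close>: monotone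
  convergence.\<close>

lemma family_rate_off: "family_rate off \<le> ennreal (4 / 3 * \<epsilon>)"
proof -
  define \<eta> where "\<eta> n = 1 / real (Suc n)" for n
  have \<eta>: "\<eta> n > 0" for n by (simp add: \<eta>_def)
  define fn where "fn n i u = ennreal (far (\<eta> n) i u powr (3/2))" for n i u
  have inc: "incseq (\<lambda>n. fn n i u)" for i u
  proof (rule incseq_SucI)
    fix n
    have "\<eta> (Suc n) \<le> \<eta> n" by (simp add: \<eta>_def frac_le)
    then show "fn n i u \<le> fn (Suc n) i u" by (auto simp: fn_def far_def)
  qed
  have sup: "(SUP n. fn n i u) = ennreal (off i u powr (3/2))" for i u
  proof (rule antisym)
    show "(SUP n. fn n i u) \<le> ennreal (off i u powr (3/2))"
    proof (rule SUP_least)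
      fix n show "fn n i u \<le> ennreal (off i u powr (3/2))"
        using \<eta>[of n] by (auto simp: fn_def far_def off_def)
    qed
    show "ennreal (off i u powr (3/2)) \<le> (SUP n. fn n i u)"
    proof (cases "\<Gamma> i u = F u")
      case False
      then obtain n where "\<eta> n < \<bar>\<Gamma> i u - F u\<bar>" unfolding \<eta>_def using nat_approx_posE[of "\<bar>\<Gamma> i u - F u\<bar>"] by auto
      then show ?thesis using False by (intro SUP_upper2[of n]) (auto simp: fn_def far_def off_def)
    qed (simp add: off_def)
  qed
  have [measurable]: "\<And>n i. far (\<eta> n) i \<in> borel_measurable borel"
    using weights_parts(2) by (simp add: weights_def)
  have "(\<integral>\<^sup>+ u. (\<Sum>i. ennreal (off i u powr (3/2))) \<partial>lborel) = (\<integral>\<^sup>+ u. (SUP n. \<Sum>i. fn n i u) \<partial>lborel)"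
    unfolding sup[symmetric] by (subst ennreal_suminf_SUP_eq[OF inc]) simp
  also have "\<dots> = (SUP n. \<integral>\<^sup>+ u. (\<Sum>i. fn n i u) \<partial>lborel)"
  proof (rule nn_integral_monotone_convergence_SUP)
    show "incseq (\<lambda>n u. \<Sum>i. fn n i u)"
      using inc by (auto simp: incseq_def le_fun_def intro!: suminf_le summableI)
    show "(\<lambda>u. \<Sum>i. fn n i u) \<in> borel_measurable lborel" for n unfolding fn_def by measurable
  qed
  finally have eq: "(\<integral>\<^sup>+ u. (\<Sum>i. ennreal (off i u powr (3/2))) \<partial>lborel) = (SUP n. \<integral>\<^sup>+ u. (\<Sum>i. fn n i u) \<partial>lborel)" .
  have "ennreal (4/3) * (\<integral>\<^sup>+ u. (\<Sum>i. fn n i u) \<partial>lborel) \<le> ennreal (4 / 3 * \<epsilon>)" for n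
    using envelope_L32(2)[OF weights_parts(2) fin_parts(2), of "\<eta> n"] near_far_bounds(1)[OF \<eta>[of n]]
      family_rate_eq[OF weights_parts(2), of "\<eta> n"]
    by (simp add: fn_def) (intro ennreal_leI, simp)
  then have "ennreal (4/3) * (SUP n. \<integral>\<^sup>+ u. (\<Sum>i. fn n i u) \<partial>lborel) \<le> ennreal (4 / 3 * \<epsilon>)"
    by (subst SUP_mult_left_ennreal) (auto intro: SUP_least)
  then show ?thesis unfolding family_rate_eq[OF weights_parts(3)] eq .
qed

text \<open>On contact with \<open>F\<close> a density is at most \<open>\<rho>\<close> plus a small
  L1 error; off \<open>F\<close> it is small itself. Adding the integral of these errors to
  \<open>opt.cl\<close> therefore gives a majorant of the representation.\<close>

lemma E_le_eopt:
  assumes m: "0 < m" "m \<le> 1" "\<epsilon> \<le> m\<^sup>2" and st: "s < t"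
  shows "E x s y t \<le> opt.cl x s y t + m * (2 * (2 + 2 * r\<^sup>2 + (t - s)))"
proof -
  have "m\<^sup>2 \<le> 1" using m by (simp add: power_le_one)
  define \<omega> where "\<omega> = envelope off"
  have fin_off: "family_rate off < \<infinity>" using family_rate_off by (auto intro: le_less_trans)
  have L\<omega>: "L32 \<omega>" unfolding \<omega>_def by (rule envelope_L32(1)[OF weights_parts(3) fin_off])
  have \<omega>0: "0 \<le> \<omega> u" for u using L\<omega> by (simp add: L32_def)
  have I\<omega>: "I32 \<omega> \<le> \<epsilon>"
  proof -
    have "ennreal (4 / 3 * I32 \<omega>) \<le> ennreal (4 / 3 * \<epsilon>)"
      using family_rate_off envelope_L32(2)[OF weights_parts(3) fin_off] by (simp add: \<omega>_def)
    then show ?thesis using eps by (subst (asm) ennreal_le_iff) auto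
  qed
  \<comment> \<open>Radius \<open>1\<close> serves only to capture contact times, which are near for
    every positive radius. The subtracted \<open>0\<close> puts the second term in the form of
    \<open>L1_small\<close>.\<close>
  define h where "h u = \<bar>\<nu> 1 u - \<rho> u\<bar> + \<bar>\<omega> u - 0\<bar>" for u
  have l1: "locint (\<lambda>u. \<bar>\<nu> 1 u - \<rho> u\<bar>)" by (intro locint_abs locint_diff locint_\<nu> locint_\<rho>)
  have l2: "locint (\<lambda>u. \<bar>\<omega> u - 0\<bar>)" using L32_locint[OF L\<omega>] by (intro locint_abs locint_diff) auto
  have lh: "locint h" unfolding h_def by (rule locint_add[OF l1 l2])
  define D where "D = (\<lambda>x s y t. ereal (opt.cl x s y t + iv h s t))"
  have "majorant \<Gamma> G R D"
    unfolding majorant_def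
  proof (intro conjI allI)
    show "superadd D"
      unfolding superadd_def D_def
    proof safe
      fix x s y t z u :: real assume st: "s < t" "t < u"
      then show "ereal (opt.cl x s y t + iv h s t) + ereal (opt.cl y t z u + iv h t u) \<le> ereal (opt.cl x s z u + iv h s u)"
        using opt.cl_superadd[OF st, of x y z] iv_combine[OF lh, of s t u] by simp
    qed
    show "dle dirichlet D"
      unfolding dle_def D_def
    proof safe
      fix x s y t :: real assume st: "s < t"
      then show "dirichlet x s y t \<le> ereal (opt.cl x s y t + iv h s t)"
        using opt.cl_lower[OF st, of x y] iv_nonneg[of h s t] by (simp add: dirichlet_eq h_def)
    qed
    fix i
    show "dle (curve_metric (\<Gamma> i) (G i) (R i)) D"
      unfolding dle_def D_def
    proof safe
      fix x s y t :: real assume st: "s < t"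
      show "curve_metric (\<Gamma> i) (G i) (R i) x s y t \<le> ereal (opt.cl x s y t + iv h s t)"
      proof (cases rule: curve_metric_cases[OF adm[of i], of x s y t])
        case 2
        let ?\<chi> = "\<lambda>u. if \<Gamma> i u = F u then \<rho> u else 0"
        have l\<chi>: "locint ?\<chi>"
        proof (rule locint_bound[OF locint_\<rho>])
          have [measurable]: "Measurable.pred borel (\<lambda>u. \<Gamma> i u = F u)" using contact_sets by (simp add: pred_def)
          show "?\<chi> \<in> borel_measurable lborel" by measurable
        qed auto
        have "iv (R i) s t \<le> iv (\<lambda>u. ?\<chi> u + h u) s t"
        proof (rule iv_mono_AE[OF admissible_locint(1)[OF adm] locint_add[OF l\<chi> lh]])
          show "AE u in lborel. s < u \<and> u < t \<longrightarrow> R i u \<le> ?\<chi> u + h u"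
            using envelope_dominates[OF weights_parts(1) fin_parts(1), of 1 i] envelope_dominates[OF weights_parts(3) fin_off, of i]
          proof eventually_elim
            case (elim u)
            show ?case
            proof (cases "\<Gamma> i u = F u")
              case True
              then have "near 1 i u = R i u" by (simp add: near_def)
              then have "R i u \<le> \<nu> 1 u" using elim(1) by simp
              moreover have "\<nu> 1 u \<le> \<rho> u + \<bar>\<nu> 1 u - \<rho> u\<bar>" by linarith
              ultimately show ?thesis using True \<omega>0[of u] by (simp add: h_def)
            next
              case False
              then have "off i u = R i u" by (simp add: off_def)
              then have "R i u \<le> \<omega> u" using elim(2) by (simp add: \<omega>_def)
              then have "R i u \<le> \<bar>\<nu> 1 u - \<rho> u\<bar> + \<bar>\<omega> u - 0\<bar>" using \<omega>0[of u] by linarith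
              then show ?thesis using False by (simp add: h_def)
            qed
          qed
        qed
        then have "iv (R i) s t \<le> iv ?\<chi> s t + iv h s t" using iv_add[OF l\<chi> lh] by simp
        then show ?thesis using contact_gain_le_eopt[OF adm st 2(3)] 2 by simp
      qed auto
    qed
  qed
  from planting_le[OF this, of x s y t] have 1: "E x s y t \<le> opt.cl x s y t + iv h s t"
    using E_eq[OF st, of x y] by (simp add: D_def)
  have "iv (\<lambda>u. \<bar>\<nu> 1 u - \<rho> u\<bar>) s t \<le> m * (1 + (2 * r\<^sup>2 + 1) + (t - s))"
    using near_far_bounds[of 1] I32_\<rho> m \<open>m\<^sup>2 \<le> 1\<close> st by (intro L1_small[OF L32_\<nu> L32_\<rho> _ m(1)]) auto
  moreover have "iv (\<lambda>u. \<bar>\<omega> u - 0\<bar>) s t \<le> m * (1 + (2 * r\<^sup>2 + 1) + (t - s))"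
  proof (rule L1_small[OF L\<omega> L32_zero _ m(1)])
    show "(LINT u|lborel. bregman (\<omega> u) 0) \<le> m\<^sup>2" using I\<omega> m by (simp add: bregman_def I32_def)
    have "I32 \<omega> \<le> 1" using I\<omega> m(3) \<open>m\<^sup>2 \<le> 1\<close> by linarith
    then show "I32 \<omega> + I32 (\<lambda>_. 0) \<le> 2 * (2 * r\<^sup>2 + 1)" by (simp add: add_increasing)
  qed (use st in auto)
  moreover have "iv h s t = iv (\<lambda>u. \<bar>\<nu> 1 u - \<rho> u\<bar>) s t + iv (\<lambda>u. \<bar>\<omega> u - 0\<bar>) s t"
    unfolding h_def by (rule iv_add[OF l1 l2])
  moreover have "m * (2 * (2 + 2 * r\<^sup>2 + (t - s))) = m * (1 + (2 * r\<^sup>2 + 1) + (t - s)) + m * (1 + (2 * r\<^sup>2 + 1) + (t - s))"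
    by (simp add: algebra_simps)
  ultimately show ?thesis using 1 by linarith
qed

end

end

lemma admissible_weights: "(\<And>i. admissible (\<Gamma> i) (G i) (R i)) \<Longrightarrow> weights R"
  by (auto simp: weights_def admissible_def)

section \<open>Minimal rate and identification of the minimiser\<close>

context passage
begin

lemma competitor_of_planted:
  assumes e: "e \<in> through_metrics a"
    and geo: "is_geodesic e p 0 1" "p 0 = 0" "p a = 1" "p 1 = 0"
    and adm: "\<And>i. admissible (\<Gamma> i) (G i) (R i)" and planted: "planted e \<Gamma> G R"
    and eps: "0 \<le> \<epsilon>" and rate: "family_rate R \<le> ennreal (4 / 3 * (2 * r\<^sup>2 + \<epsilon>))"
  shows "competitor a \<Gamma> G R (\<lambda>x s y t. real_of_ereal (e x s y t)) p \<epsilon>"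
    and "s < t \<Longrightarrow> e x s y t = ereal (real_of_ereal (e x s y t))"
proof -
  have wR: "weights R" by (rule admissible_weights[OF adm])
  have fin: "family_rate R < \<infinity>" using rate by (auto intro: le_less_trans)
  note L = envelope_L32(1)[OF wR fin]
  interpret P: dominated_planting \<Gamma> G R "envelope R"
    by unfold_locales (use adm L L32_locint[OF L] envelope_dominates[OF wR fin] in \<open>auto simp: L32_def\<close>)
  have eq: "e x s y t = ereal (real_of_ereal (e x s y t))" if "s < t" for x s y t
    using P.planted_eq_clo[OF planted that, of x y] P.clo_eq[OF that, of x y] by simp
  have sup: "real_of_ereal (e x s y t) + real_of_ereal (e y t z u) \<le> real_of_ereal (e x s z u)" if "s < t" "t < u" for x s y t z u
    using P.cl_superadd[OF that, of x y z] that P.planted_eq_clo[OF planted] by (simp add: P.cl_def)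
  show "competitor a \<Gamma> G R (\<lambda>x s y t. real_of_ereal (e x s y t)) p \<epsilon>"
  proof unfold_locales
    show "planting \<Gamma> G R x s y t = ereal (real_of_ereal (e x s y t))" if "s < t" for x s y t
      using P.planted_eq_clo[OF planted that, of x y] eq[OF that, of x y] by simp
    show "real_of_ereal (e (p s) s (p v) v) + real_of_ereal (e (p v) v (p t) t) = real_of_ereal (e (p s) s (p t) t)"
      if "0 \<le> s" "s < v" "v < t" "t \<le> 1" for s v t
      by (rule geodesic_additive[OF eq sup geo(1) that])
  qed (use wR eps rate geo in auto)
  show "s < t \<Longrightarrow> e x s y t = ereal (real_of_ereal (e x s y t))" by (rule eq)
qed

lemma rate_ge:
  assumes "e \<in> through_metrics a"
  shows "ennreal (8 / 3 * r\<^sup>2) \<le> rate e"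
  unfolding rate_def
proof (rule INF_greatest)
  fix X assume "X \<in> {(\<Gamma>, G, R). (\<forall>i. admissible (\<Gamma> i) (G i) (R i)) \<and> planted e \<Gamma> G R}"
  then obtain \<Gamma> G R where X: "X = (\<Gamma>, G, R)" and adm: "\<And>i. admissible (\<Gamma> i) (G i) (R i)" and pl: "planted e \<Gamma> G R"
    by auto
  obtain p where p: "is_geodesic e p 0 1" "p 0 = 0" "p a = 1" "p 1 = 0"
    using assms by (auto simp: through_metrics_def)
  have "ennreal (8 / 3 * r\<^sup>2) \<le> family_rate R"
  proof (cases "family_rate R < \<infinity>")
    case True
    have le: "family_rate R \<le> ennreal (4 / 3 * (2 * r\<^sup>2 + enn2real (family_rate R)))"
    proof -
      have "family_rate R = ennreal (enn2real (family_rate R))" using True by simp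
      also have "\<dots> \<le> ennreal (4 / 3 * (2 * r\<^sup>2 + enn2real (family_rate R)))"
      proof (rule ennreal_leI)
        have "x \<le> 4 / 3 * (2 * y + x)" if "0 \<le> x" "0 \<le> y" for x y :: real using that by simp
        then show "enn2real (family_rate R) \<le> 4 / 3 * (2 * r\<^sup>2 + enn2real (family_rate R))" by simp
      qed
      finally show ?thesis .
    qed
    \<comment> \<open>The slack is the rate itself; \<open>I32_\<sigma>_ge\<close> holds for every
      slack.\<close>
    interpret competitor a \<Gamma> G R "\<lambda>x s y t. real_of_ereal (e x s y t)" p "enn2real (family_rate R)"
      by (rule competitor_of_planted(1)[OF assms p adm pl _ le]) simp
    show ?thesis
      unfolding envelope_L32(2)[OF wR True] using I32_\<sigma>_ge by (intro ennreal_leI) simp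
  qed (simp add: less_top[symmetric])
  then show "ennreal (8 / 3 * r\<^sup>2) \<le> (case X of (\<Gamma>, G, R) \<Rightarrow> family_rate R)" by (simp add: X)
qed

lemma rate_eopt: "rate eopt = ennreal (8 / 3 * r\<^sup>2)"
  using rate_eopt_le rate_ge[OF eopt_through] by (rule antisym)

text \<open>The distances along \<open>F\<close> are settled before the metric itself: they are at
  most those of \<open>w\<close> by subdivision, and the bound at the endpoints
  \<open>(0, 0)\<close> and \<open>(0, 1)\<close> leaves no room for strict inequality in between.
  They then give \<open>E \<le> opt.cl\<close>, and also make \<open>e\<close> a majorant of the
  optimal planting.\<close>

lemma minimiser_unique:
  assumes e: "e \<in> through_metrics a" and re: "rate e = ennreal (8 / 3 * r\<^sup>2)"
  shows "deq e eopt"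
proof -
  define E where "E = (\<lambda>x s y t. real_of_ereal (e x s y t))"
  obtain p where p: "is_geodesic e p 0 1" "p 0 = 0" "p a = 1" "p 1 = 0"
    using e by (auto simp: through_metrics_def)
  have comp: "\<exists>\<Gamma> G R. competitor a \<Gamma> G R E p \<epsilon>" and eq: "\<And>x s y t. s < t \<Longrightarrow> e x s y t = ereal (E x s y t)" if "0 < \<epsilon>" for \<epsilon>
  proof -
    have "rate e < ennreal (4 / 3 * (2 * r\<^sup>2 + \<epsilon>))"
      unfolding re using that by (intro ennreal_lessI) (auto intro!: mult_pos_pos add_nonneg_pos)
    then obtain \<Gamma> G R where *: "\<And>i. admissible (\<Gamma> i) (G i) (R i)" "planted e \<Gamma> G R"
      "family_rate R < ennreal (4 / 3 * (2 * r\<^sup>2 + \<epsilon>))"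
      unfolding rate_def INF_less_iff by auto
    show "\<exists>\<Gamma> G R. competitor a \<Gamma> G R E p \<epsilon>"
      using competitor_of_planted(1)[OF e p *(1,2) _ less_imp_le[OF *(3)]] that unfolding E_def by force
    show "s < t \<Longrightarrow> e x s y t = ereal (E x s y t)" for x s y t
      using competitor_of_planted(2)[OF e p *(1,2) _ less_imp_le[OF *(3)]] that unfolding E_def by simp
  qed
  note eq = eq[OF zero_less_one]
  obtain \<Gamma>0 G0 R0 where c0: "competitor a \<Gamma>0 G0 R0 E p 1" using comp[of 1] by auto
  interpret C: competitor a \<Gamma>0 G0 R0 E p 1 by (rule c0)
  have pF: "p t = F t" if "0 \<le> t" "t \<le> 1" for t
  proof (rule path_determined[where W = "\<lambda>t. E 0 0 (p t) t" and p = p])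
    fix \<epsilon> :: real assume "0 < \<epsilon>"
    then obtain \<Gamma> G R where "competitor a \<Gamma> G R E p \<epsilon>" using comp by blast
    then interpret D: competitor a \<Gamma> G R E p \<epsilon> .
    show "\<exists>\<sigma>. locint \<sigma> \<and> (\<forall>u. 0 \<le> \<sigma> u) \<and> \<sigma> \<in> borel_measurable borel \<and>
      (\<forall>t. 0 < t \<and> t \<le> 1 \<longrightarrow> E 0 0 (p t) t \<le> dd 0 0 (p t) t + iv \<sigma> 0 t) \<and>
      (\<forall>s t. 0 < s \<and> s < t \<and> t \<le> 1 \<longrightarrow> E 0 0 (p t) t - E 0 0 (p s) s \<le> dd (p s) s (p t) t + iv \<sigma> s t) \<and>
      iv (\<lambda>u. \<phi> u * \<sigma> u) 0 1 \<le> 2 * r\<^sup>2 + \<epsilon>"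
      using D.loc D.nonneg D.\<sigma>_meas D.W_bounds D.pairing_le by (intro exI[of _ "envelope R"]) blast
  qed (use that p C.W_bounds in auto)
  have E_\<rho>: "E x s y t \<le> dd x s y t + iv \<rho> s t" if st: "s < t" for x s y t
  proof (rule le_of_small)
    fix m :: real assume m: "0 < m" "m \<le> 1"
    \<comment> \<open>Slack \<open>m\<^sup>2\<close> produces an error linear in \<open>m\<close>,
      as \<open>le_of_small\<close> requires.\<close>
    obtain \<Gamma> G R where "competitor a \<Gamma> G R E p (m\<^sup>2)" using comp[of "m\<^sup>2"] m by auto
    then interpret D: competitor a \<Gamma> G R E p "m\<^sup>2" .
    show "E x s y t \<le> dd x s y t + iv \<rho> s t + m * (2 + 2 * r\<^sup>2 + (t - s))"
      by (rule D.E_le_\<rho>[OF m order_refl st])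
  qed
  define f where "f s t = E (F s) s (F t) t - (w t - w s)" for s t
  have f_add: "f s v + f v t = f s t" if "0 \<le> s" "s < v" "v < t" "t \<le> 1" for s v t
    using C.additive[OF that] pF[of s] pF[of v] pF[of t] that by (simp add: f_def)
  have piece: "f s t \<le> 0" if st: "0 \<le> s" "s < t" "t \<le> 1" "t \<le> a \<or> a \<le> s" for s t
  proof (rule subdivide[where f = f and d = 1 and M = "r\<^sup>2 / q\<^sup>2"])
    fix x v y assume "s \<le> x" "x < v" "v < y" "y \<le> t"
    then show "f x y \<le> f x v + f v y" using f_add[of x v y] st by simp
  next
    fix x y assume xy: "s \<le> x" "x < y" "y \<le> t"
    have "iv (\<lambda>u. (g u)\<^sup>2) x y - (F y - F x)\<^sup>2 / (y - x) \<le> r\<^sup>2 / q\<^sup>2 * (y - x)\<^sup>2"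
      using xy st by (intro energy_excess) auto
    then show "f x y \<le> r\<^sup>2 / q\<^sup>2 * (y - x)\<^sup>2"
      using E_\<rho>[of x y "F x" "F y"] gain_eq[of x y] xy st by (simp add: f_def dd_def)
  qed (use st in auto)
  have f_le: "f s t \<le> 0" if st: "0 \<le> s" "s < t" "t \<le> 1" for s t
  proof (cases "s < a \<and> a < t")
    case True
    then show ?thesis using piece[of s a] piece[of a t] f_add[of s a t] st a by simp
  qed (use piece[of s t] st in auto)
  \<comment> \<open>The Dirichlet distance from \<open>(0, 0)\<close> to \<open>(0, 1)\<close> is
    \<open>0\<close>, equal to \<open>w 1 - w 0\<close>. As \<open>f\<close> is additive and nowhere
    positive, it vanishes on all subintervals.\<close>
  have f01: "0 \<le> f 0 1"
    using C.E_lower[of 0 1 0 0] by (simp add: f_def F_ends w_ends dd_def)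
  have gain: "E (F s) s (F t) t = w t - w s" if st: "0 \<le> s" "s < t" "t \<le> 1" for s t
  proof -
    have "0 \<le> f s t"
      using f_le[of 0 s] f_le[of t 1] f_add[of 0 s t] f_add[of 0 t 1] f01 st
      by (cases "s = 0"; cases "t = 1") auto
    then show ?thesis using f_le[OF st] by (simp add: f_def)
  qed
  have upper: "E x s y t \<le> opt.cl x s y t" if st: "s < t" for x s y t
  proof (rule le_of_small)
    fix m :: real assume m: "0 < m" "m \<le> 1"
    obtain \<Gamma> G R where "competitor a \<Gamma> G R E p (m\<^sup>2)" using comp[of "m\<^sup>2"] m by auto
    then interpret D: competitor a \<Gamma> G R E p "m\<^sup>2" .
    show "E x s y t \<le> opt.cl x s y t + m * (2 * (2 + 2 * r\<^sup>2 + (t - s)))"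
      by (rule D.E_le_eopt[OF gain m order_refl st])
  qed
  have E_sup: "E x s y t + E y t z u \<le> E x s z u" if "s < t" "t < u" for x s y t z u
    using superaddD[OF C.superadd_clo that, of x y z] C.E_eq that by simp
  define k where "k s t = (if s < t then E (F s) s (F t) t else 0)" for s t
  have k_sup: "k s v + k v t \<le> k s t" if "s \<le> v" "v \<le> t" for s v t
    using that E_sup[of s v t "F s" "F v" "F t"] by (auto simp: k_def)
  have k_gain: "iv \<rho> s t - iv (\<lambda>u. (g u)\<^sup>2) s t \<le> k s t" if st: "s < t" for s t
  proof -
    have out: "0 \<le> k s t" if "s \<le> t" "t \<le> 0 \<or> 1 \<le> s" for s t
      using C.E_lower[of s t "F s" "F t"] F_outside[of s] F_outside[of t] that by (auto simp: k_def dd_def)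
    show ?thesis
    proof (cases "t \<le> 0 \<or> 1 \<le> s")
      case True
      then show ?thesis using out[of s t] iv_outside[of s t] st by simp
    next
      case False
      let ?s = "max s 0" and ?t = "min t 1"
      have "k ?s ?t = w ?t - w ?s"
        using gain[of ?s ?t] False st by (auto simp: k_def max_def min_def)
      moreover have "k s ?s + k ?s ?t \<le> k s ?t" "k s ?t + k ?t t \<le> k s t"
        using False st by (auto intro!: k_sup)
      moreover have "0 \<le> k s ?s" "0 \<le> k ?t t"
        using out[of s 0] out[of 1 t] by (auto simp: max_def min_def k_def)
      ultimately show ?thesis using gain_clip[of s t] False st by simp
    qed
  qed
  have "dle eopt e"
  proof -
    have "majorant (\<lambda>_. F) (\<lambda>_. g) R1 e"
      unfolding majorant_def
    proof (intro conjI allI)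
      show "superadd e" unfolding superadd_def by (simp add: eq E_sup)
      show "dle dirichlet e" unfolding dle_def by (simp add: eq dirichlet_eq C.E_lower)
      fix i
      show "dle (curve_metric F g (R1 i)) e"
        unfolding dle_def
      proof safe
        fix x s y t :: real assume st: "s < t"
        show "curve_metric F g (R1 i) x s y t \<le> e x s y t"
        proof (cases rule: curve_metric_cases[OF admissible_R1[of i], of x s y t])
          case 2
          have "iv (R1 i) s t \<le> iv \<rho> s t"
            by (rule iv_mono) (use R1_le admissible_locint(1)[OF admissible_R1] locint_\<rho> in auto)
          then show ?thesis using 2 k_gain[OF st] st by (simp add: eq k_def)
        qed auto
      qed
    qed
    then show ?thesis by (simp add: dle_def planting_le)
  qed
  then show ?thesis
    unfolding deq_def dle_def using upper eq opt.clo_eq by (auto intro!: antisym)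
qed

end

theorem theorem5:
  fixes a :: real
  assumes "0 < a" and "a < 1/2"
  shows "(\<exists>F g \<rho> e xB tB.
            admissible F g \<rho> \<and> planted1 e F g \<rho> \<and> e \<in> through_metrics a \<and>
            a < tB \<and>
            (\<forall>t\<in>{0..a}. F t = t / a) \<and>
            (\<forall>t\<in>{a..tB}. F t = 1 + (xB - 1) * (t - a) / (tB - a)) \<and>
            (\<forall>t\<in>{tB..1}. F t = xB * (sqrt t - t) / (sqrt tB - tB)) \<and>
            (\<forall>e'\<in>through_metrics a. rate e \<le> rate e') \<and>
            (\<forall>e'\<in>through_metrics a. rate e' = rate e \<longrightarrow> deq e' e) \<and>
            rate e = ennreal (8 / (3 * a\<^sup>2 * (3 - 2 * sqrt (2 * a))\<^sup>2)) \<and>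
            xB = 4 * (1 - sqrt (2 * a)) / (3 - 2 * sqrt (2 * a)) \<and>
            tB = 2 * a)
       \<and> ((\<lambda>b. 4 * (1 - sqrt (2 * b)) / (3 - 2 * sqrt (2 * b))) \<longlongrightarrow> 4/3) (at_right 0)
       \<and> (\<lambda>b. 8 / (3 * b\<^sup>2 * (3 - 2 * sqrt (2 * b))\<^sup>2) - 8 / (27 * b\<^sup>2))
            \<in> o[at_right 0](\<lambda>b. 1 / b\<^sup>2)"
proof (intro conjI)
  interpret passage a using assms by unfold_locales
  define xB where "xB = 4 * (1 - sqrt (2 * a)) / (3 - 2 * sqrt (2 * a))"
  have D: "0 < 3 - 2 * q" using q by simp
  have xB: "xB = 4 * (1 - q) / (3 - 2 * q)" by (simp add: xB_def q_def)
  have rD: "r * (3 - 2 * q) = 1 / a" using r(3) a by (simp add: field_simps)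
  have xB': "xB = 4 * (1 - q) * (r * a)"
  proof -
    have "1 / (3 - 2 * q) = r * a" using r(3) D by (simp add: field_simps)
    then show ?thesis unfolding xB by (simp add: divide_inverse)
  qed
  have sq: "sqrt (2 * a) = q" by (simp add: q_def)
  have r_value: "8 / 3 * r\<^sup>2 = 8 / (3 * a\<^sup>2 * (3 - 2 * sqrt (2 * a))\<^sup>2)"
  proof -
    have "r = 1 / (a * (3 - 2 * q))" using rD D a by (simp add: field_simps)
    then show ?thesis unfolding sq by (simp add: power_mult_distrib power_divide)
  qed
  have mid: "F t = 1 + (xB - 1) * (t - a) / (2 * a - a)" if "a \<le> t" "t \<le> 2 * a" for t
  proof -
    have Ft: "F t = r * (t + q\<^sup>2) - c * t"
    proof (cases "t = a")
      case True
      then show ?thesis using a by (simp add: F_def K_def q2)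
    next
      case False
      then show ?thesis using that a q(4) by (simp add: F_def K_def q2)
    qed
    have "1 = r * (3 - 2 * q) * a" using r(3) by simp
    moreover have "(xB - 1) * (t - a) / (2 * a - a) = (xB / a - 1 / a) * (t - a)" using a by (simp add: field_simps)
    moreover have "xB / a = 4 * (1 - q) * r" using a by (simp add: xB')
    ultimately have "1 + (xB - 1) * (t - a) / (2 * a - a) = r * (3 - 2 * q) * a + (4 * (1 - q) * r - r * (3 - 2 * q)) * (t - a)"
      using rD by simp
    then show ?thesis unfolding Ft by (simp add: q2 c_def algebra_simps)
  qed
  have late: "F t = xB * (sqrt t - t) / (sqrt (2 * a) - 2 * a)" if "2 * a \<le> t" "t \<le> 1" for t
  proof -
    have Ft: "F t = c * sqrt t - c * t"
    proof (cases "t = 2 * a")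
      case True
      then show ?thesis using K_cont(2) a by (simp add: F_def q2 sq)
    next
      case False
      then show ?thesis using that a q(3) by (simp add: F_def K_def q2)
    qed
    have dn: "sqrt (2 * a) - 2 * a = q * (1 - q)"
      using q2 sq by (simp add: power2_eq_square algebra_simps)
    \<comment> \<open>\<open>c * (q * (1 - q))\<close> is \<open>F (q\<^sup>2)\<close>, the position
      of the curve at time \<open>t_B\<close>.\<close>
    have xq: "xB = c * (q * (1 - q))"
      unfolding xB' c_def using q2 by (simp add: power2_eq_square algebra_simps)
    have "q * (1 - q) \<noteq> 0" using q(1,2) by simp
    then have "c * (q * (1 - q)) * (sqrt t - t) / (q * (1 - q)) = c * (sqrt t - t)" by simp
    then show ?thesis unfolding Ft dn xq by (simp add: right_diff_distrib)
  qed
  show "\<exists>F g \<rho> e xB tB.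
            admissible F g \<rho> \<and> planted1 e F g \<rho> \<and> e \<in> through_metrics a \<and>
            a < tB \<and>
            (\<forall>t\<in>{0..a}. F t = t / a) \<and>
            (\<forall>t\<in>{a..tB}. F t = 1 + (xB - 1) * (t - a) / (tB - a)) \<and>
            (\<forall>t\<in>{tB..1}. F t = xB * (sqrt t - t) / (sqrt tB - tB)) \<and>
            (\<forall>e'\<in>through_metrics a. rate e \<le> rate e') \<and>
            (\<forall>e'\<in>through_metrics a. rate e' = rate e \<longrightarrow> deq e' e) \<and>
            rate e = ennreal (8 / (3 * a\<^sup>2 * (3 - 2 * sqrt (2 * a))\<^sup>2)) \<and>
            xB = 4 * (1 - sqrt (2 * a)) / (3 - 2 * sqrt (2 * a)) \<and>
            tB = 2 * a"
    using admissible_F planted1_eopt eopt_through a F_early mid late rate_eopt rate_ge minimiser_unique r_value xB_def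
    by (intro exI[of _ F] exI[of _ g] exI[of _ \<rho>] exI[of _ eopt] exI[of _ xB] exI[of _ "2 * a"]) auto
  show "((\<lambda>b. 4 * (1 - sqrt (2 * b)) / (3 - 2 * sqrt (2 * b))) \<longlongrightarrow> 4/3) (at_right (0::real))"
    by real_asymp
  show "(\<lambda>b::real. 8 / (3 * b\<^sup>2 * (3 - 2 * sqrt (2 * b))\<^sup>2) - 8 / (27 * b\<^sup>2)) \<in> o[at_right 0](\<lambda>b. 1 / b\<^sup>2)"
    by real_asymp
qed

end
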